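(* Let $n \geq 2$ be an integer and fix $\delta > 0$. There exist $\varepsilon = \varepsilon(n,\delta) > 0$, depending only on $n$ and $\delta$, and a constant $c > 0$, depending only on $n$, such that the following holds for all integers $d \geq 1$ and $1 \leq m \leq n-1$ and every prime $p$. Let $E \subseteq Gr(n, n-m)$ be a set of subspaces and let $K \subseteq \mathbb{F}_p^n$. Assume that $$|E| \geq 2 p^{m(n-m) - m + d - 1} \quad\text{and}\quad p^{\delta} \leq |K| \leq p^{d+1-\delta}.$$ Then there exists $W \in E$ such that $$|\pi^W(K)| \geq c\, |K|^{\frac{d}{1 + d(n-m)}} \left( \frac{|E|}{p^{m(n-m)-m}} \right)^{\varepsilon}.$$
   Context: $\mathbb{F}_p$ is the field with $p$ elements, $p$ prime. $Gr(n,m)$ is the set of $m$-dimensional linear subspaces of $\mathbb{F}_p^n$. For a linear subspace $W \subseteq \mathbb{F}_p^n$, the projection map $\pi^W : \mathbb{F}_p^n \to \mathbb{F}_p^n/W$ is $\pi^W(x) = x + W$. *)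

theory Defs
  imports Complex_Main "HOL-Number_Theory.Residues" "Jordan_Normal_Form.Missing_VectorSpace"
begin

abbreviation Fp :: "nat \<Rightarrow> int ring"
  where "Fp p \<equiv> residue_ring (int p)"

text \<open>The space of vectors of length \<open>n\<close> over the field with \<open>p\<close> elements: the carrier is
  \<^term>\<open>{..<n} \<rightarrow>\<^sub>E carrier (Fp p)\<close>, so every vector is \<^term>\<open>undefined\<close> outside \<^term>\<open>{..<n}\<close>.\<close>

definition Fpn :: "nat \<Rightarrow> nat \<Rightarrow> (int, nat \<Rightarrow> int) module"
  where "Fpn p n = ring.func_space (Fp p) {..<n}"

definition Gr :: "nat \<Rightarrow> nat \<Rightarrow> nat \<Rightarrow> (nat \<Rightarrow> int) set set"
  where "Gr p n k =
    {W. subspace (Fp p) W (Fpn p n) \<and> vectorspace.dim (Fp p) ((Fpn p n)\<lparr>carrier := W\<rparr>) = k}"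

text \<open>A right coset, so that the values lie in the library's quotient \<^const>\<open>A_RCOSETS\<close>;
  addition is commutative.\<close>

definition quot_proj :: "nat \<Rightarrow> nat \<Rightarrow> (nat \<Rightarrow> int) set \<Rightarrow> (nat \<Rightarrow> int) \<Rightarrow> (nat \<Rightarrow> int) set"
  where "quot_proj p n W x = W +>\<^bsub>Fpn p n\<^esub> x"

end

theory Submission
  imports Defs "Berlekamp_Zassenhaus.Finite_Field" "Subresultants.Subresultant_Gcd"
    "HOL-Library.Function_Algebras"
begin

text \<open>Put \<open>k = n - m\<close> and let \<open>X\<close> be the largest size of a projection of \<open>K\<close>. Counting gives a subspace
  \<open>V0\<close> of dimension \<open>k - 1\<close> lying in many members of \<open>E\<close>; modulo \<open>V0\<close> these members are directions. Thin
  out \<open>K\<close>, modulo \<open>V0\<close>, until every line in one of finitely many independent directions that meets it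
  does so in at least \<open>r\<close> points, where \<open>r\<close> is about \<open>|K| / X^k\<close>. If there are \<open>d + 2\<close> independent
  directions, then \<open>r^(d+1)\<close> is at most of order \<open>X\<close>, which is better than required. Otherwise the directions span
  dimension \<open>d + 1\<close>, and \<open>r^d \<le> X\<close> gives the bound with the additional factor \<open>T^(1/(1+dk))\<close>,
  \<open>T = X / r^d\<close>. To bound \<open>T\<close> from below, project to a plane spanned by two of the directions: this
  yields a planar set of at least \<open>r\<^sup>2/T\<^sup>2\<close> points with many projections of size at most \<open>r T\<close>.

  By the Balog--Szemeredi--Gowers theorem and Ruzsa's triangle inequality, the planar problem reduces
  to bounding the number of \<open>\<lambda>\<close> for which \<open>A - A\<close>, \<open>A - \<lambda>A\<close> and \<open>A - \<lambda>\<^sup>2A\<close> all have size at most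
  \<open>T |A|\<close>. For each such \<open>\<lambda>\<close> many lines with direction \<open>(1, \<lambda>, \<lambda>\<^sup>2)\<close> are rich in points of \<open>A\<^sup>3\<close>. A polynomial
  of low degree vanishing on \<open>A\<^sup>3\<close> to high order in all these directions vanishes on all rich lines, and one of its
  prime factors \<open>g\<close> contains more than its share of them. By Bezout's theorem \<open>g\<close> divides many translates of the
  polynomial, which has too few prime factors for the translates of \<open>g\<close> to be distinct. So \<open>g\<close> has a
  translation symmetry, hence is a plane, and a plane contains too few rich lines.\<close>

section \<open>Polynomials in two variables and their common zeros\<close>

text \<open>The exponent comes from eliminating \<open>r\<close>: \<open>|K|\<close> is at most of
  order \<open>r X^k\<close> and \<open>r^d \<le> X\<close>, so \<open>X\<close> is at least of
  order \<open>|K|^(d/(1+dk))\<close>. That at least \<open>d + 1\<close> independent directions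
  exist is a count: modulo \<open>V0\<close> there are nearly \<open>2 p^(d-1)\<close> directions,
  and a span of dimension \<open>d\<close> has room for only \<open>(p^d - 1)/(p - 1)\<close>.

  Any gain beyond this exponent must use that the field has no proper subfield: for a subfield
  \<open>A\<close>, the set \<open>A - \<lambda>A\<close> equals \<open>A\<close> for every
  \<open>\<lambda>\<close> in \<open>A\<close>. Primality enters through the translation symmetry:
  if \<open>g\<close> divides its translate by \<open>t\<close>, it divides the translates by all
  integer multiples of \<open>t\<close>, and over a prime field these multiples fill a whole line.
  The bound \<open>|K| \<le> p^(d+1-\<delta>)\<close> excludes the remaining obstruction, a planar
  set that fills most of the plane.

  The constant \<open>c\<close> is independent of \<delta> because \<delta> affects only the
  exponent \<epsilon>; the constant absorbs the numerical losses and, trivially, all primes below a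
  bound linear in \<open>n\<close>.\<close>

definition inner_degree :: "'a::comm_semiring_1 poly poly \<Rightarrow> nat"
  where "inner_degree f = Max ((\<lambda>i. degree (coeff f i)) ` {..degree f})"

lemma degree_coeff_le_inner_degree: "degree (coeff f i) \<le> inner_degree f"
proof (cases "i \<le> degree f")
  case True
  then show ?thesis unfolding inner_degree_def by (intro Max_ge) auto
next
  case False
  then show ?thesis by (simp add: coeff_eq_0)
qed

lemma inner_degree_le: "(\<And>i. degree (coeff f i) \<le> n) \<Longrightarrow> inner_degree f \<le> n"
  unfolding inner_degree_def by (intro Max.boundedI) auto

lemma inner_degree_attained: "\<exists>i. degree (coeff f i) = inner_degree f"
proof -
  have "inner_degree f \<in> (\<lambda>i. degree (coeff f i)) ` {..degree f}"
    unfolding inner_degree_def by (intro Max_in) auto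
  then show ?thesis by auto
qed

lemma coeff_mult_at_bounds:
  fixes a b :: "'a::comm_semiring_1 poly"
  assumes "degree a \<le> m" "degree b \<le> n"
  shows "coeff (a * b) (m + n) = coeff a m * coeff b n"
proof -
  have "coeff (a * b) (m + n) = (\<Sum>i\<le>m + n. coeff a i * coeff b (m + n - i))"
    by (simp add: coeff_mult)
  also have "\<dots> = (\<Sum>i\<in>{m}. coeff a i * coeff b (m + n - i))"
  proof (intro sum.mono_neutral_right)
    show "\<forall>i\<in>{..m + n} - {m}. coeff a i * coeff b (m + n - i) = 0"
    proof
      fix i assume i: "i \<in> {..m + n} - {m}"
      then consider "i > m" | "m + n - i > n" by fastforce
      then show "coeff a i * coeff b (m + n - i) = 0"
        using assms by cases (auto simp: coeff_eq_0)
    qed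
  qed auto
  finally show ?thesis by simp
qed

text \<open>For \<open>n = inner_degree f\<close> this is the leading coefficient of
  \<open>f\<close> after the two indeterminates have been exchanged.\<close>

definition inner_lead :: "'a::comm_semiring_1 poly poly \<Rightarrow> nat \<Rightarrow> 'a poly"
  where "inner_lead f n = map_poly (\<lambda>q. coeff q n) f"

lemma inner_lead_mult:
  assumes "inner_degree f \<le> m" "inner_degree g \<le> n"
  shows "inner_lead (f * g) (m + n) = inner_lead f m * inner_lead g n"
proof (rule poly_eqI)
  fix i
  have *: "degree (coeff f j) \<le> m" "degree (coeff g j) \<le> n" for j
    using assms degree_coeff_le_inner_degree order_trans by blast+
  have "coeff (inner_lead (f * g) (m + n)) i
      = (\<Sum>j\<le>i. coeff (coeff f j * coeff g (i - j)) (m + n))"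
    by (simp add: inner_lead_def coeff_map_poly coeff_mult[of f g] coeff_sum)
  also have "\<dots> = (\<Sum>j\<le>i. coeff (coeff f j) m * coeff (coeff g (i - j)) n)"
    by (simp only: coeff_mult_at_bounds[OF *])
  also have "\<dots> = coeff (inner_lead f m * inner_lead g n) i"
    by (simp add: inner_lead_def coeff_map_poly coeff_mult)
  finally show "coeff (inner_lead (f * g) (m + n)) i = coeff (inner_lead f m * inner_lead g n) i" .
qed

lemma inner_lead_nonzero:
  assumes "f \<noteq> 0"
  shows "inner_lead f (inner_degree f) \<noteq> 0"
proof (cases "inner_degree f = 0")
  case True
  have "coeff f (degree f) \<noteq> 0" using assms by simp
  moreover have "degree (coeff f (degree f)) = 0"
    using degree_coeff_le_inner_degree[of f "degree f"] True by simp
  ultimately have "coeff (coeff f (degree f)) 0 \<noteq> 0"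
    by (metis leading_coeff_neq_0)
  then have "coeff (inner_lead f (inner_degree f)) (degree f) \<noteq> 0"
    using True by (simp add: inner_lead_def coeff_map_poly)
  then show ?thesis by auto
next
  case False
  obtain i where i: "degree (coeff f i) = inner_degree f" using inner_degree_attained by blast
  then have "coeff (coeff f i) (inner_degree f) \<noteq> 0"
    using False by (metis degree_0 leading_coeff_neq_0)
  then have "coeff (inner_lead f (inner_degree f)) i \<noteq> 0"
    by (simp add: inner_lead_def coeff_map_poly)
  then show ?thesis by auto
qed

lemma inner_degree_mult_le: "inner_degree (f * g) \<le> inner_degree f + inner_degree g"
proof (rule inner_degree_le)
  fix i
  show "degree (coeff (f * g) i) \<le> inner_degree f + inner_degree g"
    unfolding coeff_mult
    by (intro degree_sum_le order_trans[OF degree_mult_le] add_mono degree_coeff_le_inner_degree) auto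
qed

lemma inner_degree_mult:
  fixes f g :: "'a::idom poly poly"
  assumes "f \<noteq> 0" "g \<noteq> 0"
  shows "inner_degree (f * g) = inner_degree f + inner_degree g"
proof (rule antisym[OF inner_degree_mult_le])
  have "inner_lead (f * g) (inner_degree f + inner_degree g) \<noteq> 0"
    using assms by (simp add: inner_lead_mult inner_lead_nonzero)
  then obtain i where "coeff (inner_lead (f * g) (inner_degree f + inner_degree g)) i \<noteq> 0"
    using leading_coeff_neq_0 by blast
  then have "coeff (coeff (f * g) i) (inner_degree f + inner_degree g) \<noteq> 0"
    by (simp add: inner_lead_def coeff_map_poly)
  then show "inner_degree f + inner_degree g \<le> inner_degree (f * g)"
    using le_degree degree_coeff_le_inner_degree order_trans by blast
qed

lemma inner_degree_add_le:
  assumes "inner_degree f \<le> n" "inner_degree g \<le> n"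
  shows "inner_degree (f + g) \<le> n"
  by (intro inner_degree_le) (simp add: degree_add_le order_trans[OF degree_coeff_le_inner_degree] assms)

text \<open>Both partial degrees are additive over a domain, so this measure is additive on
  factorizations and also controls resultants. In the application the coefficient ring is
  \<open>F[m]\<close>, and the degree in \<open>m\<close> is deliberately left uncounted.\<close>

definition bidegree :: "'a::comm_semiring_1 poly poly \<Rightarrow> nat"
  where "bidegree f = degree f + inner_degree f"

lemma bidegree_mult:
  fixes f g :: "'a::idom poly poly"
  assumes "f \<noteq> 0" "g \<noteq> 0"
  shows "bidegree (f * g) = bidegree f + bidegree g"
  using assms by (simp add: bidegree_def degree_mult_eq inner_degree_mult)

lemma bidegree_1 [simp]: "bidegree (1 :: 'a::comm_semiring_1 poly poly) = 0"
  by (simp add: bidegree_def inner_degree_def)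

lemma bidegree_dvd_1:
  fixes f :: "'a::idom poly poly"
  assumes "f dvd 1"
  shows "bidegree f = 0"
proof -
  obtain g where "1 = f * g" using assms by (auto elim: dvdE)
  moreover from this have "f \<noteq> 0" "g \<noteq> 0" by auto
  ultimately show ?thesis using bidegree_mult[of f g] bidegree_1[where 'a='a] by simp
qed

lemma bidegree_prod_mset:
  fixes A :: "'a::idom poly poly multiset"
  assumes "0 \<notin># A"
  shows "bidegree (prod_mset A) = (\<Sum>f\<in>#A. bidegree f)"
  using assms by (induction A) (auto simp: bidegree_mult prod_mset_zero_iff)

section \<open>A Bezout bound from resultants\<close>

text \<open>Each term of the determinant takes one entry from every row of the Sylvester matrix:
  \<open>degree g\<close> rows hold coefficients of \<open>f\<close>, and \<open>degree f\<close>
  rows hold coefficients of \<open>g\<close>.\<close>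

lemma degree_resultant_le:
  fixes f g :: "'a::idom poly poly"
  shows "degree (resultant f g) \<le> degree g * inner_degree f + degree f * inner_degree g"
proof -
  let ?m = "degree f" and ?n = "degree g"
  let ?S = "sylvester_mat f g"
  have S: "?S \<in> carrier_mat (?m + ?n) (?m + ?n)" by (rule sylvester_carrier_mat)
  define b where "b i = (if i < ?n then inner_degree f else inner_degree g)" for i
  have entry: "degree (?S $$ (i, j)) \<le> b i" if "i < ?m + ?n" "j < ?m + ?n" for i j
    using that by (auto simp: sylvester_index_mat b_def degree_coeff_le_inner_degree)
  have sumb: "(\<Sum>i = 0..<?m + ?n. b i) = ?n * inner_degree f + ?m * inner_degree g"
  proof -
    have "(\<Sum>i = 0..<?m + ?n. b i) = (\<Sum>i = 0..<?n. b i) + (\<Sum>i = ?n..<?n + ?m. b i)"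
      by (simp add: sum.atLeastLessThan_concat add.commute)
    also have "(\<Sum>i = 0..<?n. b i) = ?n * inner_degree f" by (simp add: b_def)
    also have "(\<Sum>i = ?n..<?n + ?m. b i) = ?m * inner_degree g" by (simp add: b_def)
    finally show ?thesis .
  qed
  have *: "(\<Sum>x = 0..<?m + ?n. degree (?S $$ (x, p x))) \<le> ?n * inner_degree f + ?m * inner_degree g"
    if p: "p permutes {0..<?m + ?n}" for p
  proof -
    have "(\<Sum>x = 0..<?m + ?n. degree (?S $$ (x, p x))) \<le> (\<Sum>x = 0..<?m + ?n. b x)"
      by (rule sum_mono[OF entry]) (use p permutes_in_image[OF p] in auto)
    then show ?thesis using sumb by simp
  qed
  show ?thesis unfolding resultant_def det_def'[OF S]
    apply (rule degree_sum_le)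
     apply (simp_all add: finite_permutations)
    apply (drule *)
    apply (rule order.trans [OF degree_mult_le])
    apply simp
    apply (rule order.trans [OF degree_prod_sum_le])
     apply simp_all
    done
qed

text \<open>After specialization at \<open>x\<close>, the vector of powers of \<open>y\<close> lies
  in the kernel of the Sylvester matrix, since each row lists the coefficients of a monomial
  multiple of \<open>f\<close> or \<open>g\<close>. The matrix is specialized rather than the
  polynomials, whose leading coefficients might vanish at \<open>x\<close>.\<close>

lemma resultant_common_zero:
  fixes f g :: "'a::idom poly poly"
  assumes f: "poly (poly f [:y:]) x = 0" and g: "poly (poly g [:y:]) x = 0"
    and pos: "degree f + degree g > 0"
  shows "poly (resultant f g) x = 0"
proof -
  let ?m = "degree f" and ?n = "degree g"
  let ?N = "?m + ?n"
  let ?S = "map_mat (\<lambda>q. poly q x) (sylvester_mat f g)"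
  define v where "v = vec ?N (\<lambda>j. y ^ (?N - 1 - j))"
  have S: "?S \<in> carrier_mat ?N ?N" using sylvester_carrier_mat[of f g] by simp
  have ev: "(\<Sum>l<?N. poly (coeff P l) x * y ^ l) = poly (poly P [:y:]) x"
    if "degree P < ?N" for P :: "'a poly poly"
  proof -
    have "poly P [:y:] = (\<Sum>l\<le>degree P. coeff P l * [:y:] ^ l)" by (simp add: poly_altdef)
    also have "\<dots> = (\<Sum>l<?N. coeff P l * [:y:] ^ l)"
      by (rule sum.mono_neutral_left) (use that in \<open>auto simp: coeff_eq_0\<close>)
    finally show ?thesis by (simp add: poly_sum poly_power)
  qed
  have row: "(\<Sum>j<?N. poly (s j) x * y ^ (?N - 1 - j)) = 0"
    if s: "\<And>j. j < ?N \<Longrightarrow> s j = coeff P (?N - 1 - j)" and P: "degree P < ?N"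
      "poly (poly P [:y:]) x = 0" for s :: "nat \<Rightarrow> 'a poly" and P
  proof -
    have "(\<Sum>j<?N. poly (s j) x * y ^ (?N - 1 - j))
        = (\<Sum>j<?N. poly (coeff P (?N - 1 - j)) x * y ^ (?N - 1 - j))"
      using s by simp
    also have "\<dots> = (\<Sum>l<?N. poly (coeff P l) x * y ^ l)"
      using sum.nat_diff_reindex[of "\<lambda>l. poly (coeff P l) x * y ^ l" ?N]
      by (simp add: diff_diff_left)
    finally show ?thesis using ev[OF P(1)] P(2) by simp
  qed
  have "?S *\<^sub>v v = 0\<^sub>v ?N"
  proof (rule eq_vecI)
    show "dim_vec (?S *\<^sub>v v) = dim_vec (0\<^sub>v ?N :: 'a vec)" using S by simp
    fix i assume "i < dim_vec (0\<^sub>v ?N :: 'a vec)"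
    then have i: "i < ?N" by simp
    have "(?S *\<^sub>v v) $ i = (\<Sum>j<?N. poly (sylvester_mat f g $$ (i, j)) x * y ^ (?N - 1 - j))"
      using i S by (simp add: scalar_prod_def v_def atLeast0LessThan)
    also have "\<dots> = 0"
    proof (cases "i < ?n")
      case True
      show ?thesis
      proof (rule row[where P = "monom 1 (?n - i - 1) * f"])
        show "degree (monom 1 (?n - i - 1) * f) < ?N"
          using True by (intro le_less_trans[OF degree_mult_le]) (simp add: degree_monom_eq)
        show "poly (poly (monom 1 (?n - i - 1) * f) [:y:]) x = 0" using f by simp
        show "sylvester_mat f g $$ (i, j) = coeff (monom 1 (?n - i - 1) * f) (?N - 1 - j)"
          if "j < ?N" for j
          using that i True by (auto simp: sylvester_index_mat2 coeff_monom_mult)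
      qed
    next
      case False
      show ?thesis
      proof (rule row[where P = "monom 1 (?N - i - 1) * g"])
        show "degree (monom 1 (?N - i - 1) * g) < ?N"
          using False i by (intro le_less_trans[OF degree_mult_le]) (simp add: degree_monom_eq)
        show "poly (poly (monom 1 (?N - i - 1) * g) [:y:]) x = 0" using g by simp
        show "sylvester_mat f g $$ (i, j) = coeff (monom 1 (?N - i - 1) * g) (?N - 1 - j)"
          if "j < ?N" for j
          using that i False by (auto simp: sylvester_index_mat2 coeff_monom_mult)
      qed
    qed
    finally show "(?S *\<^sub>v v) $ i = 0\<^sub>v ?N $ i" using i by simp
  qed
  moreover have "v \<noteq> 0\<^sub>v ?N"
  proof
    assume "v = 0\<^sub>v ?N"
    then have "v $ (?N - 1) = 0" using pos by simp
    then show False using pos by (simp add: v_def)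
  qed
  moreover have "v \<in> carrier_vec ?N" by (simp add: v_def)
  ultimately have "det ?S = 0" using det_0_iff_vec_prod_zero[OF S] by blast
  then show ?thesis by (simp only: resultant_def comm_ring_hom.hom_det[OF poly_hom.comm_ring_hom_axioms])
qed

text \<open>A prime \<open>g\<close> not dividing \<open>q\<close> is coprime to it, so the
  resultant is nonzero, and every common zero contributes the root \<open>X i\<close>. Injectivity
  of \<open>X\<close> replaces the usual generic change of coordinates.\<close>

lemma card_common_zeros_le:
  fixes g q :: "'a::{factorial_ring_gcd,semiring_gcd_mult_normalize} poly poly"
  assumes g: "prime_elem g" and ndvd: "\<not> g dvd q"
    and inj: "inj_on X I" and fin: "finite I"
    and g0: "\<And>i. i \<in> I \<Longrightarrow> poly (poly g [:Y i:]) (X i) = 0"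
    and q0: "\<And>i. i \<in> I \<Longrightarrow> poly (poly q [:Y i:]) (X i) = 0"
  shows "card I \<le> bidegree g * bidegree q"
proof -
  have roots: "card I \<le> degree r" if "r \<noteq> 0" "\<And>i. i \<in> I \<Longrightarrow> poly r (X i) = 0" for r :: "'a poly"
  proof -
    have "card I = card (X ` I)" using inj by (simp add: card_image)
    also have "\<dots> \<le> card {x. poly r x = 0}"
      using that by (intro card_mono) (auto simp: poly_roots_finite)
    also have "\<dots> \<le> degree r" using that by (simp add: card_poly_roots_bound)
    finally show ?thesis .
  qed
  have g_nz: "g \<noteq> 0" and q_nz: "q \<noteq> 0" using g ndvd by auto
  show ?thesis
  proof (cases "degree g = 0")
    \<comment> \<open>Here the resultant may carry no information: it is \<open>1\<close> if
      \<open>q\<close> is constant in the outer variable too. But \<open>g\<close> is then itself a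
      univariate polynomial that vanishes at all \<open>X i\<close>.\<close>
    case True
    then obtain g' where g': "g = [:g':]" by (meson degree_eq_zeroE)
    show ?thesis
    proof (cases "bidegree q = 0")
      case True
      then have dq: "degree q = 0" "inner_degree q = 0" by (auto simp: bidegree_def)
      then obtain q' where q': "q = [:q':]" by (meson degree_eq_zeroE)
      have "degree q' = 0" using dq degree_coeff_le_inner_degree[of q 0] by (simp add: q')
      then obtain q'' where q'': "q' = [:q'':]" by (meson degree_eq_zeroE)
      have "q'' \<noteq> 0" using q_nz q' q'' by auto
      then have "I = {}" using q0 by (auto simp: q' q'')
      then show ?thesis by simp
    next
      case False
      have "card I \<le> degree g'" using g_nz g0 by (intro roots) (auto simp: g')
      also have "\<dots> \<le> bidegree g" using degree_coeff_le_inner_degree[of g 0] by (simp add: g' bidegree_def)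
      also have "\<dots> \<le> bidegree g * bidegree q" using False by simp
      finally show ?thesis .
    qed
  next
    case False
    have "coprime g q" using g ndvd by (simp add: prime_elem_imp_coprime)
    then have "degree (gcd g q) = 0" by (simp add: coprime_iff_gcd_eq_1)
    then have nz: "resultant g q \<noteq> 0" by (simp add: resultant_0_gcd)
    have "card I \<le> degree (resultant g q)"
      using False by (intro roots nz resultant_common_zero[OF g0 q0]) auto
    also have "\<dots> \<le> degree q * inner_degree g + degree g * inner_degree q"
      by (rule degree_resultant_le)
    also have "\<dots> \<le> bidegree g * bidegree q" by (simp add: bidegree_def algebra_simps)
    finally show ?thesis .
  qed
qed

section \<open>Surfaces containing many lines\<close>

text \<open>A polynomial in \<open>m, k, h\<close> is encoded as an element of \<open>F[m][\<kappa>][h]\<close> with \<open>\<kappa> = k + m\<^sup>2 h\<close>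
  (innermost indeterminate \<open>m\<close>). The line of all \<open>(m, x + l m, y + l\<^sup>2 m)\<close>, where \<open>b = (x, y)\<close>, is then a
  single point of the plane over \<open>F[m]\<close>, and translating \<open>k\<close> and \<open>h\<close> by \<open>t\<close> translates this plane.\<close>

definition line_eval :: "'a::comm_ring_1 \<Rightarrow> 'a \<times> 'a \<Rightarrow> 'a poly poly poly \<Rightarrow> 'a poly"
  where "line_eval l b f = poly (poly f [:[:snd b, l^2:]:]) [:fst b, l, snd b, l^2:]"

definition shift :: "'a::comm_ring_1 \<Rightarrow> 'a poly \<Rightarrow> 'a poly"
  where "shift a q = q \<circ>\<^sub>p [:a, 1:]"

lemma inner_degree_1 [simp]: "inner_degree (1 :: 'a::comm_semiring_1 poly poly) = 0"
  by (simp add: inner_degree_def)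

text \<open>Since \<kappa> is \<open>k + m^2 h\<close>, adding \<open>t\<close> to the pair
  \<open>(k, h)\<close> adds \<open>fst t + m^2 * snd t\<close> to \<kappa>; this is the shift
  \<open>[:fst t, 0, snd t:]\<close>.\<close>

definition translate :: "'a::comm_ring_1 \<times> 'a \<Rightarrow> 'a poly poly poly \<Rightarrow> 'a poly poly poly"
  where "translate t f = shift [:[:snd t:]:] (map_poly (shift [:fst t, 0, snd t:]) f)"

lemma shift_simps [simp]:
  "shift a (f + g) = shift a f + shift a g" "shift a (f * g) = shift a f * shift a g"
  "shift a 0 = 0" "shift a 1 = 1" "shift a [:c:] = [:c:]" "shift a (pCons c 1) = pCons (c + a) 1"
  by (simp_all add: shift_def pcompose_add pcompose_mult pcompose_pCons)

lemma shift_pCons: "shift a (pCons c q) = [:c:] + [:a, 1:] * shift a q"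
  by (simp add: shift_def pcompose_pCons)

lemma shift_shift: "shift a (shift b q) = shift (a + b) q"
  by (induction q) (simp_all add: shift_pCons add_ac del: mult_pCons_left)

lemma shift_zero [simp]: "shift 0 q = q"
  by (induction q) (simp_all add: shift_pCons)

lemma poly_shift [simp]: "poly (shift a q) x = poly q (x + a)"
  by (simp add: shift_def poly_pcompose add_ac)

lemma degree_shift_le: "degree (shift a q) \<le> degree q"
  unfolding shift_def by (rule order_trans[OF degree_pcompose_le]) simp

lemma map_poly_shift_pCons: "map_poly (shift a) (pCons c q) = pCons (shift a c) (map_poly (shift a) q)"
  by (rule poly_eqI) (simp add: coeff_map_poly coeff_pCons split: nat.splits)

lemma map_poly_shift_simps:
  "map_poly (shift a) (f + g) = map_poly (shift a) f + map_poly (shift a) g"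
  "map_poly (shift a) (f * g) = map_poly (shift a) f * map_poly (shift a) g"
  "map_poly (shift a) 1 = 1"
proof -
  interpret m: map_poly_comm_ring_hom "shift a" by unfold_locales simp_all
  show "map_poly (shift a) (f + g) = map_poly (shift a) f + map_poly (shift a) g"
    "map_poly (shift a) (f * g) = map_poly (shift a) f * map_poly (shift a) g"
    "map_poly (shift a) 1 = 1"
    by (simp_all only: m.hom_add m.hom_mult m.hom_one)
qed

lemma line_eval_simps [simp]:
  "line_eval l b (f + g) = line_eval l b f + line_eval l b g"
  "line_eval l b (f * g) = line_eval l b f * line_eval l b g"
  "line_eval l b 1 = 1" "line_eval l b 0 = 0"
  by (simp_all add: line_eval_def)

lemma translate_simps [simp]:
  "translate t (f + g) = translate t f + translate t g"
  "translate t (f * g) = translate t f * translate t g"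
  "translate t 1 = 1" "translate t 0 = 0"
  by (simp_all add: translate_def map_poly_shift_simps)

lemma line_eval_pCons:
  "line_eval l b (pCons q f) = poly q [:fst b, l, snd b, l^2:] + [:snd b, l^2:] * line_eval l b f"
  by (simp add: line_eval_def)

lemma translate_pCons:
  "translate t (pCons q f) = [:shift [:fst t, 0, snd t:] q:] + [:[:[:snd t:]:], 1:] * translate t f"
  by (simp add: translate_def map_poly_shift_pCons shift_pCons del: mult_pCons_left)

lemma line_eval_translate:
  "line_eval l b (translate t f) = line_eval l (fst b + fst t, snd b + snd t) f"
proof (induction f)
  case (pCons q f)
  have "line_eval l b (translate t (pCons q f))
      = line_eval l b [:shift [:fst t, 0, snd t:] q:]
        + line_eval l b [:[:[:snd t:]:], 1:] * line_eval l b (translate t f)"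
    by (simp add: translate_pCons del: mult_pCons_left mult_pCons_right)
  also have "line_eval l b [:shift [:fst t, 0, snd t:] q:]
      = poly q [:fst b + fst t, l, snd b + snd t, l^2:]"
    by (simp add: line_eval_def add_ac)
  also have "line_eval l b [:[:[:snd t:]:], 1:] = [:snd b + snd t, l^2:]"
    by (simp add: line_eval_def add_ac)
  finally show ?case using pCons by (simp add: line_eval_pCons)
qed (simp add: line_eval_def)

lemma inner_degree_const [simp]: "inner_degree [:q:] = degree q"
proof (rule antisym)
  show "inner_degree [:q:] \<le> degree q"
    by (intro inner_degree_le) (simp add: coeff_pCons split: nat.splits)
  show "degree q \<le> inner_degree [:q:]" using degree_coeff_le_inner_degree[of "[:q:]" 0] by simp
qed

lemma inner_degree_0 [simp]: "inner_degree 0 = 0"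
  by (simp add: inner_degree_def)

lemma inner_degree_pCons: "inner_degree (pCons q f) = max (degree q) (inner_degree f)"
proof (rule antisym)
  show "inner_degree (pCons q f) \<le> max (degree q) (inner_degree f)"
    by (intro inner_degree_le) (simp add: coeff_pCons degree_coeff_le_inner_degree le_max_iff_disj split: nat.splits)
  have "degree (coeff f i) \<le> inner_degree (pCons q f)" for i
    using degree_coeff_le_inner_degree[of "pCons q f" "Suc i"] by simp
  then have "inner_degree f \<le> inner_degree (pCons q f)" by (rule inner_degree_le)
  moreover have "degree q \<le> inner_degree (pCons q f)"
    using degree_coeff_le_inner_degree[of "pCons q f" 0] by simp
  ultimately show "max (degree q) (inner_degree f) \<le> inner_degree (pCons q f)" by simp
qed

lemma bidegree_translate_le:
  fixes f :: "'a::idom poly poly poly"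
  shows "bidegree (translate t f) \<le> bidegree f"
proof -
  have "degree (translate t f) \<le> degree f"
    unfolding translate_def by (rule order_trans[OF degree_shift_le degree_map_poly_le])
  moreover have "inner_degree (translate t f) \<le> inner_degree f"
  proof (induction f)
    case (pCons q f)
    have "inner_degree ([:[:[:snd t:]:], 1:] * translate t f) \<le> inner_degree f"
      using pCons inner_degree_mult_le[of "[:[:[:snd t:]:], 1:]" "translate t f"]
      by (simp add: inner_degree_pCons[of "[:[:snd t:]:]"] del: mult_pCons_left)
    moreover have "degree (shift [:fst t, 0, snd t:] q) \<le> degree q"
      by (rule degree_shift_le)
    ultimately show ?case unfolding translate_pCons
      by (intro inner_degree_add_le) (auto simp: inner_degree_pCons le_max_iff_disj)
  qed simp
  ultimately show ?thesis by (simp add: bidegree_def)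
qed

lemma translate_translate:
  fixes f :: "'a::comm_ring_1 poly poly poly"
  shows "translate s (translate t f) = translate (fst s + fst t, snd s + snd t) f"
proof (induction f)
  case (pCons q f)
  have a: "translate s [:q':] = [:shift [:fst s, 0, snd s:] q':]" for q'
    by (simp add: translate_def map_poly_shift_pCons)
  have b: "translate s [:[:[:c:]:], 1:] = [:[:[:c + snd s:]:], 1:]" for c
    by (simp add: translate_def map_poly_shift_pCons)
  show ?case
    unfolding translate_pCons translate_simps a b pCons by (simp add: shift_shift add_ac)
qed simp

lemma translate_0 [simp]: "translate (0, 0) f = f"
proof -
  have "shift [:0, 0, 0:] = (\<lambda>q::'a poly poly. q)" by (auto simp: fun_eq_iff)
  then show ?thesis by (simp add: translate_def)
qed

lemma translate_uminus:
  "translate (- fst t, - snd t) (translate t f) = f" "translate t (translate (- fst t, - snd t) f) = f"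
  by (simp_all add: translate_translate)

lemma bidegree_translate:
  fixes f :: "'a::idom poly poly poly"
  shows "bidegree (translate t f) = bidegree f"
  using bidegree_translate_le[of t f] bidegree_translate_le[of "(- fst t, - snd t)" "translate t f"]
  by (simp add: translate_uminus)

lemma translate_dvd: "f dvd g \<Longrightarrow> translate t f dvd translate t g"
  by (metis dvd_def translate_simps(2))

lemma translate_dvd_iff: "translate t f dvd translate t g \<longleftrightarrow> f dvd g"
  by (metis translate_dvd translate_uminus(1))

lemma prime_elem_translate:
  fixes f :: "'a::idom poly poly poly"
  assumes "prime_elem f"
  shows "prime_elem (translate t f)"
proof (rule prime_elemI)
  show "translate t f \<noteq> 0" using assms translate_uminus(1)[of t f] by auto
  show "\<not> translate t f dvd 1"
    using assms translate_dvd_iff[of t f 1] by (auto simp: prime_elem_def)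
  fix a b assume "translate t f dvd a * b"
  then have "f dvd translate (- fst t, - snd t) a * translate (- fst t, - snd t) b"
    by (metis translate_dvd translate_simps(2) translate_uminus(1))
  then have "f dvd translate (- fst t, - snd t) a \<or> f dvd translate (- fst t, - snd t) b"
    using assms by (simp add: prime_elem_dvd_mult_iff)
  then show "translate t f dvd a \<or> translate t f dvd b"
    by (metis translate_dvd translate_uminus(2))
qed

section \<open>Interpolation: a polynomial of low degree vanishing on all rich lines\<close>

definition box_poly :: "nat \<Rightarrow> (nat \<times> nat \<times> nat \<Rightarrow> 'a::comm_ring_1) \<Rightarrow> 'a poly poly poly"
  where "box_poly e \<phi> =
    (\<Sum>(a, b, c)\<in>{..e} \<times> {..e} \<times> {..e}. monom (monom (monom (\<phi> (a, b, c)) a) b) c)"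

lemma coeff_box_poly:
  assumes "a \<le> e" "b \<le> e" "c \<le> e"
  shows "coeff (coeff (coeff (box_poly e \<phi>) c) b) a = \<phi> (a, b, c)"
proof -
  have "coeff (coeff (coeff (box_poly e \<phi>) c) b) a
      = (\<Sum>i\<in>{..e} \<times> {..e} \<times> {..e}. if i = (a, b, c) then \<phi> i else 0)"
    unfolding box_poly_def coeff_sum by (intro sum.cong) (auto simp: coeff_monom split: if_splits)
  then show ?thesis using assms by simp
qed

lemma bidegree_box_poly: "bidegree (box_poly e \<phi>) \<le> 2 * e"
proof -
  have "degree (box_poly e \<phi>) \<le> e"
    unfolding box_poly_def by (intro degree_sum_le) (auto intro: order_trans[OF degree_monom_le])
  moreover have "inner_degree (box_poly e \<phi>) \<le> e"
  proof (rule inner_degree_le)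
    fix i show "degree (coeff (box_poly e \<phi>) i) \<le> e"
      unfolding box_poly_def coeff_sum
      by (intro degree_sum_le) (auto simp: coeff_monom intro: order_trans[OF degree_monom_le])
  qed
  ultimately show ?thesis by (simp add: bidegree_def)
qed

lemma line_eval_box_poly:
  "line_eval l v (box_poly e \<phi>) = (\<Sum>(a, b, c)\<in>{..e} \<times> {..e} \<times> {..e}.
     [:\<phi> (a, b, c):] * [:0, 1:] ^ a * [:fst v, l, snd v, l^2:] ^ b * [:snd v, l^2:] ^ c)"
  unfolding line_eval_def box_poly_def poly_sum
  by (intro sum.cong) (auto simp: poly_monom monom_altdef algebra_simps)

text \<open>Along a line of direction \<open>(1, \<lambda>, \<lambda>^2)\<close> the distance
  \<open>s\<close> (outer indeterminate) is always accompanied by \<open>1\<close>, \<lambda> or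
  \<open>\<lambda>^2\<close>, so a coefficient of \<open>s^i\<close> has degree at most
  \<open>2 * i\<close> in \<lambda>. The condition is closed under sums and products.\<close>

definition weighted :: "'a::comm_ring_1 poly poly set"
  where "weighted = {q. \<forall>i. degree (coeff q i) \<le> 2 * i}"

lemma weighted_add: "p \<in> weighted \<Longrightarrow> q \<in> weighted \<Longrightarrow> p + q \<in> weighted"
  by (auto simp: weighted_def intro: degree_add_le)

lemma weighted_mult:
  assumes "p \<in> weighted" "q \<in> weighted"
  shows "p * q \<in> weighted"
proof -
  have "degree (coeff p j * coeff q (i - j)) \<le> 2 * i" if "j \<le> i" for i j
  proof -
    have "degree (coeff p j * coeff q (i - j)) \<le> degree (coeff p j) + degree (coeff q (i - j))"
      by (rule degree_mult_le)
    also have "\<dots> \<le> 2 * j + 2 * (i - j)"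
      using assms by (intro add_mono) (auto simp: weighted_def)
    finally show ?thesis using that by simp
  qed
  then show ?thesis by (auto simp: weighted_def coeff_mult intro: degree_sum_le)
qed

lemma weighted_power: "p \<in> weighted \<Longrightarrow> p ^ n \<in> weighted"
proof (induction n)
  case 0
  then show ?case by (simp add: weighted_def)
next
  case (Suc n)
  then show ?case unfolding power_Suc by (intro weighted_mult)
qed

lemma weighted_sum: "(\<And>i. i \<in> I \<Longrightarrow> f i \<in> weighted) \<Longrightarrow> sum f I \<in> weighted"
proof (induction I rule: infinite_finite_induct)
  case (insert x F)
  then show ?case by (simp add: weighted_add)
qed (simp_all add: weighted_def)

text \<open>The restriction of \<^term>\<open>box_poly e \<phi>\<close> to the line of slope \<open>\<lambda>\<close> through the point
  \<open>(u, v, w)\<close>, expanded around \<open>u\<close>; the inner indeterminate is \<open>\<lambda>\<close>, the outer one is the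
  distance from \<open>u\<close>.\<close>

definition pencil :: "'a::comm_ring_1 \<times> 'a \<times> 'a \<Rightarrow> nat \<Rightarrow> (nat \<times> nat \<times> nat \<Rightarrow> 'a) \<Rightarrow> 'a poly poly"
  where "pencil z e \<phi> = (case z of (u, v, w) \<Rightarrow>
    (let h = [:[:w:], [:0, 0, 1:]:]; k = [:[:v:], [:0, 1:]:] + [:[:u:], 1:]^2 * h in
     \<Sum>(a, b, c)\<in>{..e} \<times> {..e} \<times> {..e}. [:[:\<phi> (a, b, c):]:] * [:[:u:], 1:] ^ a * k ^ b * h ^ c))"

lemma pencil_weighted: "pencil z e \<phi> \<in> weighted"
proof -
  obtain u v w where z: "z = (u, v, w)" by (cases z)
  have basic: "[:[:c:]:] \<in> weighted" "[:[:c:], 1:] \<in> weighted" "[:[:c:], [:0, 1:]:] \<in> weighted"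
    "[:[:c:], [:0, 0, 1:]:] \<in> weighted" for c :: 'a
    by (auto simp: weighted_def coeff_pCons numeral_2_eq_2 split: nat.splits)
  show ?thesis unfolding pencil_def z Let_def prod.case case_prod_unfold
    by (rule weighted_sum, intro weighted_mult weighted_power weighted_add basic)
qed

lemma pencil_diff: "pencil z e (\<lambda>i. \<phi> i - \<psi> i) = pencil z e \<phi> - pencil z e \<psi>"
proof -
  have *: "[:[:x - y:]:] = [:[:x:]:] - [:[:y:]:]" for x y :: 'a by simp
  show ?thesis
    unfolding pencil_def Let_def case_prod_unfold * left_diff_distrib sum_subtractf ..
qed

lemma map_poly_eval_pCons:
  "map_poly (\<lambda>q. poly q l) (pCons a f) = pCons (poly a l) (map_poly (\<lambda>q. poly q l) f)"
  by (rule poly_eqI) (simp add: coeff_map_poly coeff_pCons split: nat.splits)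

text \<open>The pair \<open>(v - l * u, w - l^2 * u)\<close> is where the line of slope
  \<open>l\<close> through \<open>(u, v, w)\<close> meets \<open>m = 0\<close>. Recentring at
  \<open>u\<close> makes the expansion a specialization of one polynomial in the slope, so
  conditions imposed on \<open>pencil\<close> at a point act on all slopes simultaneously.\<close>

lemma line_eval_pencil:
  "shift u (line_eval l (v - l * u, w - l^2 * u) (box_poly e \<phi>))
    = map_poly (\<lambda>q. poly q l) (pencil (u, v, w) e \<phi>)"
proof -
  interpret s: comm_ring_hom "shift u :: 'a poly \<Rightarrow> 'a poly" by unfold_locales simp_all
  interpret m: map_poly_comm_ring_hom "\<lambda>q. poly q l" ..
  let ?k = "[:v - l * u, l, w - l^2 * u, l^2:]" and ?h = "[:w - l^2 * u, l^2:]"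
  let ?H = "[:[:w:], [:0, 0, 1:]:]" and ?K = "[:[:v:], [:0, 1:]:] + [:[:u:], 1:]^2 * [:[:w:], [:0, 0, 1:]:]"
  have X: "shift u [:0, 1:] = [:u, 1:]" using shift_simps(6)[of u 0] by simp
  have h: "?h = [:w - l^2 * u:] + [:l^2:] * [:0, 1:]" by simp
  have k: "?k = [:v - l * u:] + [:l:] * [:0, 1:] + [:0, 1:]^2 * ?h"
    by (simp add: power2_eq_square)
  have sh: "shift u ?h = [:w, l^2:]"
    unfolding h by (simp only: s.hom_add s.hom_mult X shift_simps(5)) simp
  have sk: "shift u ?k = [:v, l:] + [:u, 1:]^2 * [:w, l^2:]"
    unfolding k by (simp only: s.hom_add s.hom_mult s.hom_power X sh shift_simps(5)) simp
  have mh: "map_poly (\<lambda>q. poly q l) ?H = [:w, l^2:]"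
    by (simp add: map_poly_eval_pCons power2_eq_square)
  have mu: "map_poly (\<lambda>q. poly q l) [:[:u:], 1:] = [:u, 1:]"
    by (simp add: map_poly_eval_pCons)
  have mv: "map_poly (\<lambda>q. poly q l) [:[:v:], [:0, 1:]:] = [:v, l:]"
    by (simp add: map_poly_eval_pCons)
  have mk: "map_poly (\<lambda>q. poly q l) ?K = [:v, l:] + [:u, 1:]^2 * [:w, l^2:]"
    by (simp only: m.hom_add m.hom_mult m.hom_power mu mv mh)
  have mc: "map_poly (\<lambda>q. poly q l) [:[:c:]:] = [:c:]" for c
    by (simp add: map_poly_eval_pCons)
  show ?thesis
    unfolding line_eval_box_poly pencil_def Let_def prod.case s.hom_sum m.hom_sum case_prod_unfold
      s.hom_mult s.hom_power m.hom_mult m.hom_power fst_conv snd_conv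
      sh sk X mh mk mu mc shift_simps(5) ..
qed

lemma sum_root_orders_le_degree:
  fixes L :: "'a::idom poly"
  assumes "finite U" "L \<noteq> 0" "\<And>u. u \<in> U \<Longrightarrow> [:- u, 1:] ^ k dvd L"
  shows "k * card U \<le> degree L"
  using assms
proof (induction U arbitrary: L rule: finite_induct)
  case (insert u U)
  obtain q where q: "L = [:- u, 1:] ^ k * q" using insert.prems(2)[of u] by (auto elim: dvdE)
  have q0: "q \<noteq> 0" using q insert.prems(1) by auto
  have "[:- v, 1:] ^ k dvd q" if v: "v \<in> U" for v
  proof -
    have "v \<noteq> u" using v insert.hyps by auto
    then have "poly ([:- u, 1:] ^ k) v \<noteq> 0" by (simp add: poly_power)
    then have "order v ([:- u, 1:] ^ k) = 0" by (rule order_0I)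
    then have "order v L = order v q" using order_mult[of "[:- u, 1:] ^ k" q v] insert.prems(1) q by simp
    moreover have "k \<le> order v L" using insert.prems v by (simp add: order_max)
    ultimately show ?thesis using order_divides[of v k q] by presburger
  qed
  then have "k * card U \<le> degree q" using insert.IH[of q] q0 by blast
  moreover have "degree L = k + degree q"
    using q q0 by (simp add: degree_mult_eq degree_power_eq)
  ultimately show ?case using insert.hyps by simp
qed simp

lemma dvd_of_shift_coeffs:
  fixes L :: "'a::comm_ring_1 poly"
  assumes "\<And>i. i < k \<Longrightarrow> coeff (shift u L) i = 0"
  shows "[:- u, 1:] ^ k dvd L"
proof -
  interpret s: comm_ring_hom "shift (- u) :: 'a poly \<Rightarrow> 'a poly" by unfold_locales simp_all
  have "monom 1 k dvd shift u L" using assms by (simp add: monom_1_dvd_iff')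
  then have "[:0, 1:] ^ k dvd shift u L" by (simp only: monom_altdef smult_1_left)
  then obtain r where "shift u L = [:0, 1:] ^ k * r" by (auto elim: dvdE)
  then have "shift (- u) (shift u L) = shift (- u) [:0, 1:] ^ k * shift (- u) r"
    by (simp only: s.hom_mult s.hom_power)
  moreover have "shift (- u) [:0, 1:] = [:- u, 1:]" using shift_simps(6)[of "- u" 0] by simp
  ultimately show ?thesis by (simp add: shift_shift)
qed

text \<open>On a line, \<open>m\<close>, \<kappa> and \<open>h\<close> restrict to polynomials of
  degree at most \<open>1\<close>, \<open>3\<close> and \<open>1\<close>, each raised to a power of
  at most \<open>e\<close>.\<close>

lemma degree_line_eval_box_poly: "degree (line_eval l v (box_poly e \<phi>)) \<le> 5 * e"
  unfolding line_eval_box_poly case_prod_unfold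
proof (rule degree_sum_le)
  fix i assume "i \<in> {..e} \<times> {..e} \<times> {..e}"
  then have i: "fst i \<le> e" "fst (snd i) \<le> e" "snd (snd i) \<le> e" by auto
  have p: "degree (q ^ n) \<le> d * e" if "degree q \<le> d" "n \<le> e" for q :: "'a poly" and n d
  proof -
    have "degree (q ^ n) \<le> degree q * n" by (rule degree_power_le)
    also have "\<dots> \<le> d * e" using that by (rule mult_le_mono)
    finally show ?thesis .
  qed
  let ?a = "[:0, 1 :: 'a:] ^ fst i" and ?b = "[:fst v, l, snd v, l^2:] ^ fst (snd i)"
    and ?c = "[:snd v, l^2:] ^ snd (snd i)"
  have "degree ([:\<phi> (fst i, fst (snd i), snd (snd i)):] * ?a * ?b * ?c)
      \<le> degree ([:\<phi> (fst i, fst (snd i), snd (snd i)):]) + degree ?a + degree ?b + degree ?c"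
    by (intro order_trans[OF degree_mult_le] add_mono order_refl)
  also have "\<dots> \<le> 0 + 1 * e + 3 * e + 1 * e"
    by (intro add_mono p i) (auto simp: degree_pCons_eq_if)
  finally show "degree ([:\<phi> (fst i, fst (snd i), snd (snd i)):] * ?a * ?b * ?c) \<le> 5 * e" by simp
qed simp

lemma card_weighted_indices: "card (SIGMA i:{..<k}. {..2 * i}) = k^2" for k :: nat
proof -
  have "card (SIGMA i:{..<k}. {..2 * i}) = (\<Sum>i<k. Suc (2 * i))" by simp
  also have "\<dots> = k^2" by (induction k) (auto simp: power2_eq_square)
  finally show ?thesis .
qed

text \<open>The vanishing conditions at a point only concern the restriction of the Taylor expansion to
  the conic of directions \<open>(1, \<lambda>, \<lambda>\<^sup>2)\<close>, so vanishing to order \<open>k\<close> costs \<open>k\<^sup>2\<close> conditions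
  rather than the \<open>k\<^sup>3/6\<close> that full multiplicity would cost.\<close>

lemma exists_poly_vanishing_on_rich_lines:
  fixes J :: "('a::{field,finite} \<times> 'a \<times> 'a) set"
  assumes "card J * k^2 < (e + 1)^3"
  obtains f :: "'a poly poly poly" where "f \<noteq> 0" "bidegree f \<le> 2 * e"
    "\<And>l v. 5 * e < k * card {u. (u, fst v + l * u, snd v + l^2 * u) \<in> J} \<Longrightarrow> line_eval l v f = 0"
proof -
  define B where "B = {..e} \<times> {..e} \<times> {..e}"
  define I where "I = J \<times> (SIGMA i:{..<k}. {..2 * i})"
  define G :: "(nat \<times> nat \<times> nat \<Rightarrow> 'a) \<Rightarrow> (('a \<times> 'a \<times> 'a) \<times> nat \<times> nat \<Rightarrow> 'a)"
    where "G \<phi> = restrict (\<lambda>(z, i, j). coeff (coeff (pencil z e \<phi>) i) j) I" for \<phi>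
  have fin: "finite B" "finite I" by (auto simp: B_def I_def)
  have cB: "card B = (e + 1)^3" by (simp add: B_def card_cartesian_product power3_eq_cube)
  have cI: "card I = card J * k^2" by (simp add: I_def card_cartesian_product card_weighted_indices)
  have two: "CARD('a) > 1"
    using card_mono[of UNIV "{0, 1 :: 'a}"] by simp
  \<comment> \<open>Over a finite field the existence of a nontrivial solution is a pigeonhole
    argument: there are more coefficient families than value families, so two of them satisfy the
    same conditions, and their difference satisfies the homogeneous ones.\<close>
  have "G ` (B \<rightarrow>\<^sub>E UNIV) \<subseteq> I \<rightarrow>\<^sub>E UNIV" by (auto simp: G_def)
  then have "card (G ` (B \<rightarrow>\<^sub>E UNIV)) \<le> card (I \<rightarrow>\<^sub>E (UNIV :: 'a set))"
    using fin by (intro card_mono finite_PiE) auto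
  also have "\<dots> = CARD('a) ^ card I" using fin by (simp add: card_PiE)
  also have "\<dots> < CARD('a) ^ card B" using two assms cB cI by simp
  also have "\<dots> = card (B \<rightarrow>\<^sub>E (UNIV :: 'a set))" using fin by (simp add: card_PiE)
  finally have "\<not> inj_on G (B \<rightarrow>\<^sub>E UNIV)" using card_image by fastforce
  then obtain \<phi> \<psi> where *: "\<phi> \<in> B \<rightarrow>\<^sub>E UNIV" "\<psi> \<in> B \<rightarrow>\<^sub>E UNIV" "\<phi> \<noteq> \<psi>" "G \<phi> = G \<psi>"
    unfolding inj_on_def by blast
  define f where "f = box_poly e (\<lambda>i. \<phi> i - \<psi> i)"
  obtain i where i: "i \<in> B" "\<phi> i \<noteq> \<psi> i" using *(1-3) PiE_ext by metis
  have "f \<noteq> 0"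
  proof
    assume "f = 0"
    then have "coeff (coeff (coeff f (snd (snd i))) (fst (snd i))) (fst i) = 0" by simp
    then show False using i unfolding f_def by (subst (asm) coeff_box_poly) (auto simp: B_def)
  qed
  moreover have "bidegree f \<le> 2 * e" unfolding f_def by (rule bidegree_box_poly)
  moreover have "line_eval l v f = 0"
    if big: "5 * e < k * card {u. (u, fst v + l * u, snd v + l^2 * u) \<in> J}" for l v
  proof (rule ccontr)
    let ?U = "{u. (u, fst v + l * u, snd v + l^2 * u) \<in> J}"
    assume nz: "line_eval l v f \<noteq> 0"
    have "[:- u, 1:] ^ k dvd line_eval l v f" if u: "u \<in> ?U" for u
    proof (rule dvd_of_shift_coeffs)
      fix n assume n: "n < k"
      let ?z = "(u, fst v + l * u, snd v + l^2 * u)"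
      let ?P = "pencil ?z e (\<lambda>i. \<phi> i - \<psi> i)"
      have "coeff ?P n = 0"
      proof (rule poly_eqI)
        fix j
        show "coeff (coeff ?P n) j = coeff 0 j"
        proof (cases "j \<le> 2 * n")
          case True
          then have "(?z, n, j) \<in> I" using u n by (simp add: I_def)
          then show ?thesis
            using fun_cong[OF *(4), of "(?z, n, j)"] by (simp add: G_def pencil_diff)
        next
          case False
          have "degree (coeff ?P n) \<le> 2 * n"
            using pencil_weighted[of ?z e "\<lambda>i. \<phi> i - \<psi> i"] by (simp add: weighted_def)
          then show ?thesis using False by (simp add: coeff_eq_0)
        qed
      qed
      moreover have "shift u (line_eval l v f) = map_poly (\<lambda>q. poly q l) ?P"
        using line_eval_pencil[of u l "fst v + l * u" "snd v + l^2 * u" e] by (simp add: f_def)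
      ultimately show "coeff (shift u (line_eval l v f)) n = 0" by (simp add: coeff_map_poly)
    qed
    then have "k * card ?U \<le> degree (line_eval l v f)"
      by (intro sum_root_orders_le_degree nz) auto
    also have "\<dots> \<le> 5 * e" unfolding f_def by (rule degree_line_eval_box_poly)
    finally show False using big by simp
  qed
  ultimately show thesis using that by blast
qed

section \<open>Prime components of a surface and the lines on them\<close>

text \<open>A line is a point over \<open>F[m]\<close> whose abscissa
  \<open>[:x, l, y, l^2:]\<close> reveals \<open>x\<close>, \<open>l\<close> and \<open>y\<close>;
  distinct lines therefore have distinct abscissae, which is what the Bezout bound requires.\<close>

lemma card_common_lines_le:
  fixes g q :: "'a::field_gcd poly poly poly"
  assumes "prime_elem g" "\<not> g dvd q" "finite I"
    and "\<And>l v. (l, v) \<in> I \<Longrightarrow> line_eval l v g = 0" "\<And>l v. (l, v) \<in> I \<Longrightarrow> line_eval l v q = 0"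
  shows "card I \<le> bidegree g * bidegree q"
proof (rule card_common_zeros_le[where X = "\<lambda>(l, v). [:fst v, l, snd v, l^2:]"
      and Y = "\<lambda>(l, v). [:snd v, l^2:]"])
  show "inj_on (\<lambda>(l, v). [:fst v, l, snd v, l^2:]) I"
    by (rule inj_onI) (auto simp: prod_eq_iff)
qed (use assms in \<open>auto simp: line_eval_def\<close>)

lemma line_eval_dvd: "g dvd f \<Longrightarrow> line_eval l v g = 0 \<Longrightarrow> line_eval l v f = 0"
  by (auto elim!: dvdE)

lemma line_eval_prod_mset_eq_0:
  fixes A :: "'a::idom poly poly poly multiset"
  assumes "line_eval l v (prod_mset A) = 0"
  shows "\<exists>g\<in>#A. line_eval l v g = 0"
  using assms by (induction A) auto

text \<open>A polynomial in \<open>m\<close> alone restricts to itself on every line, so it vanishes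
  on none unless it is zero.\<close>

lemma bidegree_pos_of_line:
  fixes g :: "'a::idom poly poly poly"
  assumes "g \<noteq> 0" "line_eval l v g = 0"
  shows "bidegree g > 0"
proof (rule ccontr)
  assume "\<not> bidegree g > 0"
  then have "degree g = 0" "inner_degree g = 0" by (auto simp: bidegree_def)
  then obtain g' where g': "g = [:g':]" by (meson degree_eq_zeroE)
  then obtain g'' where "g' = [:g'':]"
    using \<open>inner_degree g = 0\<close> by (metis degree_eq_zeroE inner_degree_const)
  then show False using assms g' by (auto simp: line_eval_def)
qed

lemma sum_set_mset_le: "sum h (set_mset A) \<le> (\<Sum>x\<in>#A. h x :: nat)"
proof (induction A)
  case (add x A)
  then show ?case by (cases "x \<in># A") (auto simp: insert_absorb)
qed simp

lemma bidegree_normalize: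
  fixes f :: "'a::field_gcd poly poly poly"
  shows "bidegree (normalize f) = bidegree f"
proof (cases "f = 0")
  case False
  have "bidegree f = bidegree (unit_factor f * normalize f)" by simp
  also have "\<dots> = bidegree (unit_factor f) + bidegree (normalize f)"
    using False by (intro bidegree_mult) auto
  also have "bidegree (unit_factor f) = 0" using False by (intro bidegree_dvd_1) simp
  finally show ?thesis by simp
qed simp

lemma sum_bidegree_prime_factorization:
  fixes f :: "'a::field_gcd poly poly poly"
  assumes "f \<noteq> 0"
  shows "(\<Sum>g\<in>#prime_factorization f. bidegree g) = bidegree f"
proof -
  have "bidegree f = bidegree (prod_mset (prime_factorization f))"
    using assms by (metis bidegree_normalize prod_mset_prime_factorization_weak)
  also have "\<dots> = (\<Sum>g\<in>#prime_factorization f. bidegree g)"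
    by (rule bidegree_prod_mset) simp
  finally show ?thesis ..
qed

text \<open>Averaging with the bidegrees as weights: if every prime factor contained less than its
  share of the lines, then, bidegrees being additive, the factors together could not cover
  \<open>P\<close>.\<close>

lemma exists_prime_factor_with_many_lines:
  fixes f :: "'a::field_gcd poly poly poly"
  assumes f: "f \<noteq> 0" and P: "finite P" "P \<noteq> {}"
    and van: "\<And>l v. (l, v) \<in> P \<Longrightarrow> line_eval l v f = 0"
  obtains g where "prime_elem g" "g dvd f" "bidegree g > 0"
    "card P * bidegree g \<le> card {(l, v) \<in> P. line_eval l v g = 0} * bidegree f"
proof -
  let ?S = "prime_factorization f"
  define Z where "Z g = {(l, v) \<in> P. line_eval l v g = 0}" for g
  have Z: "x \<in> Z g \<longleftrightarrow> x \<in> P \<and> line_eval (fst x) (snd x) g = 0" for x g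
    by (cases x) (simp add: Z_def)
  have fin: "finite (Z g)" for g by (rule finite_subset[OF _ P(1)]) (auto simp: Z)
  have cover: "\<exists>g\<in>#?S. x \<in> Z g" if x: "x \<in> P" for x
  proof -
    have "f dvd prod_mset ?S"
      using prod_mset_prime_factorization_weak[OF f] by (simp add: associated_iff_dvd)
    moreover have "line_eval (fst x) (snd x) f = 0" using van[of "fst x" "snd x"] x by simp
    ultimately have "line_eval (fst x) (snd x) (prod_mset ?S) = 0" by (rule line_eval_dvd)
    from line_eval_prod_mset_eq_0[OF this] x show ?thesis unfolding Z by blast
  qed
  have zero: "card (Z g) = 0" if g: "g \<in># ?S" "bidegree g = 0" for g
  proof -
    have "g \<noteq> 0" using g(1) by auto
    then have "Z g = {}" using bidegree_pos_of_line[of g] g(2) by (fastforce simp: Z)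
    then show ?thesis by simp
  qed
  have "\<exists>g\<in>#?S. bidegree g > 0 \<and> card P * bidegree g \<le> card (Z g) * bidegree f"
  proof (rule ccontr)
    assume "\<not> ?thesis"
    then have lt: "card (Z g) * bidegree f < card P * bidegree g" if "g \<in># ?S" "bidegree g > 0" for g
      using that not_le by blast
    have le: "card (Z g) * bidegree f \<le> card P * bidegree g" if "g \<in># ?S" for g
      using lt[OF that] zero[OF that] by (cases "bidegree g = 0") (simp_all add: less_imp_le)
    \<comment> \<open>The contradiction needs one strict inequality, and only factors of positive
      bidegree provide it; a factor vanishing on some line of \<open>P\<close> is such a
      factor.\<close>
    obtain x where "x \<in> P" using P(2) by (meson ex_in_conv)
    from cover[OF this] obtain g0 where g0: "g0 \<in># ?S" "x \<in> Z g0" by (elim bexE)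
    have "Z g0 \<noteq> {}" using g0(2) by blast
    then have "card (Z g0) \<noteq> 0" by (simp only: card_eq_0_iff fin simp_thms)
    then have pos: "bidegree g0 > 0" using zero[OF g0(1)] by (metis gr0I)
    have "card P \<le> card (\<Union>g\<in>set_mset ?S. Z g)"
    proof (rule card_mono)
      show "finite (\<Union>g\<in>set_mset ?S. Z g)" using fin by blast
      show "P \<subseteq> (\<Union>g\<in>set_mset ?S. Z g)" using cover by blast
    qed
    also have "\<dots> \<le> (\<Sum>g\<in>set_mset ?S. card (Z g))" by (rule card_UN_le[OF finite_set_mset])
    finally have "card P * bidegree f \<le> (\<Sum>g\<in>set_mset ?S. card (Z g)) * bidegree f"
      by (rule mult_le_mono1)
    also have "\<dots> = (\<Sum>g\<in>set_mset ?S. card (Z g) * bidegree f)" by (rule sum_distrib_right)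
    also have "\<dots> < (\<Sum>g\<in>set_mset ?S. card P * bidegree g)"
    proof (rule sum_strict_mono_ex1[OF finite_set_mset])
      show "\<forall>g\<in>set_mset ?S. card (Z g) * bidegree f \<le> card P * bidegree g" using le by blast
      show "\<exists>g\<in>set_mset ?S. card (Z g) * bidegree f < card P * bidegree g"
        using lt[OF g0(1) pos] g0(1) by blast
    qed
    also have "\<dots> = card P * (\<Sum>g\<in>set_mset ?S. bidegree g)" by (rule sum_distrib_left[symmetric])
    also have "\<dots> \<le> card P * (\<Sum>g\<in>#?S. bidegree g)" by (intro mult_le_mono2 sum_set_mset_le)
    also have "\<dots> = card P * bidegree f"
      by (simp only: sum_bidegree_prime_factorization[OF f])
    finally show False by simp
  qed
  then obtain g where g: "g \<in># ?S" "bidegree g > 0" "card P * bidegree g \<le> card (Z g) * bidegree f"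
    by blast
  have "prime g" "g dvd f" using g(1) f by (auto simp: in_prime_factors_iff)
  then show thesis using g(2,3) by (intro that[of g]) (auto simp: prime_imp_prime_elem Z_def)
qed

lemma card_prime_divisors_le_bidegree:
  fixes f :: "'a::field_gcd poly poly poly"
  assumes f: "f \<noteq> 0" and I: "finite I"
    and G: "\<And>i. i \<in> I \<Longrightarrow> prime_elem (G i) \<and> G i dvd f \<and> bidegree (G i) > 0"
    and na: "\<And>i j. i \<in> I \<Longrightarrow> j \<in> I \<Longrightarrow> G i dvd G j \<Longrightarrow> i = j"
  shows "card I \<le> bidegree f"
proof -
  have inj: "inj_on (\<lambda>i. normalize (G i)) I"
  proof (rule inj_onI)
    fix i j assume ij: "i \<in> I" "j \<in> I" "normalize (G i) = normalize (G j)"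
    then show "i = j" using na[of i j] by (simp add: associated_iff_dvd)
  qed
  have sub: "(\<lambda>i. normalize (G i)) ` I \<subseteq> prime_factors f"
    using f G by (auto simp: in_prime_factors_iff prime_normalize_iff)
  have "card I = (\<Sum>h\<in>(\<lambda>i. normalize (G i)) ` I. 1)" using inj by (simp add: card_image)
  also have "\<dots> \<le> (\<Sum>h\<in>(\<lambda>i. normalize (G i)) ` I. bidegree h)"
    using G by (intro sum_mono) (auto simp: bidegree_normalize Suc_le_eq)
  also have "\<dots> \<le> (\<Sum>h\<in>prime_factors f. bidegree h)" using sub by (intro sum_mono2) auto
  also have "\<dots> \<le> (\<Sum>h\<in>#prime_factorization f. bidegree h)" by (rule sum_set_mset_le)
  finally show ?thesis using f by (simp add: sum_bidegree_prime_factorization)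
qed

text \<open>The plane containing the line \<open>(l, v)\<close> and the direction
  \<open>(0, t)\<close>, with equation
  \<open>snd t * (k - fst v - l m) = fst t * (h - snd v - l^2 m)\<close>, rewritten by means of
  \<open>k = \<kappa> - m^2 h\<close>.\<close>

definition plane_poly :: "'a::comm_ring_1 \<Rightarrow> 'a \<times> 'a \<Rightarrow> 'a \<times> 'a \<Rightarrow> 'a poly poly poly"
  where "plane_poly l v t =
    [:[:[:fst t * snd v - snd t * fst v, fst t * l^2 - snd t * l:], [:snd t:]:],
      [:[:- fst t, 0, - snd t:]:]:]"

lemma line_eval_plane_poly:
  "line_eval l' v' (plane_poly l v t) =
    [:snd t * (fst v' - fst v) - fst t * (snd v' - snd v), snd t * (l' - l) - fst t * (l'^2 - l^2):]"
  by (simp add: line_eval_def plane_poly_def algebra_simps)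

lemma bidegree_plane_poly: "bidegree (plane_poly l v t) \<le> 2"
  by (simp add: bidegree_def plane_poly_def inner_degree_pCons degree_pCons_eq_if)

section \<open>Slopes with small difference sets\<close>

definition difference_set :: "'a::ring \<Rightarrow> 'a set \<Rightarrow> 'a set"
  where "difference_set l A = (\<lambda>(a, b). a - l * b) ` (A \<times> A)"

lemma difference_setI: "a \<in> A \<Longrightarrow> b \<in> A \<Longrightarrow> a - l * b \<in> difference_set l A"
  unfolding difference_set_def by (rule image_eqI[of _ _ "(a, b)"]) auto

definition line_points :: "'a::comm_ring_1 set \<Rightarrow> 'a \<Rightarrow> 'a \<times> 'a \<Rightarrow> 'a set"
  where "line_points A l v = {u \<in> A. fst v + l * u \<in> A \<and> snd v + l^2 * u \<in> A}"

text \<open>With \<open>N = card A\<close>, the \<open>N^3\<close> points of the cube lie on at most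
  \<open>T^2 N^2\<close> lines of slope \<open>l\<close>. Lines with fewer than
  \<open>N / (2 T^2)\<close> points account for at most half of the points, and any other line
  carries at most \<open>N\<close> of them.\<close>

lemma exists_rich_lines:
  fixes A :: "'a::comm_ring_1 set"
  assumes fin: "finite A" and T: "card (difference_set l A) \<le> T * card A"
    "card (difference_set (l^2) A) \<le> T * card A"
  shows "\<exists>V. finite V \<and> (card A)^2 \<le> 2 * card V \<and>
    (\<forall>v\<in>V. card A \<le> 2 * T^2 * card (line_points A l v))"
proof (cases "card A = 0")
  case False
  define N where "N = card A"
  define W where "W = difference_set l A \<times> difference_set (l^2) A"
  have finW: "finite W" using fin by (auto simp: W_def difference_set_def)
  define V where "V = {v \<in> W. N \<le> 2 * T^2 * card (line_points A l v)}"
  have finL: "finite (line_points A l v)" and leN: "card (line_points A l v) \<le> N" for v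
    using fin by (auto simp: line_points_def N_def intro: card_mono)
  have "N^3 = card (A \<times> A \<times> A)" by (simp add: N_def card_cartesian_product power3_eq_cube)
  also have "\<dots> \<le> card (SIGMA v:W. line_points A l v)"
  proof (rule card_inj_on_le)
    let ?h = "\<lambda>(u, k, h). ((k - l * u, h - l^2 * u), u)"
    show "inj_on ?h (A \<times> A \<times> A)" by (auto simp: inj_on_def)
    show "?h ` (A \<times> A \<times> A) \<subseteq> (SIGMA v:W. line_points A l v)"
      by (auto simp: W_def difference_set_def line_points_def)
    show "finite (SIGMA v:W. line_points A l v)" using finW finL by auto
  qed
  also have "\<dots> = (\<Sum>v\<in>W. card (line_points A l v))" using finW finL by simp
  finally have "2 * T^2 * N^3 \<le> (\<Sum>v\<in>W. 2 * T^2 * card (line_points A l v))"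
    by (simp only: mult_le_mono2 flip: sum_distrib_left)
  also have "\<dots> \<le> (\<Sum>v\<in>W. (if v \<in> V then 2 * T^2 * N else 0) + N)"
    by (rule sum_mono) (use leN in \<open>auto simp: V_def intro!: le_SucI trans_le_add1\<close>)
  also have "\<dots> = card V * (2 * T^2 * N) + card W * N"
    using finW by (simp add: sum.distrib sum.If_cases V_def Int_def)
  also have "\<dots> \<le> card V * (2 * T^2 * N) + (T * N) * (T * N) * N"
    using T by (simp add: W_def card_cartesian_product N_def mult_le_mono)
  finally have "T^2 * N * N^2 \<le> T^2 * N * (2 * card V)"
    by (simp add: power2_eq_square power3_eq_cube algebra_simps)
  moreover have "T > 0"
  proof (rule ccontr)
    assume "\<not> T > 0"
    then have "card (difference_set l A) = 0" using T by simp
    moreover have "finite (difference_set l A)" using fin by (simp add: difference_set_def)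
    ultimately have "A = {}" by (auto simp: difference_set_def)
    then show False using False by simp
  qed
  moreover have "N > 0" using False by (simp add: N_def)
  ultimately have "N^2 \<le> 2 * card V" by simp
  moreover have "finite V" using finW by (simp add: V_def)
  ultimately show ?thesis by (intro exI[of _ V]) (auto simp: V_def N_def)
qed (auto intro: exI[of _ "{}"])

text \<open>Confining the base points to one translate of \<open>A \<times> A\<close> puts the
  differences of base points of equal slope into \<open>(A - A)^2\<close>, a set that does not
  depend on the slope. The translate is a popular one: each rich line \<open>v\<close> admits at
  least \<open>(card A / (2 T^2))^2\<close> pairs \<open>b\<close>, one parameter for each
  coordinate.\<close>

lemma exists_rich_lines_in_box:
  fixes A :: "'a::comm_ring_1 set"
  assumes fin: "finite A" and T: "card (difference_set l A) \<le> T * card A"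
    "card (difference_set (l^2) A) \<le> T * card A"
  shows "\<exists>V. finite V \<and> (card A)^2 \<le> 8 * T^4 * card V \<and>
    (\<forall>v\<in>V. card A \<le> 2 * T^2 * card (line_points A l v)) \<and>
    (\<exists>s t. \<forall>v\<in>V. fst v + s \<in> A \<and> snd v + t \<in> A)"
proof (cases "card A = 0")
  case False
  obtain V where V: "finite V" "(card A)^2 \<le> 2 * card V"
    "\<And>v. v \<in> V \<Longrightarrow> card A \<le> 2 * T^2 * card (line_points A l v)"
    using exists_rich_lines[OF assms] by blast
  define V' where "V' b = {v \<in> V. fst v + l * fst b \<in> A \<and> snd v + l^2 * snd b \<in> A}" for b
  have finV': "finite (V' b)" for b using V(1) by (simp add: V'_def)
  have "card V * (card A)^2 = (\<Sum>v\<in>V. (card A)^2)" by simp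
  also have "\<dots> \<le> (\<Sum>v\<in>V. (2 * T^2 * card (line_points A l v))^2)"
    by (intro sum_mono power_mono V(3)) auto
  also have "\<dots> = 4 * T^4 * (\<Sum>v\<in>V. card (line_points A l v \<times> line_points A l v))"
    by (simp add: card_cartesian_product sum_distrib_left power2_eq_square power4_eq_xxxx algebra_simps)
  also have "(\<Sum>v\<in>V. card (line_points A l v \<times> line_points A l v))
      = card (SIGMA v:V. line_points A l v \<times> line_points A l v)"
    using V(1) fin by (simp add: line_points_def)
  also have "\<dots> \<le> card (SIGMA b:A \<times> A. V' b)"
  proof (rule card_inj_on_le)
    show "inj_on (\<lambda>(v, b). (b, v)) (SIGMA v:V. line_points A l v \<times> line_points A l v)"
      by (auto simp: inj_on_def)
    show "(\<lambda>(v, b). (b, v)) ` (SIGMA v:V. line_points A l v \<times> line_points A l v) \<subseteq> (SIGMA b:A \<times> A. V' b)"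
      by (auto simp: line_points_def V'_def)
    show "finite (SIGMA b:A \<times> A. V' b)" using fin finV' by auto
  qed
  also have "\<dots> = (\<Sum>b\<in>A \<times> A. card (V' b))" using fin finV' by simp
  finally have le: "card V * (card A)^2 \<le> 4 * T^4 * (\<Sum>b\<in>A \<times> A. card (V' b))" by simp
  have "\<exists>b\<in>A \<times> A. card V \<le> 4 * T^4 * card (V' b)"
  proof (rule ccontr)
    assume "\<not> ?thesis"
    then have "(\<Sum>b\<in>A \<times> A. 4 * T^4 * card (V' b)) < (\<Sum>b\<in>A \<times> A. card V)"
      using fin False by (intro sum_strict_mono) (auto simp: not_le)
    then show False using le
      by (simp add: sum_distrib_left card_cartesian_product power2_eq_square algebra_simps)
  qed
  then obtain b where b: "card V \<le> 4 * T^4 * card (V' b)" by blast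
  have "(card A)^2 \<le> 8 * T^4 * card (V' b)" using V(2) b by linarith
  moreover have "\<forall>v\<in>V' b. card A \<le> 2 * T^2 * card (line_points A l v)"
    using V(3) by (simp add: V'_def)
  moreover have "\<forall>v\<in>V' b. fst v + l * fst b \<in> A \<and> snd v + l^2 * snd b \<in> A"
    by (simp add: V'_def)
  ultimately show ?thesis using finV' by blast
qed (auto intro: exI[of _ "{}"])

text \<open>For \<open>(1, l', l'^2)\<close> to be parallel to the plane is a nontrivial condition
  on \<open>l'\<close> of degree at most two, leaving two slopes. For each of them a line in the
  plane is determined by one coordinate of its base point, and that coordinate lies in a translate
  of \<open>A\<close>.\<close>

lemma card_lines_in_plane_le:
  fixes A :: "'a::field set"
  assumes t: "t \<noteq> (0, 0)" and fin: "finite A"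
    and P: "\<And>l' v'. (l', v') \<in> P \<Longrightarrow> line_eval l' v' (plane_poly l v t) = 0 \<and> l' \<in> L \<and>
       fst v' + \<alpha> l' \<in> A \<and> snd v' + \<beta> l' \<in> A"
  shows "card P \<le> 2 * card A"
proof -
  define Ls where "Ls = (if fst t = 0 then {l} else {l, snd t / fst t - l})"
  have eq1: "snd t * (fst v' - fst v) = fst t * (snd v' - snd v)"
    and eq2: "snd t * (l' - l) = fst t * (l'^2 - l^2)" if "(l', v') \<in> P" for l' v'
    using P[OF that] by (simp_all add: line_eval_plane_poly)
  have ls: "l' \<in> Ls" if "(l', v') \<in> P" for l' v'
  proof -
    have "(l' - l) * (snd t - fst t * (l' + l)) = 0"
      using eq2[OF that] by (simp add: power2_eq_square algebra_simps)
    then have "l' = l \<or> snd t = fst t * (l' + l)" by simp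
    then show ?thesis using t by (cases t) (auto simp: Ls_def field_simps)
  qed
  have cL: "card Ls \<le> 2" "finite Ls" by (auto simp: Ls_def card_insert_if)
  define F where "F = (\<lambda>(l' :: 'a, v'). (l', if snd t = 0 then fst v' + \<alpha> l' else snd v' + \<beta> l'))"
  have "card P \<le> card (Ls \<times> A)"
  proof (rule card_inj_on_le)
    show "inj_on F P"
    proof (rule inj_onI)
      fix x y assume xy: "x \<in> P" "y \<in> P" "F x = F y"
      obtain l1 v1 l2 v2 where [simp]: "x = (l1, v1)" "y = (l2, v2)" by (cases x, cases y)
      have [simp]: "l1 = l2" using xy by (simp add: F_def)
      show "x = y"
      proof (cases "snd t = 0")
        case True
        then have "fst t \<noteq> 0" using t by (cases t) auto
        then have "snd v1 = snd v" "snd v2 = snd v"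
          using eq1[of l1 v1] eq1[of l2 v2] xy True by auto
        then show ?thesis using xy True by (simp add: F_def prod_eq_iff)
      next
        case False
        then have "snd v1 = snd v2" using xy by (simp add: F_def)
        then have "snd t * (fst v1 - fst v) = snd t * (fst v2 - fst v)"
          using eq1[of l1 v1] eq1[of l2 v2] xy by simp
        then show ?thesis using False \<open>snd v1 = snd v2\<close> by (simp add: prod_eq_iff)
      qed
    qed
    show "F ` P \<subseteq> Ls \<times> A" using ls P by (auto simp: F_def)
    show "finite (Ls \<times> A)" using cL fin by simp
  qed
  also have "\<dots> \<le> 2 * card A" using cL by (simp add: card_cartesian_product)
  finally show ?thesis .
qed

lemma line_eval_translate_dvd:
  fixes g :: "'a::idom poly poly poly"
  assumes "g dvd translate t f" "line_eval l v g = 0"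
  shows "line_eval l (fst v + fst t, snd v + snd t) f = 0"
  using line_eval_dvd[OF assms] by (simp add: line_eval_translate)

lemma dvd_translate_multiple:
  fixes g :: "'a::comm_ring_1 poly poly poly"
  assumes "g dvd translate t g"
  shows "g dvd translate (of_nat j * fst t, of_nat j * snd t) g"
proof (induction j)
  case (Suc j)
  have "translate (of_nat j * fst t, of_nat j * snd t) g
      dvd translate (of_nat j * fst t, of_nat j * snd t) (translate t g)"
    using assms by (rule translate_dvd)
  then show ?case using Suc by (auto simp: translate_translate algebra_simps intro: dvd_trans)
qed simp

text \<open>If the surface \<open>g = 0\<close> had a translation symmetry, it would contain, along with a line, all
  its translates, hence a plane; being irreducible it would be that plane.\<close>

lemma translation_symmetry_imp_plane:
  fixes g :: "'a::{field_gcd,finite} poly poly poly"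
  assumes prime: "\<And>x::'a. \<exists>j. x = of_nat j"
    and g: "prime_elem g" and t: "t \<noteq> (0, 0)" and sym: "g dvd translate t g"
    and line: "line_eval l v g = 0" and deg: "2 * bidegree g < CARD('a)"
  shows "g dvd plane_poly l v t"
proof (rule ccontr)
  assume "\<not> g dvd plane_poly l v t"
  define I where "I = (\<lambda>x. (l, fst v + x * fst t, snd v + x * snd t)) ` UNIV"
  have "inj (\<lambda>x. (l, fst v + x * fst t, snd v + x * snd t))"
    using t by (cases t) (auto simp: inj_on_def)
  then have "CARD('a) = card I" by (simp add: I_def card_image)
  also have "\<dots> \<le> bidegree g * bidegree (plane_poly l v t)"
  proof (rule card_common_lines_le[OF g])
    fix l' v' assume "(l', v') \<in> I"
    then obtain x where x: "l' = l" "v' = (fst v + x * fst t, snd v + x * snd t)" by (auto simp: I_def)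
    \<comment> \<open>Primality of the field: every multiple of \<open>t\<close> is reached by
      iterating the translation.\<close>
    obtain j where j: "x = of_nat j" using prime by blast
    show "line_eval l' v' g = 0"
      using line_eval_translate_dvd[OF dvd_translate_multiple[OF sym, of j] line] by (simp add: x j)
    show "line_eval l' v' (plane_poly l v t) = 0"
      by (simp add: x line_eval_plane_poly)
  qed (fact, simp add: I_def)
  also have "\<dots> \<le> 2 * bidegree g" using bidegree_plane_poly[of l v t] by simp
  finally show False using deg by simp
qed

text \<open>The constants follow from the bound \<open>242 * T^4 * card A\<close> for the bidegree
  of the auxiliary polynomial: \<open>484\<close> is twice \<open>242\<close>, \<open>3872\<close>
  is \<open>16 * 242\<close>, and \<open>7500000\<close> exceeds
  \<open>16 * 242 * 8 * 242 = 7496192\<close>.\<close>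

theorem card_slopes_lt:
  fixes A L :: "'a::{field_gcd,finite} set"
  assumes prime: "\<And>x::'a. \<exists>j. x = of_nat j"
    and T: "card (difference_set 1 A) \<le> T * card A"
    "\<And>l. l \<in> L \<Longrightarrow> card (difference_set l A) \<le> T * card A"
    "\<And>l. l \<in> L \<Longrightarrow> card (difference_set (l^2) A) \<le> T * card A"
    and T1: "T \<ge> 1" and large: "3872 * T^8 < card A" and small: "484 * T^4 * card A < CARD('a)"
  shows "card L < 7500000 * T^18"
proof (rule ccontr)
  assume "\<not> ?thesis"
  then have D: "7500000 * T^18 \<le> card L" by simp
  define N where "N = card A"
  have N: "N > 0" using large by (simp add: N_def)
  have "\<forall>l\<in>L. \<exists>V. finite V \<and> N^2 \<le> 8 * T^4 * card V \<and>
    (\<forall>v\<in>V. N \<le> 2 * T^2 * card (line_points A l v)) \<and>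
    (\<exists>s t. \<forall>v\<in>V. fst v + s \<in> A \<and> snd v + t \<in> A)"
    using exists_rich_lines_in_box[of A] T by (simp add: N_def)
  then obtain V where V: "\<And>l. l \<in> L \<Longrightarrow> finite (V l)" "\<And>l. l \<in> L \<Longrightarrow> N^2 \<le> 8 * T^4 * card (V l)"
    "\<And>l v. l \<in> L \<Longrightarrow> v \<in> V l \<Longrightarrow> N \<le> 2 * T^2 * card (line_points A l v)"
    "\<And>l. l \<in> L \<Longrightarrow> \<exists>s t. \<forall>v\<in>V l. fst v + s \<in> A \<and> snd v + t \<in> A"
    by (metis (no_types, lifting))
  from V(4) obtain s t where st: "\<And>l v. l \<in> L \<Longrightarrow> v \<in> V l \<Longrightarrow> fst v + s l \<in> A \<and> snd v + t l \<in> A"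
    by metis
  define P where "P = Sigma L V"
  have finP: "finite P" using V(1) by (auto simp: P_def)
  have cP: "card L * N^2 \<le> 8 * T^4 * card P"
  proof -
    have "card L * N^2 = (\<Sum>l\<in>L. N^2)" by simp
    also have "\<dots> \<le> (\<Sum>l\<in>L. 8 * T^4 * card (V l))" by (intro sum_mono V(2))
    also have "\<dots> = 8 * T^4 * card P" using V(1) by (simp add: P_def sum_distrib_left)
    finally show ?thesis .
  qed
  have "card L > 0" using D T1 by (metis gr0I le_0_eq mult_is_0 not_one_le_zero power_not_zero zero_neq_numeral)
  then have "P \<noteq> {}" using cP N by (auto intro!: Nat.gr0I)

  \<comment> \<open>Vanishing to order \<open>j^3\<close> on the cube costs
    \<open>N^3 j^6 = e^3\<close> conditions, just below the \<open>(e + 1)^3\<close> available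
    coefficients. A rich line has at least \<open>N / (2 T^2)\<close> points, so its total order
    exceeds the degree bound \<open>5 * e = 5 N j^2\<close> as soon as
    \<open>j > 10 T^2\<close>.\<close>
  define j where "j = 10 * T^2 + 1"
  define e where "e = N * j^2"
  have "card (A \<times> A \<times> A) * (j^3)^2 < (e + 1)^3"
  proof -
    have "card (A \<times> A \<times> A) * (j^3)^2 = e^3"
      by (simp add: card_cartesian_product e_def N_def power_mult_distrib flip: power_mult)
         (simp add: power3_eq_cube)
    also have "\<dots> < (e + 1)^3" by (rule power_strict_mono) auto
    finally show ?thesis .
  qed
  from exists_poly_vanishing_on_rich_lines[OF this]
  obtain f :: "'a poly poly poly" where f: "f \<noteq> 0" "bidegree f \<le> 2 * e"
    "\<And>l v. 5 * e < j^3 * card {u. (u, fst v + l * u, snd v + l^2 * u) \<in> A \<times> A \<times> A} \<Longrightarrow> line_eval l v f = 0"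
    by blast
  have fP: "line_eval l v f = 0" if lv: "(l, v) \<in> P" for l v
  proof (rule f(3))
    have eq: "{u. (u, fst v + l * u, snd v + l^2 * u) \<in> A \<times> A \<times> A} = line_points A l v"
      by (auto simp: line_points_def)
    have le: "N \<le> 2 * T^2 * card (line_points A l v)" using V(3) lv by (auto simp: P_def)
    then have pos: "card (line_points A l v) > 0" using N by (auto intro!: Nat.gr0I)
    have "5 * N \<le> 10 * T^2 * card (line_points A l v)" using le by (simp add: mult_ac)
    also have "\<dots> < j * card (line_points A l v)" using pos by (simp add: j_def)
    finally have "j^2 * (5 * N) < j^2 * (j * card (line_points A l v))" by (simp add: j_def)
    then show "5 * e < j^3 * card {u. (u, fst v + l * u, snd v + l^2 * u) \<in> A \<times> A \<times> A}"
      unfolding eq by (simp add: e_def power2_eq_square power3_eq_cube mult_ac)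
  qed
  define w where "w = bidegree f"
  have w: "w \<le> 242 * T^4 * N"
  proof -
    have "j \<le> 11 * T^2" using T1 by (simp add: j_def)
    then have "j^2 \<le> 121 * T^4" using power_mono[of j "11 * T^2" 2] by (simp add: power_mult_distrib flip: power_mult)
    then have "2 * e \<le> 242 * T^4 * N" by (simp add: e_def)
    then show ?thesis using f(2) by (simp only: w_def order_trans)
  qed
  obtain g where g: "prime_elem g" "g dvd f" "bidegree g > 0"
    "card P * bidegree g \<le> card {(l, v) \<in> P. line_eval l v g = 0} * w"
    using exists_prime_factor_with_many_lines[OF f(1) finP \<open>P \<noteq> {}\<close> fP] unfolding w_def by blast
  define Pg where "Pg = {(l, v) \<in> P. line_eval l v g = 0}"
  define wg where "wg = bidegree g"
  have finPg: "finite Pg" by (rule finite_subset[OF _ finP]) (auto simp: Pg_def)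
  have Pg: "(l, v) \<in> Pg \<longleftrightarrow> l \<in> L \<and> v \<in> V l \<and> line_eval l v g = 0" for l v
    by (auto simp: Pg_def P_def)
  obtain h where h: "f = g * h" using g(2) by (rule dvdE)
  have "g \<noteq> 0" "h \<noteq> 0" using f(1) h by auto
  then have "w = wg + bidegree h" unfolding w_def wg_def h by (rule bidegree_mult)
  then have wg: "wg > 0" "wg \<le> w" using g(3) by (simp_all add: wg_def)
  have cPg: "card L * N^2 * wg \<le> 8 * T^4 * card Pg * w"
  proof -
    have "card L * N^2 * wg \<le> 8 * T^4 * (card P * wg)" using cP by simp
    also have "\<dots> \<le> 8 * T^4 * (card Pg * w)" using g(4) by (simp add: Pg_def wg_def)
    finally show ?thesis by (simp add: mult_ac)
  qed
  have nosym: "\<tau> = (0, 0)" if sym: "g dvd translate \<tau> g" for \<tau>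
  proof (rule ccontr)
    assume \<tau>: "\<tau> \<noteq> (0, 0)"
    have "card Pg > 0" using cPg wg N \<open>card L > 0\<close> by (auto intro!: Nat.gr0I)
    then obtain l v where lv: "(l, v) \<in> Pg" by (metis card_gt_0_iff ex_in_conv surj_pair)
    have "2 * wg \<le> 2 * (242 * T^4 * N)" using wg w by linarith
    also have "\<dots> < CARD('a)" using small unfolding N_def by linarith
    finally have "2 * bidegree g < CARD('a)" by (simp only: wg_def)
    then have pl: "g dvd plane_poly l v \<tau>"
      using lv by (intro translation_symmetry_imp_plane[OF prime g(1) \<tau> sym]) (auto simp: Pg)
    have "card Pg \<le> 2 * card A"
    proof (rule card_lines_in_plane_le[OF \<tau>])
      fix l' v' assume "(l', v') \<in> Pg"
      then show "line_eval l' v' (plane_poly l v \<tau>) = 0 \<and> l' \<in> L \<and> fst v' + s l' \<in> A \<and> snd v' + t l' \<in> A"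
        using st line_eval_dvd[OF pl] by (auto simp: Pg)
    qed simp
    then have "card L * N^2 * wg \<le> 8 * T^4 * (2 * N) * (242 * T^4 * N)"
      using cPg w by (elim order_trans) (intro mult_le_mono, auto simp: N_def)
    also have "\<dots> = 3872 * T^8 * N^2" by (simp add: power2_eq_square flip: power_add)
    finally have "card L * wg * N^2 \<le> 3872 * T^8 * N^2" by (simp add: mult_ac)
    then have "card L * wg \<le> 3872 * T^8" using N by simp
    moreover have "T^8 \<le> T^18" using T1 by (intro power_increasing) auto
    moreover have "card L \<le> card L * wg" using wg by simp
    moreover have "T^18 > 0" using T1 by simp
    ultimately show False using D by linarith
  qed

  \<comment> \<open>By the box condition this set contains the translation between any two chosen
    lines of equal slope, whatever the slope is.\<close>
  define \<Theta>0 where "\<Theta>0 = difference_set 1 A \<times> difference_set 1 A"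
  have c\<Theta>0: "card \<Theta>0 \<le> T^2 * N^2"
    using mult_le_mono[OF T(1) T(1)] by (simp add: \<Theta>0_def card_cartesian_product N_def power2_eq_square mult_ac)
  define Q where "Q \<tau> = {(l, v) \<in> Pg. (fst v + fst \<tau>, snd v + snd \<tau>) \<in> V l}" for \<tau>
  have finQ: "finite (Q \<tau>)" and leQ: "card (Q \<tau>) \<le> card Pg" for \<tau>
  proof -
    have "Q \<tau> \<subseteq> Pg" by (auto simp: Q_def)
    then show "finite (Q \<tau>)" "card (Q \<tau>) \<le> card Pg" using finPg by (auto intro: finite_subset card_mono)
  qed
  \<comment> \<open>The threshold is the Bezout bound for \<open>g\<close> and a translate of
    \<open>f\<close>, both of which vanish on the lines of \<open>Q \<tau>\<close>.\<close>
  define \<Theta> where "\<Theta> = {\<tau> \<in> \<Theta>0. wg * w < card (Q \<tau>)}"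
  have g_dvd: "g dvd translate \<tau> f" if "\<tau> \<in> \<Theta>" for \<tau>
  proof (rule ccontr)
    assume "\<not> g dvd translate \<tau> f"
    then have "card (Q \<tau>) \<le> bidegree g * bidegree (translate \<tau> f)"
    proof (rule card_common_lines_le[OF g(1) _ finQ])
      fix l v assume "(l, v) \<in> Q \<tau>"
      then have "(l, v) \<in> Pg" "(l, (fst v + fst \<tau>, snd v + snd \<tau>)) \<in> P" by (auto simp: Q_def P_def Pg)
      then show "line_eval l v g = 0" "line_eval l v (translate \<tau> f) = 0"
        using fP by (auto simp: Pg line_eval_translate)
    qed
    then show False using that by (simp add: \<Theta>_def bidegree_translate wg_def w_def)
  qed
  have "card \<Theta> \<le> w"
    unfolding w_def
  proof (rule card_prime_divisors_le_bidegree[OF f(1), where G = "\<lambda>\<tau>. translate (- fst \<tau>, - snd \<tau>) g"])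
    fix \<tau> assume "\<tau> \<in> \<Theta>"
    then have "translate (- fst \<tau>, - snd \<tau>) g dvd translate (- fst \<tau>, - snd \<tau>) (translate \<tau> f)"
      using g_dvd by (intro translate_dvd)
    then show "prime_elem (translate (- fst \<tau>, - snd \<tau>) g) \<and> translate (- fst \<tau>, - snd \<tau>) g dvd f \<and>
        bidegree (translate (- fst \<tau>, - snd \<tau>) g) > 0"
      using g by (simp add: translate_uminus prime_elem_translate bidegree_translate)
  next
    fix \<sigma> \<tau> assume "translate (- fst \<sigma>, - snd \<sigma>) g dvd translate (- fst \<tau>, - snd \<tau>) g"
    then have "translate \<sigma> (translate (- fst \<sigma>, - snd \<sigma>) g) dvd translate \<sigma> (translate (- fst \<tau>, - snd \<tau>) g)"
      by (rule translate_dvd)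
    then have "g dvd translate (fst \<sigma> - fst \<tau>, snd \<sigma> - snd \<tau>) g"
      by (simp add: translate_translate)
    from nosym[OF this] show "\<sigma> = \<tau>" by (simp add: prod_eq_iff)
  qed simp

  \<comment> \<open>Pairs of lines of equal slope, the first of them on \<open>g\<close>, are
    counted by the translation that takes the first to the second. There are at most
    \<open>w\<close> popular translations, and each unpopular one accounts for at most
    \<open>wg * w\<close> pairs; each of the two contributions is then shown to fall within half of
    the total.\<close>
  have "card Pg * N^2 \<le> 8 * T^4 * (\<Sum>\<tau>\<in>\<Theta>0. card (Q \<tau>))"
  proof -
    have "card Pg * N^2 = (\<Sum>x\<in>Pg. N^2)" by simp
    also have "\<dots> \<le> (\<Sum>x\<in>Pg. 8 * T^4 * card (V (fst x)))"
      by (intro sum_mono V(2)) (auto simp: Pg)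
    also have "\<dots> = 8 * T^4 * card (SIGMA x:Pg. V (fst x))"
      using finPg V(1) by (subst card_SigmaI) (auto simp: Pg sum_distrib_left)
    also have "card (SIGMA x:Pg. V (fst x)) \<le> card (SIGMA \<tau>:\<Theta>0. Q \<tau>)"
    proof (rule card_inj_on_le)
      let ?h = "\<lambda>((l, v), v'). ((fst v' - fst v, snd v' - snd v), (l, v))"
      show "inj_on ?h (SIGMA x:Pg. V (fst x))" by (auto simp: inj_on_def)
      show "?h ` (SIGMA x:Pg. V (fst x)) \<subseteq> (SIGMA \<tau>:\<Theta>0. Q \<tau>)"
      proof clarify
        fix l a b a' b' assume lv: "(l, a, b) \<in> Pg" "(a', b') \<in> V (fst (l, a, b))"
        have "a + s l \<in> A" "b + t l \<in> A" "a' + s l \<in> A" "b' + t l \<in> A"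
          using lv st[of l "(a, b)"] st[of l "(a', b')"] by (auto simp: Pg)
        then have "((a' + s l) - 1 * (a + s l), (b' + t l) - 1 * (b + t l)) \<in> \<Theta>0"
          unfolding \<Theta>0_def by (intro SigmaI difference_setI)
        then have "(a' - a, b' - b) \<in> \<Theta>0" by simp
        moreover have "(l, a, b) \<in> Q (a' - a, b' - b)" using lv by (simp add: Q_def)
        ultimately show "(fst (a', b') - fst (a, b), snd (a', b') - snd (a, b)) \<in> \<Theta>0 \<and>
            (l, a, b) \<in> Q (fst (a', b') - fst (a, b), snd (a', b') - snd (a, b))" by simp
      qed
      show "finite (SIGMA \<tau>:\<Theta>0. Q \<tau>)" using finQ by auto
    qed
    also have "card (SIGMA \<tau>:\<Theta>0. Q \<tau>) = (\<Sum>\<tau>\<in>\<Theta>0. card (Q \<tau>))" using finQ by simp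
    finally show ?thesis by simp
  qed
  also have "(\<Sum>\<tau>\<in>\<Theta>0. card (Q \<tau>)) \<le> (\<Sum>\<tau>\<in>\<Theta>0. (if \<tau> \<in> \<Theta> then card Pg else 0) + wg * w)"
    by (rule sum_mono) (use leQ in \<open>auto simp: \<Theta>_def intro: trans_le_add1\<close>)
  also have "\<dots> = card \<Theta> * card Pg + card \<Theta>0 * (wg * w)"
    by (simp add: sum.distrib sum.If_cases \<Theta>_def Int_def)
  also have "\<dots> \<le> w * card Pg + (T^2 * N^2) * (wg * w)"
    using \<open>card \<Theta> \<le> w\<close> c\<Theta>0 by (intro add_mono mult_le_mono) auto
  finally have main: "card Pg * N^2 \<le> 8 * T^4 * w * card Pg + 8 * T^6 * N^2 * wg * w"
    by (simp add: algebra_simps flip: power_add)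
  have a: "2 * (8 * T^4 * w) \<le> N^2"
  proof -
    have "2 * (8 * T^4 * w) = 16 * T^4 * w" by simp
    also have "\<dots> \<le> 16 * T^4 * (242 * T^4 * N)" by (rule mult_le_mono2[OF w])
    also have "\<dots> = 3872 * T^8 * N" by (simp flip: power_add)
    also have "\<dots> \<le> N * N" using large by (simp add: N_def)
    finally show ?thesis by (simp add: power2_eq_square)
  qed
  have b: "2 * (8 * T^6 * N^2 * wg * w) < card Pg * N^2"
  proof -
    have "T^18 > 0" using T1 by simp
    have "w > 0" using wg by simp
    have "16 * T^6 * wg * w * (8 * T^4 * w) \<le> 16 * T^6 * wg * (242 * T^4 * N) * (8 * T^4 * (242 * T^4 * N))"
      using w by (intro mult_le_mono) auto
    also have "\<dots> = 7496192 * T^18 * N^2 * wg" by (simp add: power2_eq_square mult_ac flip: power_add)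
    also have "\<dots> < 7500000 * T^18 * N^2 * wg" using \<open>T^18 > 0\<close> N wg by simp
    also have "\<dots> \<le> card L * N^2 * wg" using D by simp
    also have "\<dots> \<le> card Pg * (8 * T^4 * w)" using cPg by (simp add: mult_ac)
    finally have "16 * T^6 * wg * w < card Pg" by (simp only: mult_less_cancel2)
    then have "16 * T^6 * wg * w * N^2 < card Pg * N^2" using N by simp
    then show ?thesis by (simp add: mult_ac)
  qed
  have "2 * (8 * T^4 * w * card Pg) = 2 * (8 * T^4 * w) * card Pg" by (simp only: mult.assoc)
  also have "\<dots> \<le> N^2 * card Pg" by (rule mult_le_mono1[OF a])
  also have "\<dots> = card Pg * N^2" by (rule mult.commute)
  finally show False using main b by linarith
qed

section \<open>Projections of planar sets\<close>

definition differences :: "'a::ab_group_add set \<Rightarrow> 'a set \<Rightarrow> 'a set"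
  where "differences U W = (\<lambda>(u, w). u - w) ` (U \<times> W)"

lemma differencesI: "u \<in> U \<Longrightarrow> w \<in> W \<Longrightarrow> u - w \<in> differences U W"
  unfolding differences_def by (rule image_eqI[of _ _ "(u, w)"]) auto

lemma finite_differences: "finite U \<Longrightarrow> finite W \<Longrightarrow> finite (differences U W)"
  by (simp add: differences_def)

lemma Ruzsa_triangle:
  assumes "finite U" "finite V" "finite W"
  shows "card (differences U W) * card V \<le> card (differences U V) * card (differences V W)"
proof -
  have "\<forall>d\<in>differences U W. \<exists>u w. u \<in> U \<and> w \<in> W \<and> d = u - w" by (auto simp: differences_def)
  then obtain f g where fg: "\<And>d. d \<in> differences U W \<Longrightarrow> f d \<in> U \<and> g d \<in> W \<and> d = f d - g d"
    by metis
  have "card (differences U W \<times> V) \<le> card (differences U V \<times> differences V W)"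
  proof (rule card_inj_on_le)
    let ?h = "\<lambda>(d, v). (f d - v, v - g d)"
    show "inj_on ?h (differences U W \<times> V)"
    proof (rule inj_onI)
      fix x y assume xy: "x \<in> differences U W \<times> V" "y \<in> differences U W \<times> V" "?h x = ?h y"
      obtain d v d' v' where [simp]: "x = (d, v)" "y = (d', v')" by (cases x, cases y)
      have e: "f d - v = f d' - v'" "v - g d = v' - g d'" using xy by auto
      have d: "d = f d - g d" "d' = f d' - g d'" using fg xy by auto
      have "f d - g d = (f d - v) + (v - g d)" by simp
      also have "\<dots> = (f d' - v') + (v' - g d')" by (simp only: e)
      also have "\<dots> = f d' - g d'" by simp
      finally have "d = d'" using d by metis
      then show "x = y" using e by simp
    qed
    show "?h ` (differences U W \<times> V) \<subseteq> differences U V \<times> differences V W"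
      using fg by (auto intro: differencesI)
    show "finite (differences U V \<times> differences V W)" using assms by (simp add: finite_differences)
  qed
  then show ?thesis by (simp add: card_cartesian_product)
qed

lemma sum_square_le:
  fixes f :: "'b \<Rightarrow> real"
  assumes "finite I"
  shows "(\<Sum>i\<in>I. f i)^2 \<le> real (card I) * (\<Sum>i\<in>I. (f i)^2)"
proof (cases "I = {}")
  case False
  define m where "m = (\<Sum>i\<in>I. f i) / card I"
  have c: "real (card I) > 0" using False assms by (simp add: card_gt_0_iff)
  have "0 \<le> (\<Sum>i\<in>I. (f i - m)^2)" by (intro sum_nonneg) auto
  also have "\<dots> = (\<Sum>i\<in>I. (f i)^2 - (2 * m) * f i + m^2)"
    by (intro sum.cong) (simp_all add: power2_diff)
  also have "\<dots> = (\<Sum>i\<in>I. (f i)^2) - 2 * m * (\<Sum>i\<in>I. f i) + card I * m^2"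
    by (simp only: sum.distrib sum_subtractf sum_constant flip: sum_distrib_left)
  also have "\<dots> = (\<Sum>i\<in>I. (f i)^2) - (\<Sum>i\<in>I. f i)^2 / card I"
    using c by (simp add: m_def power2_eq_square field_simps)
  finally show ?thesis using c by (simp add: field_simps)
qed simp

lemma markov_card:
  fixes f :: "'b \<Rightarrow> real" and c M :: real
  assumes fin: "finite I" and le: "\<And>i. i \<in> I \<Longrightarrow> f i \<le> M" and c: "c \<ge> 0" and M: "M \<ge> 0"
  shows "(\<Sum>i\<in>I. f i) \<le> card {i \<in> I. f i \<ge> c} * M + card I * c"
proof -
  have "(\<Sum>i\<in>I. f i) \<le> (\<Sum>i\<in>I. (if f i \<ge> c then M else 0) + c)"
    by (intro sum_mono) (use le c M in \<open>auto intro: add_increasing2\<close>)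
  also have "\<dots> = card {i \<in> I. f i \<ge> c} * M + card I * c"
    using fin by (simp add: sum.distrib sum.If_cases Int_def)
  finally show ?thesis .
qed

text \<open>The graph-theoretic core of the Balog--Szemeredi--Gowers theorem. The conclusion concerns the
  graph alone, which is what allows a single pair of sets to serve all slopes at once.\<close>

lemma dense_graph_three_paths:
  fixes K :: "('b \<times> 'c) set" and \<alpha> :: real
  assumes fin: "finite A" "finite B" and K: "K \<subseteq> A \<times> B" and \<alpha>: "0 < \<alpha>"
    and dens: "\<alpha> * card A * card B \<le> card K" and ne: "K \<noteq> {}"
  obtains A' B' where "A' \<subseteq> A" "B' \<subseteq> B" "\<alpha> * card A \<le> 6 * card A'" "\<alpha> * card B \<le> 4 * card B'"
    "A' \<noteq> {}" "B' \<noteq> {}"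
    "\<And>a b. a \<in> A' \<Longrightarrow> b \<in> B' \<Longrightarrow> \<alpha>^5 * card A * card B
      \<le> 3072 * card {(a1, b1). (a, b1) \<in> K \<and> (a1, b1) \<in> K \<and> (a1, b) \<in> K}"
proof -
  define a where "a = real (card A)"
  define b where "b = real (card B)"
  have pos: "a > 0" "b > 0" using ne K fin by (auto simp: a_def b_def card_gt_0_iff)
  have finK: "finite K" using K fin by (rule finite_subset[OF _ finite_cartesian_product])
  define N where "N x = {y \<in> B. (x, y) \<in> K}" for x
  define A0 where "A0 = {x \<in> A. real (card (N x)) \<ge> \<alpha> * b / 2}"
  define M where "M y = {x \<in> A0. (x, y) \<in> K}" for y
  have finN: "finite (N x)" for x using fin by (simp add: N_def)
  have finA0: "finite A0" "A0 \<subseteq> A" using fin by (auto simp: A0_def)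
  have finM: "finite (M y)" for y using finA0 by (simp add: M_def)
  have cA0: "real (card A0) \<le> a" using finA0 fin by (simp add: a_def card_mono)

  have e1: "\<alpha> * a * b / 2 \<le> (\<Sum>y\<in>B. real (card (M y)))"
  proof -
    have "\<alpha> * a * b \<le> real (card K)" using dens by (simp add: a_def b_def)
    also have "card K = card (SIGMA x:A. N x)"
      by (rule arg_cong[of _ _ card]) (use K in \<open>auto simp: N_def\<close>)
    also have "real \<dots> = (\<Sum>x\<in>A. real (card (N x)))" using fin finN by simp
    also have "\<dots> = (\<Sum>x\<in>A0. real (card (N x))) + (\<Sum>x\<in>A - A0. real (card (N x)))"
      using sum.subset_diff[of A0 A "\<lambda>x. real (card (N x))"] fin finA0 by simp
    also have "(\<Sum>x\<in>A - A0. real (card (N x))) \<le> (\<Sum>x\<in>A - A0. \<alpha> * b / 2)"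
      by (intro sum_mono) (auto simp: A0_def)
    also have "\<dots> \<le> a * (\<alpha> * b / 2)"
      using \<alpha> pos fin by (simp add: a_def mult_right_mono card_mono)
    also have "(\<Sum>x\<in>A0. real (card (N x))) = real (card (SIGMA x:A0. N x))" using finA0 finN by simp
    also have "card (SIGMA x:A0. N x) = card (SIGMA y:B. M y)"
      by (rule bij_betw_same_card[of "\<lambda>(x, y). (y, x)"])
         (auto simp: bij_betw_def inj_on_def N_def M_def image_def)
    also have "real \<dots> = (\<Sum>y\<in>B. real (card (M y)))" using fin finM by simp
    finally show ?thesis by (simp add: field_simps)
  qed
  have e2: "\<alpha>^2 * a^2 * b / 4 \<le> (\<Sum>y\<in>B. (real (card (M y)))^2)"
  proof -
    have "(\<alpha> * a * b / 2)^2 \<le> (\<Sum>y\<in>B. real (card (M y)))^2"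
      using e1 \<alpha> pos by (intro power_mono) auto
    also have "\<dots> \<le> b * (\<Sum>y\<in>B. (real (card (M y)))^2)" unfolding b_def by (rule sum_square_le[OF fin(2)])
    finally have "b * (\<alpha>^2 * a^2 * b / 4) \<le> b * (\<Sum>y\<in>B. (real (card (M y)))^2)"
      by (simp add: power2_eq_square algebra_simps)
    then show ?thesis using pos by simp
  qed
  \<comment> \<open>Chosen so that the bad pairs, with the penalty \<open>16 / \<alpha>\<close>, use
    up at most half of the second moment bounded below in \<open>e2\<close>. The penalty in turn
    ensures that the bad pairs inside \<open>M y0\<close> are at most a fraction
    \<open>\<alpha> / 16\<close> of all pairs there.\<close>
  define \<beta> where "\<beta> = \<alpha>^3 / 128"
  define bad where "bad x x' \<longleftrightarrow> real (card (N x \<inter> N x')) < \<beta> * b" for x x'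
  define Z where "Z y = {(x, x') \<in> M y \<times> M y. bad x x'}" for y
  have finZ: "finite (Z y)" for y using finM by (auto simp: Z_def intro: finite_subset[of _ "M y \<times> M y"])
  have e3: "(\<Sum>y\<in>B. real (card (Z y))) \<le> a^2 * (\<beta> * b)"
  proof -
    let ?I = "{(x, x') \<in> A0 \<times> A0. bad x x'}"
    have finI: "finite ?I" using finA0 by (auto intro: finite_subset[of _ "A0 \<times> A0"])
    have "(\<Sum>y\<in>B. card (Z y)) = card (SIGMA y:B. Z y)" using fin finZ by simp
    also have "\<dots> \<le> card (SIGMA i:?I. N (fst i) \<inter> N (snd i))"
    proof (rule card_inj_on_le)
      show "inj_on (\<lambda>(y, i). (i, y)) (SIGMA y:B. Z y)" by (auto simp: inj_on_def)
      show "(\<lambda>(y, i). (i, y)) ` (SIGMA y:B. Z y) \<subseteq> (SIGMA i:?I. N (fst i) \<inter> N (snd i))"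
        by (auto simp: Z_def M_def N_def)
      show "finite (SIGMA i:?I. N (fst i) \<inter> N (snd i))" using finI finN by auto
    qed
    also have "\<dots> = (\<Sum>i\<in>?I. card (N (fst i) \<inter> N (snd i)))" using finI finN by simp
    finally have "(\<Sum>y\<in>B. real (card (Z y))) \<le> (\<Sum>i\<in>?I. real (card (N (fst i) \<inter> N (snd i))))"
      by (simp flip: of_nat_sum)
    also have "\<dots> \<le> (\<Sum>i\<in>?I. \<beta> * b)" by (intro sum_mono) (auto simp: bad_def)
    also have "\<dots> = real (card ?I) * (\<beta> * b)" by simp
    also have "\<dots> \<le> a^2 * (\<beta> * b)"
    proof (rule mult_right_mono)
      have "card ?I \<le> card (A0 \<times> A0)" using finA0 by (intro card_mono) auto
      then have "real (card ?I) \<le> real (card A0) * real (card A0)"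
        by (simp add: card_cartesian_product flip: of_nat_mult)
      also have "\<dots> \<le> a * a" using cA0 by (intro mult_mono) (auto simp: a_def)
      finally show "real (card ?I) \<le> a^2" by (simp add: power2_eq_square)
    qed (use \<alpha> pos in \<open>simp add: \<beta>_def\<close>)
    finally show ?thesis .
  qed
  define q where "q = 16 / \<alpha> * (\<Sum>y\<in>B. real (card (Z y)))"
  have "\<exists>y\<in>B. (real (card (M y)))^2 - 16 / \<alpha> * real (card (Z y)) \<ge> \<alpha>^2 * a^2 / 8"
  proof (rule ccontr)
    assume "\<not> ?thesis"
    then have "(\<Sum>y\<in>B. (real (card (M y)))^2 - 16 / \<alpha> * real (card (Z y))) < (\<Sum>y\<in>B. \<alpha>^2 * a^2 / 8)"
      using fin pos by (intro sum_strict_mono) (auto simp: b_def not_le)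
    also have "\<dots> = \<alpha>^2 * a^2 * b / 8" by (simp add: b_def)
    finally have lt: "(\<Sum>y\<in>B. (real (card (M y)))^2) - q < \<alpha>^2 * a^2 * b / 8"
      by (simp add: sum_subtractf sum_distrib_left q_def)
    have "q \<le> 16 / \<alpha> * (a^2 * (\<beta> * b))"
      unfolding q_def using e3 \<alpha> by (intro mult_left_mono) auto
    also have "\<dots> = \<alpha>^2 * a^2 * b / 8"
      using \<alpha> by (simp add: \<beta>_def power2_eq_square power3_eq_cube field_simps)
    finally show False using e2 lt by linarith
  qed
  then obtain y0 where y0: "y0 \<in> B" "(real (card (M y0)))^2 - 16 / \<alpha> * real (card (Z y0)) \<ge> \<alpha>^2 * a^2 / 8"
    by blast
  define c where "c = real (card (M y0))"
  have zle: "real (card (Z y0)) \<le> \<alpha> / 16 * c^2"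
  proof -
    have "0 \<le> \<alpha>^2 * a^2 / 8" by simp
    then have "16 / \<alpha> * real (card (Z y0)) \<le> c^2" using y0(2) unfolding c_def by linarith
    then show ?thesis using \<alpha> by (simp add: field_simps)
  qed
  have c: "\<alpha> * a \<le> 3 * c"
  proof -
    have "0 \<le> 16 / \<alpha> * real (card (Z y0))" using \<alpha> by simp
    then have "\<alpha>^2 * a^2 / 8 \<le> c^2" using y0(2) unfolding c_def by linarith
    moreover have "0 \<le> c^2" by simp
    ultimately have "\<alpha>^2 * a^2 \<le> 9 * c^2" by linarith
    then have "(\<alpha> * a)^2 \<le> (3 * c)^2" by (simp add: power_mult_distrib)
    then show ?thesis by (rule power2_le_imp_le) (simp add: c_def)
  qed
  have cpos: "c > 0" using c \<alpha> pos by (smt (verit) mult_pos_pos)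
  define B' where "B' = {y \<in> B. real (card (M y \<inter> M y0)) \<ge> \<alpha> * c / 4}"
  have B': "\<alpha> * b \<le> 4 * card B'"
  proof -
    have "c * (\<alpha> * b / 2) = (\<Sum>x\<in>M y0. \<alpha> * b / 2)" by (simp add: c_def)
    also have "\<dots> \<le> (\<Sum>x\<in>M y0. real (card (N x)))" by (intro sum_mono) (auto simp: M_def A0_def)
    also have "\<dots> = real (card (SIGMA x:M y0. N x))" using finM finN by simp
    also have "card (SIGMA x:M y0. N x) = card (SIGMA y:B. M y \<inter> M y0)"
      by (rule bij_betw_same_card[of "\<lambda>(x, y). (y, x)"])
         (auto simp: bij_betw_def inj_on_def N_def M_def image_def)
    also have "real \<dots> = (\<Sum>y\<in>B. real (card (M y \<inter> M y0)))" using fin finM by simp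
    also have "\<dots> \<le> card B' * c + card B * (\<alpha> * c / 4)"
      unfolding B'_def by (rule markov_card[OF fin(2)])
        (use \<alpha> finM in \<open>auto simp: c_def intro: card_mono\<close>)
    finally have "c * (\<alpha> * b) \<le> c * (4 * card B')" by (simp add: b_def field_simps)
    then show ?thesis using cpos by simp
  qed
  define bc where "bc x = real (card {x' \<in> M y0. bad x x'})" for x
  define A1 where "A1 = {x \<in> M y0. bc x < \<alpha> * c / 8}"
  have A1: "\<alpha> * a \<le> 6 * card A1"
  proof -
    have "real (card (M y0 - A1)) * (\<alpha> * c / 8) = (\<Sum>x\<in>M y0 - A1. \<alpha> * c / 8)" by simp
    also have "\<dots> \<le> (\<Sum>x\<in>M y0 - A1. bc x)" by (intro sum_mono) (auto simp: A1_def)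
    also have "\<dots> \<le> (\<Sum>x\<in>M y0. bc x)" by (intro sum_mono2 finM) (auto simp: bc_def)
    also have "\<dots> = real (card (SIGMA x:M y0. {x' \<in> M y0. bad x x'}))" using finM by (simp add: bc_def)
    also have "(SIGMA x:M y0. {x' \<in> M y0. bad x x'}) = Z y0" by (auto simp: Z_def)
    also have "real (card (Z y0)) \<le> \<alpha> / 16 * c^2" by (rule zle)
    finally have "(\<alpha> * c / 8) * real (card (M y0 - A1)) \<le> (\<alpha> * c / 8) * (c / 2)"
      by (simp add: power2_eq_square mult_ac)
    then have "real (card (M y0 - A1)) \<le> c / 2" using \<alpha> cpos by simp
    moreover have "real (card (M y0)) = real (card A1) + real (card (M y0 - A1))"
    proof -
      have "A1 \<subseteq> M y0" by (auto simp: A1_def)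
      then show ?thesis using finM[of y0] card_mono[of "M y0" A1]
        by (simp add: card_Diff_subset finite_subset)
    qed
    ultimately have "c \<le> 2 * card A1" by (simp add: c_def)
    then show ?thesis using c by simp
  qed
  show thesis
  proof (rule that[of A1 B'])
    show "A1 \<subseteq> A" using finA0 by (auto simp: A1_def M_def)
    show "B' \<subseteq> B" by (auto simp: B'_def)
    show "\<alpha> * card A \<le> 6 * card A1" using A1 by (simp add: a_def)
    show "\<alpha> * card B \<le> 4 * card B'" using B' by (simp add: b_def)
    have "\<alpha> * a > 0" "\<alpha> * b > 0" using \<alpha> pos by auto
    then show "A1 \<noteq> {}" "B' \<noteq> {}" using A1 B' by auto
    fix x y assume x: "x \<in> A1" and y: "y \<in> B'"
    let ?G = "{x' \<in> M y \<inter> M y0. \<not> bad x x'}"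
    let ?P = "{(a1, b1). (x, b1) \<in> K \<and> (a1, b1) \<in> K \<and> (a1, y) \<in> K}"
    have "real (card (M y \<inter> M y0)) \<le> real (card ?G) + real (card {x' \<in> M y0. bad x x'})"
    proof -
      have "card (M y \<inter> M y0) \<le> card (?G \<union> {x' \<in> M y0. bad x x'})"
        using finM by (intro card_mono) auto
      also have "\<dots> \<le> card ?G + card {x' \<in> M y0. bad x x'}" by (rule card_Un_le)
      finally show ?thesis by (simp flip: of_nat_add)
    qed
    moreover have "real (card (M y \<inter> M y0)) \<ge> \<alpha> * c / 4" using y by (simp add: B'_def)
    moreover have "real (card {x' \<in> M y0. bad x x'}) < \<alpha> * c / 8" using x by (simp add: A1_def bc_def)
    \<comment> \<open>Membership of \<open>y\<close> in \<open>B'\<close> supplies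
      \<open>\<alpha> * c / 4\<close> neighbours in \<open>M y0\<close>, and membership of
      \<open>x\<close> in \<open>A1\<close> spoils fewer than half of that number. Each remaining
      neighbour shares at least \<open>\<beta> * b\<close> neighbours with \<open>x\<close>, and
      this gives the paths.\<close>
    ultimately have G: "real (card ?G) \<ge> \<alpha> * c / 8" by linarith
    have finG: "finite ?G" using finM by simp
    have "\<alpha> * (\<alpha> * a / 3) / 8 * (\<beta> * b) \<le> \<alpha> * c / 8 * (\<beta> * b)"
      using c \<alpha> pos by (intro mult_right_mono) (auto simp: \<beta>_def)
    also have "\<dots> \<le> real (card ?G) * (\<beta> * b)" using G \<alpha> pos by (intro mult_right_mono) (auto simp: \<beta>_def)
    also have "\<dots> = (\<Sum>x'\<in>?G. \<beta> * b)" by simp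
    also have "\<dots> \<le> (\<Sum>x'\<in>?G. real (card (N x \<inter> N x')))" by (intro sum_mono) (auto simp: bad_def)
    also have "\<dots> = real (card (SIGMA x':?G. N x \<inter> N x'))" using finG finN by simp
    also have "\<dots> \<le> real (card ?P)"
    proof (intro of_nat_mono card_mono)
      show "finite ?P" by (rule finite_subset[OF _ finK]) auto
      show "(SIGMA x':?G. N x \<inter> N x') \<subseteq> ?P" by (auto simp: N_def M_def)
    qed
    finally have le: "\<alpha> * (\<alpha> * a / 3) / 8 * (\<beta> * b) \<le> real (card ?P)" .
    \<comment> \<open>The factor is \<open>3 * 8 * 128\<close>, from
      \<open>c \<ge> \<alpha> * a / 3\<close>, the eighth of \<open>\<alpha> * c\<close> and the
      definition of \<beta>.\<close>
    have "\<alpha>^5 * a * b = 3072 * (\<alpha> * (\<alpha> * a / 3) / 8 * (\<beta> * b))"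
      by (simp add: \<beta>_def eval_nat_numeral)
    then show "\<alpha>^5 * card A * card B \<le> 3072 * card ?P"
      using le unfolding a_def b_def by linarith
  qed
qed

section \<open>From planar projections to slopes with small difference sets\<close>

lemma differences_scaled:
  fixes U W :: "'a::field set"
  assumes "c \<noteq> 0"
  shows "card (differences ((*) c ` U) ((*) c ` W)) = card (differences U W)"
proof -
  have "differences ((*) c ` U) ((*) c ` W) = (*) c ` differences U W"
    unfolding differences_def by (force simp: right_diff_distrib image_iff)
  then show ?thesis using assms by (simp add: card_image inj_on_def)
qed

lemma card_differences_commute: "card (differences U W) = card (differences W U)"
proof -
  have "differences U W = uminus ` differences W U"
    unfolding differences_def by (force simp: image_iff)
  then show ?thesis by (simp add: card_image)
qed

lemma difference_set_eq: "difference_set l A = differences A ((*) l ` A)"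
  unfolding difference_set_def differences_def by (force simp: image_iff)

lemma card_scaled: "c \<noteq> 0 \<Longrightarrow> card ((*) c ` (A :: 'a::field set)) = card A"
  by (rule card_image) (simp add: inj_on_def)

text \<open>Two of the directions become coordinate axes, so that \<open>K\<close> turns into a
  dense bipartite graph and every other projection into \<open>u - \<mu> t * w\<close>. One pair
  \<open>A'\<close>, \<open>B'\<close> works for all \<open>t\<close>, and Ruzsa's inequality
  eliminates \<open>B'\<close> at the price of replacing \<open>\<mu> t\<close> by a ratio. The last
  two alternatives are the cases in which a size hypothesis of \<open>card_slopes_lt\<close>
  fails.\<close>

theorem planar_projections:
  fixes K :: "('a::{field_gcd,finite} \<times> 'a) set"
  assumes prime: "\<And>x::'a. \<exists>j. x = of_nat j"
    and K: "K \<noteq> {}" and \<tau>: "X^2 \<le> \<tau> * card K"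
    and proj: "\<And>t. t \<in> \<Theta> \<Longrightarrow> card ((\<lambda>(a, b). b - t * a) ` K) \<le> X"
  shows "card \<Theta> \<le> 2^1032 * \<tau>^576 \<or> X \<le> 2^1032 * \<tau>^576 \<or> CARD('a) \<le> 2^1032 * \<tau>^576 * X"
proof (cases "card \<Theta> \<le> 3")
  case True
  show ?thesis
  proof (cases "\<tau> = 0")
    case True
    then show ?thesis using \<tau> by simp
  next
    case False
    then have "3 \<le> (2::nat)^1032 * \<tau>^576"
      by (intro order_trans[OF _ mult_le_mono[of "2^2" "2^1032" 1 "\<tau>^576"]] power_increasing) auto
    then show ?thesis using \<open>card \<Theta> \<le> 3\<close> by linarith
  qed
next
  case False
  obtain t0 t1 where t01: "t0 \<in> \<Theta>" "t1 \<in> \<Theta>" "t0 \<noteq> t1"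
    using False card_le_Suc0_iff_eq[of \<Theta>] by fastforce
  define \<Theta>' where "\<Theta>' = \<Theta> - {t0, t1}"
  have c\<Theta>': "card \<Theta> = card \<Theta>' + 2" using t01 False
    by (simp add: \<Theta>'_def card_Diff_subset)
  then have "\<Theta>' \<noteq> {}" using False by auto
  then obtain t2 where t2: "t2 \<in> \<Theta>'" by blast
  define h where "h = (\<lambda>(a, b). (b - t0 * a, b - t1 * a))"
  have "inj h"
  proof (rule injI)
    fix x y assume h: "h x = h y"
    obtain a b a' b' where [simp]: "x = (a, b)" "y = (a', b')" by (cases x, cases y)
    have e: "b - t0 * a = b' - t0 * a'" "b - t1 * a = b' - t1 * a'" using h by (auto simp: h_def)
    have "(t0 - t1) * (a - a') = ((b - t1 * a) - (b - t0 * a)) - ((b' - t1 * a') - (b' - t0 * a'))"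
      by (simp add: algebra_simps)
    also have "\<dots> = 0" by (simp add: e)
    finally have "a = a'" using t01 by simp
    then show "x = y" using e by simp
  qed
  define G where "G = h ` K"
  define A where "A = fst ` G"
  define B where "B = snd ` G"
  have cG: "card G = card K" unfolding G_def using \<open>inj h\<close> by (intro card_image) (auto intro: inj_on_subset)
  have G: "G \<noteq> {}" "G \<subseteq> A \<times> B" using K unfolding A_def B_def by (simp add: G_def, force)
  have cA: "card A \<le> X" and cB: "card B \<le> X"
    using proj[OF t01(1)] proj[OF t01(2)] by (simp_all add: A_def B_def G_def h_def image_image case_prod_unfold)
  have ne: "A \<noteq> {}" "B \<noteq> {}" using G by (auto simp: A_def B_def)
  then have pos: "card A > 0" "card B > 0" "X > 0" using cA cB by (auto simp: card_gt_0_iff)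
  have \<tau>0: "\<tau> > 0" using \<tau> pos by (auto intro: Nat.gr0I)
  define \<mu> where "\<mu> t = (t - t0) / (t - t1)" for t
  have \<mu>_proj: "card ((\<lambda>(u, w). u - \<mu> t * w) ` G) \<le> X" if t: "t \<in> \<Theta>'" for t
  proof -
    have nz: "t - t1 \<noteq> 0" using t by (auto simp: \<Theta>'_def)
    have "u - \<mu> t * w = (t0 - t1) / (t - t1) * (b - t * a)" if "(u, w) = h (a, b)" for u w a b
    proof -
      have uw: "u = b - t0 * a" "w = b - t1 * a" using that by (auto simp: h_def)
      show ?thesis using nz by (simp add: \<mu>_def uw field_simps)
    qed
    then have "(\<lambda>(u, w). u - \<mu> t * w) ` G = (*) ((t0 - t1) / (t - t1)) ` (\<lambda>(a, b). b - t * a) ` K"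
      unfolding G_def image_image by (intro image_cong refl) (auto simp: h_def)
    then show ?thesis using proj[of t] t card_image_le[of "(\<lambda>(a, b). b - t * a) ` K"]
      by (metis (no_types, lifting) DiffD1 \<Theta>'_def finite_code order_trans)
  qed
  have \<mu>0: "\<mu> t \<noteq> 0" if "t \<in> \<Theta>'" for t using that by (auto simp: \<mu>_def \<Theta>'_def)
  have \<mu>_inj: "inj_on \<mu> \<Theta>'"
  proof (rule inj_onI)
    fix s t assume st: "s \<in> \<Theta>'" "t \<in> \<Theta>'" "\<mu> s = \<mu> t"
    have "s - t1 \<noteq> 0" "t - t1 \<noteq> 0" using st by (auto simp: \<Theta>'_def)
    then have "(s - t0) * (t - t1) = (t - t0) * (s - t1)" using st(3) by (simp add: \<mu>_def field_simps)
    then have "(s - t) * (t0 - t1) = 0" by (simp add: algebra_simps)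
    then show "s = t" using t01 by simp
  qed
  have dens: "1 / real \<tau> * card A * card B \<le> card G"
  proof -
    have "card A * card B \<le> X * X" using cA cB by (rule mult_le_mono)
    also have "\<dots> \<le> \<tau> * card G" using \<tau> cG by (simp add: power2_eq_square)
    finally have "real (card A * card B) \<le> real (\<tau> * card G)" by (rule of_nat_mono)
    then show ?thesis using \<tau>0 by (simp add: field_simps)
  qed
  obtain A' B' where AB: "A' \<subseteq> A" "B' \<subseteq> B" "1 / real \<tau> * card A \<le> 6 * card A'" "1 / real \<tau> * card B \<le> 4 * card B'"
    "A' \<noteq> {}" "B' \<noteq> {}"
    and paths: "\<And>a b. a \<in> A' \<Longrightarrow> b \<in> B' \<Longrightarrow> (1 / real \<tau>)^5 * card A * card B
      \<le> 3072 * card {(a1, b1). (a, b1) \<in> G \<and> (a1, b1) \<in> G \<and> (a1, b) \<in> G}"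
    by (rule dense_graph_three_paths[OF _ _ G(2) _ dens G(1)]) (use \<tau>0 in auto)
  have X_le: "X^2 \<le> \<tau> * (card A * card B)"
  proof -
    have "card G \<le> card (A \<times> B)" using G(2) by (intro card_mono) auto
    then show ?thesis using \<tau> cG by (simp add: card_cartesian_product) (meson mult_le_mono2 order_trans)
  qed
  have XA: "X \<le> \<tau> * card A" and XB: "X \<le> \<tau> * card B"
  proof -
    have le: "X * X \<le> \<tau> * (card A * card B)" using X_le by (simp add: power2_eq_square)
    also have "\<dots> \<le> \<tau> * (card A * X)" using cB by (intro mult_le_mono2)
    finally have "X * X \<le> \<tau> * card A * X" by (simp only: mult.assoc)
    then show "X \<le> \<tau> * card A" using pos by (simp only: mult_le_cancel2)
    note le
    also have "\<tau> * (card A * card B) \<le> \<tau> * (X * card B)" using cA by (intro mult_le_mono2 mult_le_mono1)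
    finally have "X * X \<le> X * (\<tau> * card B)" by (simp only: mult_ac)
    then show "X \<le> \<tau> * card B" using pos by (simp only: mult_le_cancel1)
  qed
  have cA': "X \<le> 6 * \<tau>^2 * card A'"
  proof -
    have "real (card A) \<le> real (6 * \<tau> * card A')" using AB(3) \<tau>0 by (simp add: field_simps)
    then have "card A \<le> 6 * \<tau> * card A'" by (simp only: of_nat_le_iff)
    then have "\<tau> * card A \<le> \<tau> * (6 * \<tau> * card A')" by (rule mult_le_mono2)
    also have "\<dots> = 6 * \<tau>^2 * card A'" by (simp add: power2_eq_square)
    finally show ?thesis using XA by linarith
  qed
  have cB': "X \<le> 4 * \<tau>^2 * card B'"
  proof -
    have "real (card B) \<le> real (4 * \<tau> * card B')" using AB(4) \<tau>0 by (simp add: field_simps)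
    then have "card B \<le> 4 * \<tau> * card B'" by (simp only: of_nat_le_iff)
    then have "\<tau> * card B \<le> \<tau> * (4 * \<tau> * card B')" by (rule mult_le_mono2)
    also have "\<dots> = 4 * \<tau>^2 * card B'" by (simp add: power2_eq_square)
    finally show ?thesis using XB by linarith
  qed
  \<comment> \<open>Along a path \<open>a, b1, a1, b\<close> the difference
    \<open>a - \<mu> t * b\<close> is an alternating sum of three values of the projection on edges.
    There are at most \<open>X^3\<close> triples of values, and every difference arises from many of
    them.\<close>
  have diff: "card (differences A' ((*) (\<mu> t) ` B')) \<le> 3072 * \<tau>^6 * X" if t: "t \<in> \<Theta>'" for t
  proof -
    define S where "S = (\<lambda>(u, w). u - \<mu> t * w) ` G"
    have S: "u - \<mu> t * w \<in> S" if "(u, w) \<in> G" for u w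
      unfolding S_def using that by (rule rev_image_eqI) simp
    define D where "D = differences A' ((*) (\<mu> t) ` B')"
    have "\<forall>d\<in>D. \<exists>a b. a \<in> A' \<and> b \<in> B' \<and> d = a - \<mu> t * b" by (auto simp: D_def differences_def)
    then obtain f g where fg: "\<And>d. d \<in> D \<Longrightarrow> f d \<in> A' \<and> g d \<in> B' \<and> d = f d - \<mu> t * g d" by metis
    define P where "P d = {(a1, b1). (f d, b1) \<in> G \<and> (a1, b1) \<in> G \<and> (a1, g d) \<in> G}" for d
    have "card (SIGMA d:D. P d) \<le> card (S \<times> S \<times> S)"
    proof (rule card_inj_on_le)
      let ?h = "\<lambda>(d, a1, b1). (f d - \<mu> t * b1, a1 - \<mu> t * b1, a1 - \<mu> t * g d)"
      show "inj_on ?h (SIGMA d:D. P d)"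
      proof (rule inj_onI)
        fix x y assume xy: "x \<in> (SIGMA d:D. P d)" "y \<in> (SIGMA d:D. P d)" "?h x = ?h y"
        obtain d a1 b1 d' a1' b1' where [simp]: "x = (d, a1, b1)" "y = (d', a1', b1')" by (cases x, cases y)
        have d: "d = f d - \<mu> t * g d" "d' = f d' - \<mu> t * g d'" using xy fg by auto
        have e: "f d - \<mu> t * b1 = f d' - \<mu> t * b1'" "a1 - \<mu> t * b1 = a1' - \<mu> t * b1'"
          "a1 - \<mu> t * g d = a1' - \<mu> t * g d'" using xy by auto
        have "f d - \<mu> t * g d = (f d - \<mu> t * b1) - (a1 - \<mu> t * b1) + (a1 - \<mu> t * g d)" by simp
        also have "\<dots> = (f d' - \<mu> t * b1') - (a1' - \<mu> t * b1') + (a1' - \<mu> t * g d')" by (simp only: e)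
        also have "\<dots> = f d' - \<mu> t * g d'" by simp
        finally have "d = d'" using d by metis
        then show "x = y" using e \<mu>0[OF t] by auto
      qed
      show "?h ` (SIGMA d:D. P d) \<subseteq> S \<times> S \<times> S" using S by (auto simp: P_def)
    qed simp
    also have "\<dots> \<le> X * (X * X)"
      using \<mu>_proj[OF t] by (simp add: card_cartesian_product S_def mult_le_mono)
    finally have "(\<Sum>d\<in>D. card (P d)) \<le> X^3" by (simp add: power3_eq_cube)
    moreover have "card A * card B \<le> 3072 * \<tau>^5 * card (P d)" if "d \<in> D" for d
    proof -
      have "(1 / real \<tau>)^5 * card A * card B \<le> 3072 * card (P d)"
        using paths fg[OF that] by (simp add: P_def)
      then have "real (card A * card B) \<le> real (3072 * \<tau>^5 * card (P d))"
        using \<tau>0 by (simp add: field_simps)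
      then show ?thesis by (simp only: of_nat_le_iff)
    qed
    then have "(\<Sum>d\<in>D. card A * card B) \<le> (\<Sum>d\<in>D. 3072 * \<tau>^5 * card (P d))" by (rule sum_mono)
    then have "card D * (card A * card B) \<le> 3072 * \<tau>^5 * (\<Sum>d\<in>D. card (P d))"
      by (simp add: sum_distrib_left)
    ultimately have "card D * (card A * card B) \<le> 3072 * \<tau>^5 * X^3"
      by (meson mult_le_mono2 order_trans)
    then have "\<tau> * (card D * (card A * card B)) \<le> \<tau> * (3072 * \<tau>^5 * X^3)" by (rule mult_le_mono2)
    moreover have "card D * X^2 \<le> card D * (\<tau> * (card A * card B))" using X_le by (rule mult_le_mono2)
    moreover have "\<tau> * (3072 * \<tau>^5 * X^3) = 3072 * \<tau>^6 * X * X^2"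
    proof -
      have "\<tau>^6 = \<tau> * \<tau>^5" "X^3 = X * X^2" by (simp_all add: power3_eq_cube power2_eq_square flip: power_Suc)
      then show ?thesis by (simp only: mult_ac)
    qed
    moreover have "card D * (\<tau> * (card A * card B)) = \<tau> * (card D * (card A * card B))"
      by (simp only: mult_ac)
    ultimately have "card D * X^2 \<le> 3072 * \<tau>^6 * X * X^2" by linarith
    then have "card D \<le> 3072 * \<tau>^6 * X" using pos by simp
    then show ?thesis by (simp only: D_def)
  qed
  \<comment> \<open>The product \<open>4 * 3072^2 * 6\<close> is below \<open>2^28\<close>. The
    final exponents are then \<open>576 = 2 * 16 * 18\<close> and
    \<open>1032 = 2 * 28 * 18 + 24\<close>, where \<open>2^24\<close> covers the factor
    \<open>7500000\<close> and the two directions set aside.\<close>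
  define T1 where "T1 = 2^28 * \<tau>^16"
  define L where "L = (\<lambda>t. \<mu> t / \<mu> t2) ` \<Theta>'"
  have one: "card (differences A' ((*) l ` A')) \<le> T1 * card A'" if l: "l \<in> L" for l
  proof -
    obtain t where t: "t \<in> \<Theta>'" "l = \<mu> t / \<mu> t2" using l by (auto simp: L_def)
    have nz: "\<mu> t \<noteq> 0" "\<mu> t2 \<noteq> 0" "l \<noteq> 0" using \<mu>0 t t2 by auto
    have sc: "(*) l ` ((*) (\<mu> t2) ` B') = (*) (\<mu> t) ` B'" using nz t by (simp add: image_image mult.assoc[symmetric])
    have "card (differences A' ((*) l ` A')) * card ((*) (\<mu> t) ` B')
        \<le> card (differences A' ((*) (\<mu> t) ` B')) * card (differences ((*) (\<mu> t) ` B') ((*) l ` A'))"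
      by (rule Ruzsa_triangle) auto
    also have "card (differences ((*) (\<mu> t) ` B') ((*) l ` A')) = card (differences A' ((*) (\<mu> t2) ` B'))"
      by (metis sc nz(3) differences_scaled card_differences_commute)
    also have "card (differences A' ((*) (\<mu> t) ` B')) * card (differences A' ((*) (\<mu> t2) ` B'))
        \<le> (3072 * \<tau>^6 * X) * (3072 * \<tau>^6 * X)"
      by (intro mult_le_mono diff t t2)
    also have "(3072 * \<tau>^6 * X) * (3072 * \<tau>^6 * X) = 3072^2 * \<tau>^12 * X^2"
      by (simp add: power_mult_distrib flip: power2_eq_square power_mult)
    also have "card ((*) (\<mu> t) ` B') = card B'" using nz(1) by (rule card_scaled)
    finally have "card (differences A' ((*) l ` A')) * card B' \<le> 3072^2 * \<tau>^12 * X^2" .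
    then have "4 * \<tau>^2 * (card (differences A' ((*) l ` A')) * card B') \<le> 4 * \<tau>^2 * (3072^2 * \<tau>^12 * X^2)"
      by (rule mult_le_mono2)
    moreover have "card (differences A' ((*) l ` A')) * X \<le> card (differences A' ((*) l ` A')) * (4 * \<tau>^2 * card B')"
      using cB' by (rule mult_le_mono2)
    moreover have "4 * \<tau>^2 * (3072^2 * \<tau>^12 * X^2) = 4 * 3072^2 * \<tau>^14 * X * X"
    proof -
      have "\<tau>^14 = \<tau>^2 * \<tau>^12" by (simp flip: power_add)
      then show ?thesis by (simp only: power2_eq_square[of X] mult_ac)
    qed
    moreover have "card (differences A' ((*) l ` A')) * (4 * \<tau>^2 * card B')
        = 4 * \<tau>^2 * (card (differences A' ((*) l ` A')) * card B')" by (simp only: mult_ac)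
    ultimately have "card (differences A' ((*) l ` A')) * X \<le> 4 * 3072^2 * \<tau>^14 * X * X"
      by linarith
    then have "card (differences A' ((*) l ` A')) \<le> 4 * 3072^2 * \<tau>^14 * X"
      using pos by (simp only: mult_le_cancel2)
    also have "\<dots> \<le> 4 * 3072^2 * \<tau>^14 * (6 * \<tau>^2 * card A')" using cA' by (rule mult_le_mono2)
    also have "\<dots> = 226492416 * \<tau>^16 * card A'" by (simp flip: power_add)
    also have "\<dots> \<le> T1 * card A'" by (simp add: T1_def)
    finally show ?thesis .
  qed
  have T1: "T1 \<ge> 1" using \<tau>0 by (simp add: T1_def Suc_le_eq)
  have two: "card (difference_set l A') \<le> T1^2 * card A'" "card (difference_set (l^2) A') \<le> T1^2 * card A'"
    if l: "l \<in> L" for l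
  proof -
    have nz: "l \<noteq> 0" using l \<mu>0 t2 by (auto simp: L_def)
    have "T1 * card A' \<le> T1^2 * card A'" using T1 by (simp add: power2_eq_square)
    from order_trans[OF one[OF l] this] show "card (difference_set l A') \<le> T1^2 * card A'"
      by (simp only: difference_set_eq)
    have "card (differences A' ((*) (l^2) ` A')) * card ((*) l ` A')
        \<le> card (differences A' ((*) l ` A')) * card (differences ((*) l ` A') ((*) (l^2) ` A'))"
      by (rule Ruzsa_triangle) auto
    also have "card (differences ((*) l ` A') ((*) (l^2) ` A')) = card (differences A' ((*) l ` A'))"
    proof -
      have "(*) (l^2) ` A' = (*) l ` ((*) l ` A')" by (simp add: image_image power2_eq_square mult.assoc)
      then show ?thesis by (simp only: differences_scaled[OF nz])
    qed
    also have "card (differences A' ((*) l ` A')) * card (differences A' ((*) l ` A'))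
        \<le> (T1 * card A') * (T1 * card A')" by (intro mult_le_mono one l)
    also have "(T1 * card A') * (T1 * card A') = T1^2 * card A' * card A'" by (simp add: power2_eq_square)
    also have "card ((*) l ` A') = card A'" using nz by (rule card_scaled)
    finally have "card (differences A' ((*) (l^2) ` A')) * card A' \<le> T1^2 * card A' * card A'" .
    moreover have "card A' > 0" using AB(5) by (simp add: card_gt_0_iff)
    ultimately show "card (difference_set (l^2) A') \<le> T1^2 * card A'"
      by (simp add: difference_set_eq)
  qed
  \<comment> \<open>The ratio at \<open>t2\<close> itself; it yields the bound on
    \<open>A' - A'\<close> required by \<open>card_slopes_lt\<close>.\<close>
  have "1 \<in> L" using t2 \<mu>0 by (force simp: L_def)
  have cL: "card L = card \<Theta>'"
    unfolding L_def using \<mu>_inj \<mu>0 t2 by (intro card_image) (auto simp: inj_on_def)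
  have e8: "(T1^2)^8 = 2^448 * \<tau>^256" and e4: "(T1^2)^4 = 2^224 * \<tau>^128" and e18: "(T1^2)^18 = 2^1008 * \<tau>^576"
    unfolding T1_def power_mult_distrib power_mult[symmetric] by simp_all
  have up: "\<tau>^i \<le> \<tau>^576" if "i \<le> 576" for i using \<tau>0 that by (intro power_increasing) auto
  have up2: "(2::nat)^i \<le> 2^1032" if "i \<le> 1032" for i using that by (intro power_increasing) auto
  show ?thesis
  proof (cases "3872 * (T1^2)^8 < card A' \<and> 484 * (T1^2)^4 * card A' < CARD('a)")
    case True
    have "card L < 7500000 * (T1^2)^18"
      by (rule card_slopes_lt[OF prime two(1)[OF \<open>1 \<in> L\<close>] two]) (use T1 True in \<open>auto simp: Suc_le_eq\<close>)
    then have "card \<Theta> \<le> 7500000 * (T1^2)^18 + 2" using cL c\<Theta>' by simp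
    also have "\<dots> \<le> 16777216 * (T1^2)^18"
    proof -
      have "1 \<le> (T1^2)^18" using T1 by (metis one_le_power)
      then show ?thesis by linarith
    qed
    also have "\<dots> = 2^24 * (2^1008 * \<tau>^576)" unfolding e18 by simp
    also have "\<dots> = 2^(24 + 1008) * \<tau>^576" unfolding power_add by (rule mult.assoc[symmetric])
    also have "\<dots> = 2^1032 * \<tau>^576" by (simp only: add_numeral_left arith_simps)
    finally show ?thesis by simp
  next
    case False
    then consider "card A' \<le> 3872 * (T1^2)^8" | "CARD('a) \<le> 484 * (T1^2)^4 * card A'" by linarith
    then show ?thesis
    proof cases
      case 1
      have "X \<le> 6 * \<tau>^2 * (3872 * (2^448 * \<tau>^256))"
        using cA' 1 unfolding e8 by (meson mult_le_mono2 order_trans)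
      also have "\<dots> = 23232 * 2^448 * \<tau>^258" by (simp flip: power_add)
      also have "\<dots> \<le> 2^16 * 2^448 * \<tau>^576" by (intro mult_le_mono up) auto
      also have "\<dots> \<le> 2^1032 * \<tau>^576" unfolding power_add[symmetric] by (intro mult_le_mono1 up2) simp
      finally show ?thesis by simp
    next
      case 2
      have "card A' \<le> X" using card_mono[OF _ AB(1)] cA by (meson finite_code order_trans)
      then have "CARD('a) \<le> 484 * (2^224 * \<tau>^128) * X"
        using 2 unfolding e4 by (meson mult_le_mono2 order_trans)
      also have "\<dots> \<le> 2^9 * (2^224 * \<tau>^576) * X" by (intro mult_le_mono up) auto
      also have "\<dots> = 2^233 * \<tau>^576 * X" by simp
      also have "\<dots> \<le> 2^1032 * \<tau>^576 * X" by (intro mult_le_mono1 up2) simp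
      finally show ?thesis by simp
    qed
  qed
qed

section \<open>Subspaces of a space over a prime field\<close>

lemma card_image_le_coarser:
  assumes "finite K" "\<And>x y. x \<in> K \<Longrightarrow> y \<in> K \<Longrightarrow> g x = g y \<Longrightarrow> f x = f y"
  shows "card (f ` K) \<le> card (g ` K)"
proof (rule surj_card_le)
  show "finite (g ` K)" using assms(1) by simp
  show "f ` K \<subseteq> (\<lambda>z. f (inv_into K g z)) ` g ` K"
  proof
    fix z assume "z \<in> f ` K"
    then obtain x where x: "x \<in> K" "z = f x" by blast
    have "inv_into K g (g x) \<in> K" "g (inv_into K g (g x)) = g x"
      using x by (auto intro: inv_into_into f_inv_into_f)
    then have "f (inv_into K g (g x)) = f x" using assms(2) x by blast
    then show "z \<in> (\<lambda>z. f (inv_into K g z)) ` g ` K" using x by (auto intro!: image_eqI[of _ _ "g x"])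
  qed
qed

lemma card_image_le_pair:
  assumes "finite K" "\<And>x y. x \<in> K \<Longrightarrow> y \<in> K \<Longrightarrow> f x = f y \<Longrightarrow> g x = g y \<Longrightarrow> h x = h y"
  shows "card (h ` K) \<le> card (f ` K) * card (g ` K)"
proof -
  have "card (h ` K) \<le> card ((\<lambda>x. (f x, g x)) ` K)"
  proof (rule card_image_le_coarser[OF assms(1)])
    fix x y assume "x \<in> K" "y \<in> K" "(f x, g x) = (f y, g y)"
    then show "h x = h y" by (intro assms(2)) simp_all
  qed
  also have "\<dots> \<le> card (f ` K \<times> g ` K)"
    by (rule card_mono) (use assms(1) in blast)+
  finally show ?thesis by (simp add: card_cartesian_product)
qed

lemma exists_representatives: "\<exists>R\<subseteq>K. inj_on f R \<and> f ` R = f ` K"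
proof -
  from iffD1[OF subset_image_inj[of "f ` K" f K] subset_refl]
  obtain R where "R \<subseteq> K" "inj_on f R" "f ` K = f ` R" by blast
  then show ?thesis by (intro exI[of _ R]) simp
qed

lemma exists_maximum:
  fixes f :: "'b \<Rightarrow> real"
  assumes "finite S" "S \<noteq> {}"
  shows "\<exists>x\<in>S. \<forall>y\<in>S. f y \<le> f x"
proof -
  have "Max (f ` S) \<in> f ` S" using assms by (intro Max_in) auto
  then obtain x where "x \<in> S" "f x = Max (f ` S)" by auto
  then show ?thesis using assms by (intro bexI[of _ x]) auto
qed

text \<open>Maximise \<open>card K' - r \<cdot> (number of fibres met by K')\<close>: discarding a short fibre would
  increase this quantity.\<close>

lemma exists_subset_with_long_fibres:
  fixes r :: real
  assumes fin: "finite K" "finite I" and X: "\<And>i. i \<in> I \<Longrightarrow> card (c i ` K) \<le> X"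
    and r: "r > 0" "card I * X * r < card K"
  obtains K' where "K' \<subseteq> K" "K' \<noteq> {}" "\<And>i x. i \<in> I \<Longrightarrow> x \<in> K' \<Longrightarrow> r \<le> card {y \<in> K'. c i y = c i x}"
proof -
  define \<Phi> where "\<Phi> K' = real (card K') - r * (\<Sum>i\<in>I. real (card (c i ` K')))" for K'
  obtain K' where K': "K' \<subseteq> K" "\<And>L. L \<subseteq> K \<Longrightarrow> \<Phi> L \<le> \<Phi> K'"
  proof -
    have "\<exists>x\<in>Pow K. \<forall>y\<in>Pow K. \<Phi> y \<le> \<Phi> x" using fin by (intro exists_maximum) auto
    then show thesis using that by blast
  qed
  have "(\<Sum>i\<in>I. real (card (c i ` K))) \<le> (\<Sum>i\<in>I. real X)" using X by (intro sum_mono) simp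
  then have "r * (\<Sum>i\<in>I. real (card (c i ` K))) \<le> r * (real (card I) * real X)"
    using r by (intro mult_left_mono) auto
  also have "\<dots> < card K" using r by (simp add: mult_ac)
  finally have "\<Phi> K > 0" by (simp add: \<Phi>_def)
  then have "\<Phi> K' > 0" using K'(2)[of K] by simp
  then have ne: "K' \<noteq> {}" by (auto simp: \<Phi>_def)
  have finK': "finite K'" using K'(1) fin(1) by (rule finite_subset)
  show thesis
  proof (rule that[OF K'(1) ne])
    fix i x assume ix: "i \<in> I" "x \<in> K'"
    define F where "F = {y \<in> K'. c i y = c i x}"
    have F: "F \<subseteq> K'" "x \<in> F" using ix by (auto simp: F_def)
    show "r \<le> card {y \<in> K'. c i y = c i x}"
    proof (rule ccontr)
      assume "\<not> ?thesis"
      then have short: "real (card F) < r" by (simp add: F_def)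
      have "c i ` K' = insert (c i x) (c i ` (K' - F))" "c i x \<notin> c i ` (K' - F)"
        using ix by (auto simp: F_def)
      then have ci: "card (c i ` K') = card (c i ` (K' - F)) + 1" using finK' by simp
      have le: "card (c j ` (K' - F)) \<le> card (c j ` K')" for j using finK' by (intro card_mono) auto
      have "(\<Sum>j\<in>I. real (card (c j ` (K' - F)))) + 1 \<le> (\<Sum>j\<in>I. real (card (c j ` K')))"
      proof -
        have "(\<Sum>j\<in>I. real (card (c j ` (K' - F))))
            = real (card (c i ` (K' - F))) + (\<Sum>j\<in>I - {i}. real (card (c j ` (K' - F))))"
          using fin ix by (simp add: sum.remove)
        also have "\<dots> \<le> real (card (c i ` K')) - 1 + (\<Sum>j\<in>I - {i}. real (card (c j ` K')))"
          using ci le by (intro add_mono sum_mono) auto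
        also have "\<dots> = (\<Sum>j\<in>I. real (card (c j ` K'))) - 1"
          using fin ix by (simp add: sum.remove)
        finally show ?thesis by simp
      qed
      then have "r * ((\<Sum>j\<in>I. real (card (c j ` (K' - F)))) + 1) \<le> r * (\<Sum>j\<in>I. real (card (c j ` K')))"
        using r by (intro mult_left_mono) auto
      moreover have "real (card (K' - F)) = real (card K') - real (card F)"
        using F finK' card_mono[OF finK' F(1)] by (simp add: card_Diff_subset finite_subset of_nat_diff)
      ultimately have "\<Phi> K' < \<Phi> (K' - F)" using short by (simp add: \<Phi>_def distrib_left)
      moreover have "\<Phi> (K' - F) \<le> \<Phi> K'" using K'(1) by (intro K'(2)) auto
      ultimately show False by simp
    qed
  qed
qed

lemma sum_card_image_fibres:
  assumes fin: "finite Z" and kh: "\<And>x y. x \<in> Z \<Longrightarrow> y \<in> Z \<Longrightarrow> k x = k y \<Longrightarrow> h x = h y"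
  shows "(\<Sum>v\<in>h ` Z. card (k ` {y \<in> Z. h y = v})) = card (k ` Z)"
proof -
  let ?F = "\<lambda>v. {y \<in> Z. h y = v}"
  have "k ` Z = (\<Union>v\<in>h ` Z. k ` ?F v)" by auto
  moreover have "card (\<Union>v\<in>h ` Z. k ` ?F v) = (\<Sum>v\<in>h ` Z. card (k ` ?F v))"
  proof (rule card_UN_disjoint)
    have False if "v \<noteq> w" "x \<in> ?F v" "y \<in> ?F w" "k x = k y" for v w x y
      using that kh[of x y] by simp
    then show "\<forall>v\<in>h ` Z. \<forall>w\<in>h ` Z. v \<noteq> w \<longrightarrow> k ` ?F v \<inter> k ` ?F w = {}" by blast
  qed (use fin in simp_all)
  ultimately show ?thesis by (simp only:)
qed

text \<open>On an \<open>h\<close>-fibre \<open>F\<close> the pair \<open>(f, g)\<close> is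
  injective, so the square root of \<open>card F\<close> is at most the mean of the sizes of its
  images under \<open>f\<close> and \<open>g\<close>. As both maps refine \<open>h\<close>, these
  image sizes add up to at most \<open>X\<close> over all fibres; hence \<open>card Z\<close> is at
  most \<open>X\<close> times the square root of the largest fibre.\<close>

lemma exists_large_common_fibre:
  fixes X :: real
  assumes fin: "finite Z" and ne: "Z \<noteq> {}"
    and X: "card (f ` Z) \<le> X" "card (g ` Z) \<le> X"
    and fh: "\<And>x y. x \<in> Z \<Longrightarrow> y \<in> Z \<Longrightarrow> f x = f y \<Longrightarrow> h x = h y"
    and gh: "\<And>x y. x \<in> Z \<Longrightarrow> y \<in> Z \<Longrightarrow> g x = g y \<Longrightarrow> h x = h y"
    and inj: "\<And>x y. x \<in> Z \<Longrightarrow> y \<in> Z \<Longrightarrow> f x = f y \<Longrightarrow> g x = g y \<Longrightarrow> x = y"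
  obtains z where "z \<in> Z" "(card Z)^2 \<le> card {y \<in> Z. h y = h z} * X^2"
proof -
  define F where "F v = {y \<in> Z. h y = v}" for v
  have finF: "finite (F v)" for v using fin by (simp add: F_def)
  have fibre_sum_f: "(\<Sum>v\<in>h ` Z. card (f ` F v)) = card (f ` Z)"
    unfolding F_def by (rule sum_card_image_fibres[OF fin]) (rule fh)
  have fibre_sum_g: "(\<Sum>v\<in>h ` Z. card (g ` F v)) = card (g ` Z)"
    unfolding F_def by (rule sum_card_image_fibres[OF fin]) (rule gh)
  obtain z where z: "z \<in> Z" "\<And>y. y \<in> Z \<Longrightarrow> card (F (h y)) \<le> card (F (h z))"
  proof -
    obtain z where "z \<in> Z" "\<forall>y\<in>Z. real (card (F (h y))) \<le> real (card (F (h z)))"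
      using exists_maximum[OF fin ne, of "\<lambda>z. real (card (F (h z)))"] by blast
    then show thesis by (intro that[of z]) auto
  qed
  define s where "s = sqrt (real (card (F (h z))))"
  have fib: "real (card (F v)) \<le> s * ((real (card (f ` F v)) + real (card (g ` F v))) / 2)" if v: "v \<in> h ` Z" for v
  proof -
    let ?n = "real (card (F v))" and ?a = "real (card (f ` F v))" and ?b = "real (card (g ` F v))"
    have "card (id ` F v) \<le> card (f ` F v) * card (g ` F v)"
    proof (rule card_image_le_pair[OF finF])
      fix x y assume "x \<in> F v" "y \<in> F v" "f x = f y" "g x = g y"
      then show "id x = id y" using inj[of x y] by (simp add: F_def)
    qed
    then have "?n \<le> ?a * ?b" by (simp flip: of_nat_mult)
    then have "sqrt ?n \<le> sqrt (?a * ?b)" by simp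
    also have "\<dots> \<le> (?a + ?b) / 2" using arith_geo_mean_sqrt[of ?a ?b] by simp
    finally have 1: "sqrt ?n \<le> (?a + ?b) / 2" .
    have 2: "sqrt ?n \<le> s" using z(2) v by (auto simp: s_def)
    have "?n = sqrt ?n * sqrt ?n" by simp
    also have "\<dots> \<le> s * ((?a + ?b) / 2)" using 1 2 by (intro mult_mono) (auto simp: s_def)
    finally show ?thesis .
  qed
  have "real (card Z) = (\<Sum>v\<in>h ` Z. real (card (id ` F v)))"
  proof -
    have "(\<Sum>v\<in>h ` Z. card (F v)) = card (\<Union>v\<in>h ` Z. F v)"
      using fin finF by (intro card_UN_disjoint[symmetric]) (auto simp: F_def)
    also have "(\<Union>v\<in>h ` Z. F v) = Z" by (auto simp: F_def)
    finally show ?thesis by (simp flip: of_nat_sum)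
  qed
  also have "\<dots> \<le> (\<Sum>v\<in>h ` Z. s * ((real (card (f ` F v)) + real (card (g ` F v))) / 2))"
    by (rule sum_mono, drule fib) simp
  also have "\<dots> = s * (((\<Sum>v\<in>h ` Z. real (card (f ` F v))) + (\<Sum>v\<in>h ` Z. real (card (g ` F v)))) / 2)"
    by (simp only: sum.distrib sum_divide_distrib[symmetric] sum_distrib_left[symmetric])
  also have "\<dots> = s * ((real (card (f ` Z)) + real (card (g ` Z))) / 2)"
    by (simp only: fibre_sum_f fibre_sum_g flip: of_nat_sum)
  also have "\<dots> \<le> s * X" using X by (intro mult_left_mono) (auto simp: s_def)
  finally have "(real (card Z))^2 \<le> (s * X)^2" by (rule power_mono) simp
  also have "\<dots> = card (F (h z)) * X^2" by (simp add: power_mult_distrib s_def)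
  finally show thesis using z(1) by (intro that[of z]) (auto simp: F_def)
qed

section \<open>Counting subspaces and cosets over a prime field\<close>

text \<open>Dimensions are measured by cardinalities \<open>q^k\<close> inside a finite subspace
  \<open>V\<close> of a possibly infinite space, so a single instance, the functions on the
  naturals, serves every \<open>n\<close>.\<close>

locale prime_field_space = vector_space scale
  for scale :: "'a::{field_gcd,finite} \<Rightarrow> 'v::ab_group_add \<Rightarrow> 'v" (infixr "*s" 75) +
  fixes q :: nat
  assumes prime_field: "\<exists>j. (x::'a) = of_nat j"
    and q_eq: "q = CARD('a)"
begin

definition coset :: "'v set \<Rightarrow> 'v \<Rightarrow> 'v set"
  where "coset W x = (\<lambda>w. x + w) ` W"

lemma coset_eq_iff:
  assumes "subspace W"
  shows "coset W x = coset W y \<longleftrightarrow> x - y \<in> W"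
proof
  assume "coset W x = coset W y"
  moreover have "x \<in> coset W x" using subspace_0[OF assms] by (force simp: coset_def)
  ultimately show "x - y \<in> W" by (auto simp: coset_def)
next
  assume xy: "x - y \<in> W"
  have "coset W x \<subseteq> coset W y" if "x - y \<in> W" for x y
  proof
    fix z assume "z \<in> coset W x"
    then obtain w where w: "w \<in> W" "z = x + w" by (auto simp: coset_def)
    have "(x - y) + w \<in> W" using subspace_add[OF assms that w(1)] .
    moreover have "z = y + ((x - y) + w)" using w(2) by simp
    ultimately show "z \<in> coset W y" unfolding coset_def by (rule rev_image_eqI)
  qed
  moreover have "y - x \<in> W" using subspace_neg[OF assms xy] by simp
  ultimately show "coset W x = coset W y" using xy by blast
qed

lemma two_le_q: "2 \<le> q"
  using card_mono[of UNIV "{0, 1 :: 'a}"] by (simp add: q_eq)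

lemma card_span_insert:
  assumes U: "subspace U" "finite U" and v: "v \<notin> U"
  shows "card (span (insert v U)) = q * card U" "finite (span (insert v U))"
proof -
  have "span (insert v U) = (\<lambda>(c, u). c *s v + u) ` (UNIV \<times> U)"
  proof (rule subset_antisym; rule subsetI)
    fix x assume "x \<in> span (insert v U)"
    then obtain c where "x - c *s v \<in> span U" unfolding span_insert by blast
    then have "x - c *s v \<in> U" using U(1) by (metis span_eq_iff)
    then show "x \<in> (\<lambda>(c, u). c *s v + u) ` (UNIV \<times> U)"
      by (intro image_eqI[of _ _ "(c, x - c *s v)"]) auto
  next
    fix x assume "x \<in> (\<lambda>(c, u). c *s v + u) ` (UNIV \<times> U)"
    then obtain c u where "u \<in> U" "x = c *s v + u" by auto
    then show "x \<in> span (insert v U)"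
      by (simp add: span_add span_scale span_base)
  qed
  moreover have "inj_on (\<lambda>(c, u). c *s v + u) (UNIV \<times> U)"
  proof (rule inj_onI)
    fix x y assume xy: "x \<in> UNIV \<times> U" "y \<in> UNIV \<times> U" "(case x of (c, u) \<Rightarrow> c *s v + u) = (case y of (c, u) \<Rightarrow> c *s v + u)"
    obtain c u d w where [simp]: "x = (c, u)" "y = (d, w)" by (cases x, cases y)
    have "(c - d) *s v = w - u" using xy by (simp add: scale_left_diff_distrib algebra_simps)
    then have mem: "(c - d) *s v \<in> U" using xy U by (simp add: subspace_diff)
    have "c = d"
    proof (rule ccontr)
      assume "c \<noteq> d"
      then have "v = inverse (c - d) *s ((c - d) *s v)" by simp
      then show False using v mem subspace_scale[OF U(1)] by metis
    qed
    then show "x = y" using xy by simp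
  qed
  ultimately show "card (span (insert v U)) = q * card U" "finite (span (insert v U))"
    using U by (simp_all add: card_image card_cartesian_product q_eq)
qed

lemma exists_vector_in_many:
  fixes E :: "'v set set"
  assumes E: "finite E" and V: "finite V" "card V = q^n" and U: "U \<subseteq> V" "card U = q^j" and jn: "j < n"
    and W: "\<And>W. W \<in> E \<Longrightarrow> U \<subseteq> W \<and> W \<subseteq> V \<and> card W = q^k"
  obtains v where "v \<in> V" "v \<notin> U" "card E * (q^k - q^j) \<le> card {W \<in> E. v \<in> W} * q^n"
proof -
  have finU: "finite U" using U V finite_subset by blast
  have ne: "V - U \<noteq> {}"
  proof
    assume "V - U = {}"
    then have "q^n = q^j" using U V by (metis Diff_eq_empty_iff subset_antisym)
    then show False using two_le_q jn by simp
  qed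
  have "card E * (q^k - q^j) = (\<Sum>W\<in>E. card (W - U))"
    using W U finU by (simp add: card_Diff_subset)
  also have "\<dots> = card (SIGMA W:E. W - U)"
    using E W V by (subst card_SigmaI) (auto intro: finite_subset)
  also have "\<dots> \<le> card (SIGMA v:V - U. {W \<in> E. v \<in> W})"
  proof (rule card_inj_on_le)
    show "inj_on (\<lambda>(W, v). (v, W)) (SIGMA W:E. W - U)" by (auto simp: inj_on_def)
    show "(\<lambda>(W, v). (v, W)) ` (SIGMA W:E. W - U) \<subseteq> (SIGMA v:V - U. {W \<in> E. v \<in> W})" using W by auto
    show "finite (SIGMA v:V - U. {W \<in> E. v \<in> W})" using E V by auto
  qed
  also have "\<dots> = (\<Sum>v\<in>V - U. card {W \<in> E. v \<in> W})" using E V by simp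
  finally have le: "card E * (q^k - q^j) \<le> (\<Sum>v\<in>V - U. card {W \<in> E. v \<in> W})" .
  have "\<exists>v\<in>V - U. card E * (q^k - q^j) \<le> card {W \<in> E. v \<in> W} * q^n"
  proof (rule ccontr)
    assume "\<not> ?thesis"
    then have "(\<Sum>v\<in>V - U. card {W \<in> E. v \<in> W} * q^n) < (\<Sum>v\<in>V - U. card E * (q^k - q^j))"
      using V ne by (intro sum_strict_mono) (auto simp: not_le)
    also have "\<dots> = card (V - U) * (card E * (q^k - q^j))" by simp
    also have "\<dots> \<le> q^n * (card E * (q^k - q^j))"
      using card_mono[of V "V - U"] V by (intro mult_le_mono1) auto
    finally have "q^n * (\<Sum>v\<in>V - U. card {W \<in> E. v \<in> W}) < q^n * (card E * (q^k - q^j))"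
      by (simp add: sum_distrib_left mult_ac)
    then show False using le by simp
  qed
  then show thesis using that by blast
qed

lemma exists_subspace_in_many_step:
  fixes E :: "'v set set"
  assumes E: "finite E" and V: "finite V" "subspace V" "card V = q^n"
    and U: "subspace U" "U \<subseteq> V" "card U = q^j" and jk: "j < k" "k \<le> n"
    and W: "\<And>W. W \<in> E \<Longrightarrow> subspace W \<and> U \<subseteq> W \<and> W \<subseteq> V \<and> card W = q^k"
  obtains U' where "subspace U'" "U \<subseteq> U'" "U' \<subseteq> V" "card U' = q^(j + 1)"
    "real (card E) * (1 - 1 / q^(k - j)) \<le> card {W \<in> E. U' \<subseteq> W} * real q^(n - k)"
proof -
  have "j < n" using jk by simp
  have W': "U \<subseteq> W \<and> W \<subseteq> V \<and> card W = q^k" if "W \<in> E" for W using W[OF that] by blast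
  obtain v where v: "v \<in> V" "v \<notin> U" "card E * (q^k - q^j) \<le> card {W \<in> E. v \<in> W} * q^n"
    using exists_vector_in_many[OF E V(1,3) U(2,3) \<open>j < n\<close> W'] by blast
  let ?U = "span (insert v U)"
  have finU: "finite U" using U V finite_subset by blast
  have qp: "real q > 0" using two_le_q by simp
  have "{W \<in> E. v \<in> W} = {W \<in> E. ?U \<subseteq> W}"
  proof -
    have "?U \<subseteq> W" if "W \<in> E" "v \<in> W" for W using W[OF that(1)] that(2) by (intro span_minimal) auto
    moreover have "v \<in> ?U" by (simp add: span_base)
    ultimately show ?thesis by blast
  qed
  then have "real (card E) * real (q^k - q^j) \<le> card {W \<in> E. ?U \<subseteq> W} * real q^n"
    using v(3) by (simp flip: of_nat_mult of_nat_power)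
  moreover have "real (q^k - q^j) = real q^k * (1 - 1 / real q^(k - j))"
  proof -
    have "q^j \<le> q^k" using jk two_le_q by (intro power_increasing) auto
    then have "real (q^k - q^j) = real q^k - real q^j" by (simp add: of_nat_diff)
    moreover have "real q^k = real q^j * real q^(k - j)" using jk by (simp flip: power_add)
    ultimately show ?thesis using qp by (simp add: right_diff_distrib)
  qed
  moreover have "real q^n = real q^k * real q^(n - k)" using jk by (simp flip: power_add)
  ultimately have "real q^k * (real (card E) * (1 - 1 / real q^(k - j)))
      \<le> real q^k * (card {W \<in> E. ?U \<subseteq> W} * real q^(n - k))" by (simp add: mult_ac)
  then have "real (card E) * (1 - 1 / q^(k - j)) \<le> card {W \<in> E. ?U \<subseteq> W} * real q^(n - k)"
    using qp by simp
  moreover have "?U \<subseteq> V" using v(1) U V by (intro span_minimal) auto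
  moreover have "card ?U = q^(j + 1)" using card_span_insert[OF U(1) finU v(2)] U by simp
  moreover have "U \<subseteq> ?U" using span_superset[of "insert v U"] by blast
  ultimately show thesis using that[of ?U] by auto
qed

text \<open>One vector is added at a time, each chosen by double counting incidences between vectors
  and members of \<open>E\<close>. Because \<open>j + i < k\<close>, every intermediate subspace has
  codimension at least two in the members before a step, whence the uniform factor
  \<open>1 - 1 / q^2\<close>; the final step to dimension \<open>k\<close> would cost
  \<open>1 - 1 / q\<close>.\<close>

lemma exists_subspace_in_many:
  fixes E :: "'v set set"
  assumes E: "finite E" and V: "finite V" "subspace V" "card V = q^n"
    and U: "subspace U" "U \<subseteq> V" "card U = q^j" and jk: "j + i < k" "k \<le> n"
    and W: "\<And>W. W \<in> E \<Longrightarrow> subspace W \<and> U \<subseteq> W \<and> W \<subseteq> V \<and> card W = q^k"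
  shows "\<exists>U'. subspace U' \<and> U \<subseteq> U' \<and> U' \<subseteq> V \<and> card U' = q^(j + i) \<and>
    real (card E) * (1 - 1 / real q^2)^i \<le> card {W \<in> E. U' \<subseteq> W} * real q^((n - k) * i)"
  using jk(1)
proof (induction i)
  case 0
  have "{W \<in> E. U \<subseteq> W} = E" using W by auto
  then show ?case using U by (intro exI[of _ U]) auto
next
  case (Suc i)
  then obtain U' where U': "subspace U'" "U \<subseteq> U'" "U' \<subseteq> V" "card U' = q^(j + i)"
    "real (card E) * (1 - 1 / real q^2)^i \<le> card {W \<in> E. U' \<subseteq> W} * real q^((n - k) * i)" by auto
  have qp: "real q \<ge> 1" using two_le_q by simp
  have nn: "0 \<le> 1 - 1 / real q^2" using qp by (simp add: divide_le_eq_1)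
  let ?E = "{W \<in> E. U' \<subseteq> W}"
  have "j + i < k" using Suc.prems by simp
  obtain U'' where U'': "subspace U''" "U' \<subseteq> U''" "U'' \<subseteq> V" "card U'' = q^(j + i + 1)"
    "real (card ?E) * (1 - 1 / q^(k - (j + i))) \<le> card {W \<in> ?E. U'' \<subseteq> W} * real q^(n - k)"
    by (rule exists_subspace_in_many_step[of ?E V n U' "j + i" k]) (use E V U' W jk \<open>j + i < k\<close> in auto)
  have "q^2 \<le> q^(k - (j + i))" using Suc.prems two_le_q by (intro power_increasing) auto
  then have "real q^2 \<le> real q^(k - (j + i))" by (metis of_nat_le_iff of_nat_power)
  then have "1 - 1 / real q^2 \<le> 1 - 1 / real q^(k - (j + i))" using qp by (simp add: frac_le)
  then have "real (card ?E) * (1 - 1 / real q^2) \<le> real (card ?E) * (1 - 1 / real q^(k - (j + i)))"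
    by (intro mult_left_mono) auto
  also have "\<dots> \<le> card {W \<in> ?E. U'' \<subseteq> W} * real q^(n - k)" using U''(5) by simp
  also have "{W \<in> ?E. U'' \<subseteq> W} = {W \<in> E. U'' \<subseteq> W}" using U''(2) by auto
  finally have step: "real (card ?E) * (1 - 1 / real q^2) \<le> card {W \<in> E. U'' \<subseteq> W} * real q^(n - k)" .
  have "real (card E) * (1 - 1 / real q^2)^Suc i = real (card E) * (1 - 1 / real q^2)^i * (1 - 1 / real q^2)"
    by simp
  also have "\<dots> \<le> card ?E * real q^((n - k) * i) * (1 - 1 / real q^2)"
    using U'(5) nn by (intro mult_right_mono) auto
  also have "\<dots> = (real (card ?E) * (1 - 1 / real q^2)) * real q^((n - k) * i)" by simp
  also have "\<dots> \<le> (card {W \<in> E. U'' \<subseteq> W} * real q^(n - k)) * real q^((n - k) * i)"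
    using step by (intro mult_right_mono) auto
  also have "\<dots> = card {W \<in> E. U'' \<subseteq> W} * real q^((n - k) * Suc i)" by (simp add: power_add)
  finally show ?case using U' U'' by (intro exI[of _ U'']) auto
qed

lemma large_q_power_bound:
  assumes "real q \<ge> 4 * real n" "n \<ge> 1" "i \<le> n"
  shows "15 / 16 \<le> (1 - 1 / real q^2)^i"
proof -
  have q4: "real q \<ge> 4" using assms by linarith
  have "real i * (1 / real q^2) \<le> real n / real q^2" using assms by (simp add: divide_right_mono)
  also have "\<dots> \<le> (real q / 4) / real q^2" using assms by (intro divide_right_mono) auto
  also have "\<dots> = 1 / (4 * real q)" using q4 by (simp add: power2_eq_square)
  also have "\<dots> \<le> 1 / 16" using q4 by (simp add: field_simps)
  finally have 1: "real i * (1 / real q^2) \<le> 1 / 16" .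
  have "1 / real q^2 \<le> 1" using q4 by (simp add: divide_le_eq_1)
  then have "1 + real i * (- (1 / real q^2)) \<le> (1 + - (1 / real q^2))^i"
    by (intro Bernoulli_inequality) linarith
  then show ?thesis using 1 by simp
qed

end

context prime_field_space
begin

text \<open>The averaging lemmas are read backwards: continued up to dimension \<open>k\<close> they
  produce a subspace that only one member can contain, which bounds \<open>card E\<close>. For
  \<open>q \<ge> 4 * n\<close> the accumulated loss is at most \<open>15/16 * 3/4 = 45/64\<close>,
  still above one half.\<close>

lemma card_containing_subspace_le:
  assumes E: "finite E" and V: "finite V" "subspace V" "card V = q^n"
    and U: "subspace U" "U \<subseteq> V" "card U = q^j" and jk: "j < k" "k \<le> n" and q: "4 * n \<le> q"
    and W: "\<And>W. W \<in> E \<Longrightarrow> subspace W \<and> U \<subseteq> W \<and> W \<subseteq> V \<and> card W = q^k"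
  shows "card E < 2 * real q^((n - k) * (k - j))"
proof (cases "E = {}")
  case True
  then show ?thesis using two_le_q by simp
next
  case False
  have n: "n \<ge> 1" "real q \<ge> 4 * real n" "real q \<ge> 4"
    using q jk by linarith+
  obtain U' where U': "subspace U'" "U \<subseteq> U'" "U' \<subseteq> V" "card U' = q^(j + (k - 1 - j))"
    "real (card E) * (1 - 1 / real q^2)^(k - 1 - j) \<le> card {W \<in> E. U' \<subseteq> W} * real q^((n - k) * (k - 1 - j))"
    using exists_subspace_in_many[OF E V U, of "k - 1 - j" k] jk W by auto
  let ?E = "{W \<in> E. U' \<subseteq> W}"
  have cU': "card U' = q^(k - 1)" using U'(4) jk by simp
  obtain U'' where U'': "subspace U''" "U' \<subseteq> U''" "U'' \<subseteq> V" "card U'' = q^(k - 1 + 1)"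
    "real (card ?E) * (1 - 1 / q^(k - (k - 1))) \<le> card {W \<in> ?E. U'' \<subseteq> W} * real q^(n - k)"
    by (rule exists_subspace_in_many_step[of ?E V n U' "k - 1" k]) (use E V U' cU' W jk in auto)
  have "W = U''" if "W \<in> {W \<in> ?E. U'' \<subseteq> W}" for W
  proof -
    have "W \<in> E" "U'' \<subseteq> W" using that by auto
    moreover have "finite W" using W[OF \<open>W \<in> E\<close>] V by (auto intro: finite_subset)
    moreover have "card U'' = card W" using W[OF \<open>W \<in> E\<close>] U''(4) jk by simp
    ultimately show ?thesis using card_subset_eq by metis
  qed
  then have "{W \<in> ?E. U'' \<subseteq> W} \<subseteq> {U''}" by blast
  then have "card {W \<in> ?E. U'' \<subseteq> W} \<le> 1" using card_mono[of "{U''}"] by fastforce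
  then have "real (card {W \<in> ?E. U'' \<subseteq> W}) * real q^(n - k) \<le> 1 * real q^(n - k)"
    by (intro mult_right_mono) auto
  then have a: "real (card ?E) * (1 - 1 / real q) \<le> real q^(n - k)" using U''(5) jk by simp
  have "3 / 4 \<le> 1 - 1 / real q" using n(3) by (simp add: field_simps)
  then have "real (card ?E) * (3 / 4) \<le> real (card ?E) * (1 - 1 / real q)" by (intro mult_left_mono) auto
  with a have E': "real (card ?E) * (3 / 4) \<le> real q^(n - k)" by linarith
  have "15 / 16 \<le> (1 - 1 / real q^2)^(k - 1 - j)"
    by (rule large_q_power_bound[of n]) (use n jk in auto)
  then have "real (card E) * (15 / 16) \<le> real (card E) * (1 - 1 / real q^2)^(k - 1 - j)"
    by (intro mult_left_mono) auto
  also have "\<dots> \<le> card ?E * real q^((n - k) * (k - 1 - j))" by (rule U'(5))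
  finally have "real (card E) * (15 / 16) * (3 / 4) \<le> (card ?E * (3 / 4)) * real q^((n - k) * (k - 1 - j))"
    by simp
  also have "\<dots> \<le> real q^(n - k) * real q^((n - k) * (k - 1 - j))" using E' by (intro mult_right_mono) auto
  also have "\<dots> = real q^((n - k) * (k - j))"
  proof -
    have "(n - k) + (n - k) * (k - 1 - j) = (n - k) * Suc (k - 1 - j)" by simp
    also have "Suc (k - 1 - j) = k - j" using jk by simp
    finally show ?thesis by (simp flip: power_add)
  qed
  finally have "real (card E) * (45 / 64) \<le> real q^((n - k) * (k - j))" by simp
  moreover have "real q^((n - k) * (k - j)) > 0" using n(3) by simp
  ultimately show ?thesis by linarith
qed

text \<open>Intersecting \<open>U\<close> with a member of \<open>E\<close> that misses one of its
  nonzero vectors lowers the dimension. The projection modulo the intersection is determined by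
  those modulo \<open>U\<close> and modulo that member, so each step costs a factor
  \<open>X\<close>, until \<open>U\<close> is trivial.\<close>

lemma card_le_projection_times:
  assumes K: "finite K" and V: "finite V" and X: "\<And>W. W \<in> E \<Longrightarrow> card (coset W ` K) \<le> X" "X \<ge> 1"
    and W: "\<And>W. W \<in> E \<Longrightarrow> subspace W"
    and sep: "\<And>v. v \<in> V \<Longrightarrow> v \<noteq> 0 \<Longrightarrow> \<exists>W\<in>E. v \<notin> W"
    and U: "subspace U" "U \<subseteq> V" "card U \<le> q^j"
  shows "card K \<le> card (coset U ` K) * X^j"
  using U
proof (induction j arbitrary: U)
  case 0
  have "card (id ` K) \<le> card (coset U ` K)"
  proof (rule card_image_le_coarser[OF K])
    fix x y assume xy: "coset U x = coset U y"
    have "finite U" using 0 V finite_subset by blast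
    have "U = {0}"
    proof -
      have "{0} \<subseteq> U" using subspace_0[OF 0(1)] by simp
      moreover have "card U \<le> card {0 :: 'v}" using 0(3) by simp
      ultimately show ?thesis using card_seteq[OF \<open>finite U\<close>] by metis
    qed
    then show "id x = id y" using xy coset_eq_iff[OF 0(1)] by simp
  qed
  then show ?case by simp
next
  case (Suc j)
  have finU: "finite U" using Suc V finite_subset by blast
  show ?case
  proof (cases "U = {0}")
    case True
    then have "card U \<le> q^j" using two_le_q by simp
    then have "card K \<le> card (coset U ` K) * X^j" using Suc by blast
    also have "\<dots> \<le> card (coset U ` K) * X^Suc j" using X(2) by simp
    finally show ?thesis .
  next
    case False
    then obtain v where v: "v \<in> U" "v \<noteq> 0" using subspace_0[OF Suc(2)] by blast
    then obtain W where W': "W \<in> E" "v \<notin> W" using sep Suc(3) by blast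
    let ?U = "U \<inter> W"
    have sub: "subspace ?U" using Suc(2) W[OF W'(1)] by (rule subspace_inter)
    have "q * card ?U = card (span (insert v ?U))"
      using card_span_insert(1)[OF sub, of v] finU W' by simp
    also have "\<dots> \<le> card U"
      using finU v Suc(2) by (intro card_mono span_minimal) auto
    also have "\<dots> \<le> q * q^j" using Suc(4) by simp
    finally have "card ?U \<le> q^j" using two_le_q by simp
    then have "card K \<le> card (coset ?U ` K) * X^j" using Suc sub by blast
    also have "card (coset ?U ` K) \<le> card (coset U ` K) * card (coset W ` K)"
      by (rule card_image_le_pair[OF K])
         (simp add: coset_eq_iff[OF sub] coset_eq_iff[OF Suc(2)] coset_eq_iff[OF W[OF W'(1)]])
    also have "\<dots> \<le> card (coset U ` K) * X" using X(1)[OF W'(1)] by simp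
    finally show ?thesis by (simp add: mult_ac)
  qed
qed

lemma mem_span_subset_iff:
  assumes B: "independent B" and C: "C \<subseteq> B" and x: "x \<in> span B"
  shows "x \<in> span C \<longleftrightarrow> (\<forall>b\<in>B - C. representation B x b = 0)"
proof
  assume "x \<in> span C"
  then have "representation B x = representation C x"
    using representation_extend[OF B _ C] by simp
  then show "\<forall>b\<in>B - C. representation B x b = 0" using representation_ne_zero by (metis DiffD2)
next
  assume z: "\<forall>b\<in>B - C. representation B x b = 0"
  have "(\<Sum>b | representation B x b \<noteq> 0. representation B x b *s b) \<in> span C"
  proof (rule span_sum)
    fix b assume "b \<in> {b. representation B x b \<noteq> 0}"
    then have "b \<in> C" using z representation_ne_zero by blast
    then show "representation B x b *s b \<in> span C" by (simp add: span_base span_scale)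
  qed
  then show "x \<in> span C" using sum_nonzero_representation_eq[OF B x] by simp
qed

lemma mem_span_Int:
  assumes B: "independent B" and C: "C \<subseteq> B" "D \<subseteq> B" and x: "x \<in> span C" "x \<in> span D"
  shows "x \<in> span (C \<inter> D)"
proof -
  have xB: "x \<in> span B" using x C span_mono by blast
  show ?thesis using x C mem_span_subset_iff[OF B _ xB] by blast
qed

text \<open>Two points of one \<open>e\<close>-fibre that lie in the same coset of
  \<open>span (B0 \<union> J)\<close> differ by an element of \<open>span B0\<close>, hence coincide
  by \<open>inj\<close>. Their \<open>J\<close>-fibres are therefore disjoint, and the fibre sizes
  multiply.\<close>

lemma fibre_growth:
  fixes r :: real
  assumes B: "independent B" "B0 \<subseteq> B" and J: "finite J" "J \<subseteq> B - B0" and K: "finite K"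
    and inj: "inj_on (coset (span B0)) K" and r: "r > 0"
    and fib: "\<And>e x. e \<in> J \<Longrightarrow> x \<in> K \<Longrightarrow> r \<le> card {y \<in> K. y - x \<in> span (insert e B0)}"
    and x: "x \<in> K"
  shows "r^card J \<le> card {y \<in> K. y - x \<in> span (B0 \<union> J)}"
  using J fib x
proof (induction J arbitrary: x rule: finite_induct)
  case empty
  have "x \<in> {y \<in> K. y - x \<in> span B0}" using empty by (simp add: span_zero)
  then have "card {y \<in> K. y - x \<in> span B0} > 0" using K by (auto simp: card_gt_0_iff)
  then show ?case by simp
next
  case (insert e J)
  let ?F = "{y \<in> K. y - x \<in> span (insert e B0)}"
  let ?G = "\<lambda>y1. {y \<in> K. y - y1 \<in> span (B0 \<union> J)}"
  have JB: "J \<subseteq> B - B0" "e \<in> B" "e \<notin> B0" using insert.prems by auto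
  have disj: "?G y1 \<inter> ?G y2 = {}" if y: "y1 \<in> ?F" "y2 \<in> ?F" "y1 \<noteq> y2" for y1 y2
  proof (rule ccontr)
    assume "\<not> ?thesis"
    then obtain y where "y - y1 \<in> span (B0 \<union> J)" "y - y2 \<in> span (B0 \<union> J)" by blast
    then have "(y - y2) - (y - y1) \<in> span (B0 \<union> J)" by (meson span_diff)
    then have 1: "y1 - y2 \<in> span (B0 \<union> J)" by simp
    have "(y1 - x) - (y2 - x) \<in> span (insert e B0)" by (rule span_diff) (use y in simp_all)
    then have 2: "y1 - y2 \<in> span (insert e B0)" by simp
    have "y1 - y2 \<in> span ((B0 \<union> J) \<inter> insert e B0)"
      using B JB 1 2 by (intro mem_span_Int[OF B(1)]) auto
    also have "(B0 \<union> J) \<inter> insert e B0 = B0" using JB insert.hyps by auto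
    finally have "coset (span B0) y1 = coset (span B0) y2" by (simp add: coset_eq_iff)
    then show False using inj y by (auto dest: inj_onD)
  qed
  have "r^card (insert e J) = r * r^card J" using insert.hyps by simp
  also have "\<dots> \<le> real (card ?F) * r^card J" using insert.prems r by (intro mult_right_mono) auto
  also have "\<dots> = (\<Sum>y1\<in>?F. r^card J)" by simp
  also have "\<dots> \<le> (\<Sum>y1\<in>?F. real (card (?G y1)))"
    using insert.prems JB by (intro sum_mono insert.IH) auto
  also have "\<dots> = real (card (\<Union>y1\<in>?F. ?G y1))"
    using K disj by (subst card_UN_disjoint) auto
  also have "\<dots> \<le> real (card {y \<in> K. y - x \<in> span (B0 \<union> insert e J)})"
  proof (intro of_nat_mono card_mono)
    show "(\<Union>y1\<in>?F. ?G y1) \<subseteq> {y \<in> K. y - x \<in> span (B0 \<union> insert e J)}"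
    proof
      fix y assume "y \<in> (\<Union>y1\<in>?F. ?G y1)"
      then obtain y1 where y: "y1 - x \<in> span (insert e B0)" "y \<in> K" "y - y1 \<in> span (B0 \<union> J)"
        by blast
      have "y1 - x \<in> span (B0 \<union> insert e J)" "y - y1 \<in> span (B0 \<union> insert e J)"
        using y span_mono[of "insert e B0" "B0 \<union> insert e J"] span_mono[of "B0 \<union> J" "B0 \<union> insert e J"] by auto
      then have "(y - y1) + (y1 - x) \<in> span (B0 \<union> insert e J)" by (meson span_add)
      then show "y \<in> {y \<in> K. y - x \<in> span (B0 \<union> insert e J)}" using y by simp
    qed
  qed (use K in simp)
  finally show ?case .
qed

end

section \<open>Pencils of subspaces\<close>

context prime_field_space
begin

lemma span_insert_span: "span (insert e (span C)) = span (insert e C)"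
proof
  have "span C \<subseteq> span (insert e C)" by (rule span_mono) auto
  then show "span (insert e (span C)) \<subseteq> span (insert e C)"
    by (intro span_minimal) (auto simp: span_base)
  show "span (insert e C) \<subseteq> span (insert e (span C))" by (rule span_mono) (auto simp: span_base)
qed

lemma card_span_Un:
  assumes B: "independent B" "C \<subseteq> B" and C: "finite (span C)" and T: "finite T" "T \<subseteq> B - C"
  shows "card (span (C \<union> T)) = q^card T * card (span C) \<and> finite (span (C \<union> T))"
  using T
proof (induction T rule: finite_induct)
  case empty
  then show ?case using C by simp
next
  case (insert e T)
  have e: "e \<notin> span (C \<union> T)"
  proof
    assume "e \<in> span (C \<union> T)"
    moreover have "C \<union> T \<subseteq> B - {e}" using insert B by auto
    ultimately have "e \<in> span (B - {e})" using span_mono by blast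
    then show False using B insert by (auto simp: dependent_def)
  qed
  show ?case using card_span_insert[OF subspace_span _ e] insert by (simp add: span_insert_span)
qed

lemma finite_span: "independent B \<Longrightarrow> finite B \<Longrightarrow> finite (span B)"
  using card_span_Un[of B "{}" B] by simp

end

text \<open>Coordinates at \<open>B - B0\<close> stand for coordinates in the quotient by
  \<open>span B0\<close>, where each \<open>W\<close> is the line through \<open>v W\<close>. That
  the basis directions themselves come from members of \<open>E\<close> makes the projection bounds
  available along them.\<close>

locale subspace_pencil = prime_field_space +
  fixes E :: "'b set set" and v :: "'b set \<Rightarrow> 'b" and B0 B :: "'b set"
  assumes B: "independent B" "B0 \<subseteq> B" "finite B"
    and finite_E: "finite E"
    and span_v: "W \<in> E \<Longrightarrow> W = span (insert (v W) B0)"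
    and v_mem: "W \<in> E \<Longrightarrow> v W \<in> span B" "W \<in> E \<Longrightarrow> v W \<notin> span B0"
    and basis_direction: "e \<in> B - B0 \<Longrightarrow> span (insert e B0) \<in> E"
begin

lemma subspace_pencil_member: "W \<in> E \<Longrightarrow> subspace W"
  using span_v subspace_span by metis

lemma v_in_member: "W \<in> E \<Longrightarrow> v W \<in> W"
  using span_v span_base insertI1 by metis

lemma pencil_eqI:
  assumes W: "W \<in> E" and x: "x \<in> W" "x \<notin> span B0"
  shows "W = span (insert x B0)"
proof -
  have "x \<in> span (insert (v W) B0)" using x span_v[OF W] by blast
  then have "v W \<in> span (insert x B0)" using x(2) by (rule in_span_insert)
  moreover have "B0 \<subseteq> span (insert x B0)" using span_superset[of "insert x B0"] by blast
  ultimately have "span (insert (v W) B0) \<subseteq> span (insert x B0)" by (intro span_minimal) auto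
  then have "W \<subseteq> span (insert x B0)" using span_v[OF W] by blast
  moreover have "span (insert x B0) \<subseteq> W"
  proof (rule span_minimal)
    have "B0 \<subseteq> W" using span_v[OF W] span_superset[of "insert (v W) B0"] by blast
    then show "insert x B0 \<subseteq> W" using x by blast
  qed (rule subspace_pencil_member[OF W])
  ultimately show ?thesis by blast
qed

lemma pencil_Int_span:
  assumes W: "W \<in> E" and U: "\<not> W \<subseteq> span C" "B0 \<subseteq> C" and x: "x \<in> W" "x \<in> span C"
  shows "x \<in> span B0"
proof (rule ccontr)
  assume "x \<notin> span B0"
  then have "W = span (insert x B0)" using pencil_eqI[OF W x(1)] by blast
  moreover have "span (insert x B0) \<subseteq> span C"
    using x(2) U(2) span_superset[of C] by (intro span_minimal) auto
  ultimately show False using U(1) by blast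
qed

text \<open>Outside \<open>span B0\<close> the members are pairwise disjoint, and each has
  \<open>(q - 1) * card (span B0)\<close> vectors there.\<close>

lemma card_pencil_members_in_span:
  assumes J: "J \<subseteq> B - B0"
  shows "card {W \<in> E. W \<subseteq> span (B0 \<union> J)} * (q - 1) < q^card J"
proof -
  let ?E = "{W \<in> E. W \<subseteq> span (B0 \<union> J)}"
  define c where "c = card (span B0)"
  have ind: "independent B0" using B(1,2) by (rule independent_mono)
  have fin0: "finite (span B0)" using finite_span[OF ind] B finite_subset by blast
  have "finite J" using J B finite_subset by blast
  then have cJ: "card (span (B0 \<union> J)) = q^card J * c" "finite (span (B0 \<union> J))"
    using card_span_Un[OF B(1,2) fin0 _ J] by (simp_all add: c_def)
  have c: "c > 0" using fin0 span_zero[of B0] by (auto simp: c_def card_gt_0_iff)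
  have sub0: "span B0 \<subseteq> span (B0 \<union> J)" by (rule span_mono) auto
  have card: "card (W - span B0) = (q - 1) * c" if "W \<in> E" for W
  proof -
    have W: "W = span (insert (v W) (span B0))" using span_v[OF that] by (simp add: span_insert_span)
    have "card (span (insert (v W) (span B0))) = q * c"
      using card_span_insert(1)[OF subspace_span fin0 v_mem(2)[OF that]] by (simp add: c_def)
    then have "card W = q * c" using W by metis
    moreover have "span B0 \<subseteq> W"
    proof -
      have "span B0 \<subseteq> span (insert (v W) B0)" by (rule span_mono) auto
      then show ?thesis using span_v[OF that] by blast
    qed
    ultimately show ?thesis using fin0 by (simp add: card_Diff_subset c_def diff_mult_distrib)
  qed
  have disj: "(W - span B0) \<inter> (W' - span B0) = {}" if "W \<in> E" "W' \<in> E" "W \<noteq> W'" for W W'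
    using pencil_eqI[OF that(1)] pencil_eqI[OF that(2)] that(3) by blast
  have "card ?E * ((q - 1) * c) = (\<Sum>W\<in>?E. card (W - span B0))" using card by simp
  also have "\<dots> = card (\<Union>W\<in>?E. W - span B0)"
  proof (rule card_UN_disjoint[symmetric])
    show "\<forall>W\<in>?E. finite (W - span B0)" using cJ(2) finite_subset by blast
  qed (use finite_E disj in auto)
  also have "\<dots> \<le> card (span (B0 \<union> J) - span B0)" using cJ(2) by (intro card_mono) auto
  also have "\<dots> < q^card J * c"
  proof -
    have "card (span (B0 \<union> J) - span B0) = q^card J * c - c"
      using fin0 sub0 cJ(1) by (simp add: card_Diff_subset c_def)
    moreover have "q^card J * c > 0" using c two_le_q by simp
    ultimately show ?thesis using c by linarith
  qed
  finally show ?thesis using c by (simp add: mult.assoc[symmetric])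
qed

end

section \<open>Pencils acting on a set with long fibres\<close>

locale fibred_pencil = subspace_pencil +
  fixes K :: "'b set" and r X :: real and d :: nat
  assumes K: "finite K" "K \<noteq> {}" "inj_on (coset (span B0)) K"
    and r: "r > 0"
    and long_fibres: "e \<in> B - B0 \<Longrightarrow> x \<in> K \<Longrightarrow> r \<le> card {y \<in> K. y - x \<in> span (insert e B0)}"
    and projection_le: "W \<in> E \<Longrightarrow> card (coset W ` K) \<le> X"
    and d: "card (B - B0) = d + 1" "d \<ge> 1"
begin

lemma power_le_card_fibre:
  assumes "J \<subseteq> B - B0" "x \<in> K"
  shows "r^card J \<le> card {y \<in> K. y - x \<in> span (B0 \<union> J)}"
proof (rule fibre_growth[OF B(1,2) _ assms(1) K(1) K(3) r _ assms(2)])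
  show "finite J" using assms(1) B(3) finite_subset by blast
qed (use long_fibres assms in blast)

lemma power_le_card: "r^(d + 1) \<le> card K"
proof -
  obtain x where "x \<in> K" using K by blast
  then have "r^card (B - B0) \<le> card {y \<in> K. y - x \<in> span (B0 \<union> (B - B0))}"
    by (intro power_le_card_fibre) auto
  also have "\<dots> \<le> card K" using K by (intro of_nat_mono card_mono) auto
  finally show ?thesis by (simp add: d)
qed

text \<open>A member outside \<open>span (B0 \<union> J)\<close> meets it only in
  \<open>span B0\<close>, so its projection stays injective on a \<open>J\<close>-fibre and inherits
  the fibre's size.\<close>

lemma power_le_card_image_fibre:
  assumes W: "W \<in> E" "\<not> W \<subseteq> span (B0 \<union> J)" and J: "J \<subseteq> B - B0" and x: "x \<in> K"
  shows "r^card J \<le> card (coset W ` {y \<in> K. y - x \<in> span (B0 \<union> J)})"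
proof -
  let ?F = "{y \<in> K. y - x \<in> span (B0 \<union> J)}"
  have "inj_on (coset W) ?F"
  proof (rule inj_onI)
    fix y z assume yz: "y \<in> ?F" "z \<in> ?F" "coset W y = coset W z"
    have "(y - x) - (z - x) \<in> span (B0 \<union> J)" by (rule span_diff) (use yz in simp_all)
    moreover have "y - z \<in> W" using yz(3) coset_eq_iff[OF subspace_pencil_member[OF W(1)]] by blast
    ultimately have "y - z \<in> span B0" by (intro pencil_Int_span[OF W]) auto
    then have "coset (span B0) y = coset (span B0) z" by (simp add: coset_eq_iff)
    then show "y = z" using K(3) yz by (auto dest: inj_onD)
  qed
  then show ?thesis using power_le_card_fibre[OF J x] by (simp add: card_image)
qed

lemma direction_not_in_span:
  assumes "e \<in> B" "C \<subseteq> B - {e}"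
  shows "e \<notin> span C"
  using assms B(1) span_mono[of C "B - {e}"] by (auto simp: dependent_def)

lemma power_le_projection: "r^d \<le> X"
proof -
  obtain e where e: "e \<in> B - B0" using d by (metis card.empty ex_in_conv add_is_0 zero_neq_one)
  let ?W = "span (insert e B0)" and ?J = "B - B0 - {e}"
  have W: "?W \<in> E" using e by (rule basis_direction)
  have "e \<notin> span (B0 \<union> ?J)" using e B(2) by (intro direction_not_in_span) auto
  moreover have "e \<in> ?W" by (simp add: span_base)
  ultimately have nW: "\<not> ?W \<subseteq> span (B0 \<union> ?J)" by blast
  obtain x where x: "x \<in> K" using K by blast
  have "card ?J = d" using e d B(3) by simp
  then have "r^d = r^card ?J" by simp
  also have "\<dots> \<le> card (coset ?W ` {y \<in> K. y - x \<in> span (B0 \<union> ?J)})"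
    by (rule power_le_card_image_fibre[OF W nW _ x]) auto
  also have "\<dots> \<le> card (coset ?W ` K)" using K by (intro of_nat_mono card_mono) auto
  also have "\<dots> \<le> X" using W by (rule projection_le)
  finally show ?thesis .
qed

text \<open>Each coset of \<open>Y\<close> that meets \<open>K\<close> contains a fibre in the
  \<open>d - 1\<close> directions other than \<open>e\<close> and \<open>f\<close>, and this fibre
  splits into at least \<open>r^(d - 1)\<close> cosets of \<open>W\<close>. Thus the bound
  \<open>X\<close> improves to \<open>X / r^(d - 1)\<close> for the projections of the planar
  set.\<close>

lemma coarse_projection_le:
  assumes ef: "e \<in> B - B0" "f \<in> B - B0" "e \<noteq> f" and W: "W \<in> E" "\<not> W \<subseteq> span (B - {e, f})"
    and Y: "subspace Y" "W \<subseteq> Y" "B - {e, f} \<subseteq> Y"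
  shows "card (coset Y ` K) * r^(d - 1) \<le> X"
proof -
  let ?J = "B - B0 - {e, f}"
  have J: "?J \<subseteq> B - B0" "B0 \<union> ?J = B - {e, f}" using ef B(2) by auto
  have cJ: "card ?J = d - 1" using ef d B(3) by (simp add: card_Diff_subset)
  have cosets: "coset Y y = coset Y x" if "y - x \<in> Y" for x y using that coset_eq_iff[OF Y(1)] by blast
  have "card (coset Y ` K) * r^(d - 1) = (\<Sum>u\<in>coset Y ` K. r^(d - 1))" by simp
  also have "\<dots> \<le> (\<Sum>u\<in>coset Y ` K. real (card (coset W ` {y \<in> K. coset Y y = u})))"
  proof (rule sum_mono)
    fix u assume "u \<in> coset Y ` K"
    then obtain x where x: "x \<in> K" "u = coset Y x" by blast
    have "r^(d - 1) \<le> card (coset W ` {y \<in> K. y - x \<in> span (B0 \<union> ?J)})"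
      using power_le_card_image_fibre[of W ?J x] W J cJ x by simp
    also have "\<dots> \<le> card (coset W ` {y \<in> K. coset Y y = u})"
    proof (intro of_nat_mono card_mono image_mono)
      have "span (B0 \<union> ?J) \<subseteq> Y" unfolding J(2) using Y by (intro span_minimal)
      then show "{y \<in> K. y - x \<in> span (B0 \<union> ?J)} \<subseteq> {y \<in> K. coset Y y = u}"
        using cosets x(2) by blast
    qed (use K in simp)
    finally show "r^(d - 1) \<le> card (coset W ` {y \<in> K. coset Y y = u})" .
  qed
  also have "\<dots> = real (\<Sum>u\<in>coset Y ` K. card (coset W ` {y \<in> K. coset Y y = u}))" by simp
  also have "(\<Sum>u\<in>coset Y ` K. card (coset W ` {y \<in> K. coset Y y = u})) = card (coset W ` K)"
  proof (rule sum_card_image_fibres[OF K(1)])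
    fix x y assume "coset W x = coset W y"
    then show "coset Y x = coset Y y"
      using Y(2) coset_eq_iff[OF Y(1)] coset_eq_iff[OF subspace_pencil_member[OF W(1)]] by blast
  qed
  also have "\<dots> \<le> X" using W(1) by (rule projection_le)
  finally show ?thesis .
qed

end

context fibred_pencil
begin

definition slopes :: "'b \<Rightarrow> 'b \<Rightarrow> 'a set"
  where "slopes e f = {representation B (v W) f / representation B (v W) e |W.
    W \<in> E \<and> representation B (v W) e \<noteq> 0}"

text \<open>The bound comes from projecting to the plane spanned by the directions \<open>e\<close> and \<open>f\<close> inside a
  large fibre of the coset map of \<^term>\<open>span B\<close>, where \<open>W\<close> acts as the planar projection with slope
  given by the two coordinates of \<open>v W\<close>.\<close>

lemma card_slopes_dichotomy:
  fixes T G :: real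
  assumes ef: "e \<in> B - B0" "f \<in> B - B0" "e \<noteq> f"
  defines "T \<equiv> X / r^d" and "G \<equiv> 2^1032 * (2 * (X / r^d)^4)^576"
  shows "card (slopes e f) \<le> G \<or> r * T \<le> G + 1 \<or> q \<le> G * (r * T)"
proof -
  let ?c = "representation B"
  let ?U = "span (B - {e, f})" and ?P = "span (B - {f})" and ?Q = "span (B - {e})" and ?R = "span B"
  define Y where "Y = X / r^(d - 1)"
  have T1: "T \<ge> 1" using power_le_projection r by (simp add: T_def)
  obtain d' where d': "d = Suc d'" using d(2) by (cases d) auto
  have Y: "Y = r * T" using r by (simp add: Y_def T_def d')
  have Y0: "Y > 0" using Y T1 r by simp
  have coarse: "card (coset Z ` K) \<le> Y"
    if "subspace Z" "W \<in> E" "\<not> W \<subseteq> ?U" "W \<subseteq> Z" "B - {e, f} \<subseteq> Z" for Z W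
    using coarse_projection_le[OF ef that(2,3,1,4,5)] r by (simp add: Y_def field_simps)
  have dirs: "card (coset (span (B - {b})) ` K) \<le> Y" if ab: "{a, b} = {e, f}" "a \<noteq> b" for a b
  proof (rule coarse[where W = "span (insert a B0)"])
    have a: "a \<in> B - B0" using ab ef by auto
    then show "span (insert a B0) \<in> E" by (rule basis_direction)
    show "\<not> span (insert a B0) \<subseteq> ?U"
      using direction_not_in_span[of a "B - {e, f}"] a ab span_base[of a "insert a B0"] by blast
    show "span (insert a B0) \<subseteq> span (B - {b})" using ab ef B(2) by (intro span_mono) auto
    show "B - {e, f} \<subseteq> span (B - {b})" using span_superset[of "B - {b}"] ab by blast
  qed simp
  obtain K3 where K3: "K3 \<subseteq> K" "inj_on (coset ?U) K3" "coset ?U ` K3 = coset ?U ` K"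
    using exists_representatives[of K "coset ?U"] by blast
  have fin3: "finite K3" using K3(1) K(1) by (rule finite_subset)
  have cK3: "r^2 \<le> card K3"
  proof -
    obtain x where x: "x \<in> K" using K by blast
    let ?F = "{y \<in> K. y - x \<in> span (B0 \<union> {e, f})}"
    have "inj_on (coset ?U) ?F"
    proof (rule inj_onI)
      fix y z assume yz: "y \<in> ?F" "z \<in> ?F" "coset ?U y = coset ?U z"
      have "(y - x) - (z - x) \<in> span (B0 \<union> {e, f})" by (rule span_diff) (use yz in simp_all)
      moreover have "y - z \<in> ?U" using yz(3) by (simp add: coset_eq_iff)
      ultimately have "y - z \<in> span ((B - {e, f}) \<inter> (B0 \<union> {e, f}))"
        using ef B(2) by (intro mem_span_Int[OF B(1)]) auto
      also have "(B - {e, f}) \<inter> (B0 \<union> {e, f}) = B0" using ef B(2) by auto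
      finally have "coset (span B0) y = coset (span B0) z" by (simp add: coset_eq_iff)
      then show "y = z" using K(3) yz by (auto dest: inj_onD)
    qed
    then have "card ?F = card (coset ?U ` ?F)" by (simp add: card_image)
    also have "\<dots> \<le> card (coset ?U ` K)" using K by (intro card_mono) auto
    also have "\<dots> = card K3" using K3 card_image by metis
    finally have "real (card ?F) \<le> card K3" by simp
    moreover have "r^card {e, f} \<le> card ?F" using ef x by (intro power_le_card_fibre) auto
    moreover have "card {e, f} = 2" using ef by simp
    ultimately show ?thesis by simp
  qed
  have "real (card K3) > 0" by (rule less_le_trans[OF _ cK3]) (use r in simp)
  then have ne3: "K3 \<noteq> {}" by auto
  have le3: "card (coset Z ` K3) \<le> Y" if "card (coset Z ` K) \<le> Y" for Z
  proof -
    have "card (coset Z ` K3) \<le> card (coset Z ` K)" using K K3(1) by (intro card_mono) auto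
    then show ?thesis using that by linarith
  qed
  \<comment> \<open>Planar coordinates make sense only inside one coset of \<open>span B\<close>,
    while \<open>K3\<close> may meet many. The two coordinate projections refine this coset map and
    jointly separate \<open>K3\<close>, so some coset retains at least
    \<open>r^4 / Y^2 = r^2 / T^2\<close> points.\<close>
  obtain z where z: "z \<in> K3" "(card K3)^2 \<le> card {y \<in> K3. coset ?R y = coset ?R z} * Y^2"
  proof (rule exists_large_common_fibre[OF fin3 ne3, of "coset ?P" Y "coset ?Q" "coset ?R"])
    have PQR: "?P \<subseteq> ?R" "?Q \<subseteq> ?R" by (rule span_mono, blast)+
    fix x y assume "x \<in> K3" "y \<in> K3"
    show "coset ?P x = coset ?P y \<Longrightarrow> coset ?R x = coset ?R y"
      "coset ?Q x = coset ?Q y \<Longrightarrow> coset ?R x = coset ?R y"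
      using PQR by (auto simp: coset_eq_iff)
    assume PQ: "coset ?P x = coset ?P y" "coset ?Q x = coset ?Q y"
    have "x - y \<in> span ((B - {f}) \<inter> (B - {e}))"
      by (rule mem_span_Int[OF B(1)]) (use PQ in \<open>auto simp: coset_eq_iff\<close>)
    also have "(B - {f}) \<inter> (B - {e}) = B - {e, f}" by auto
    finally have "coset ?U x = coset ?U y" by (simp add: coset_eq_iff)
    then show "x = y" using K3(2) \<open>x \<in> K3\<close> \<open>y \<in> K3\<close> by (auto dest: inj_onD)
  next
    show "card (coset ?P ` K3) \<le> Y" using ef by (intro le3 dirs[of e f]) auto
    show "card (coset ?Q ` K3) \<le> Y" using ef by (intro le3 dirs[of f e]) auto
  qed (use that in blast)
  define K4 where "K4 = {y \<in> K3. coset ?R y = coset ?R z}"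
  have K4: "K4 \<subseteq> K3" "finite K4" "K4 \<noteq> {}" using z(1) fin3 by (auto simp: K4_def)
  have mem4: "y - z \<in> ?R" if "y \<in> K4" for y using that by (simp add: K4_def coset_eq_iff)
  define \<phi> where "\<phi> y = (?c (y - z) e, ?c (y - z) f)" for y
  define L where "L = \<phi> ` K4"
  have diff4: "y - y' \<in> ?R" "?c (y - y') b = ?c (y - z) b - ?c (y' - z) b"
    if y: "y \<in> K4" "y' \<in> K4" for y y' b
  proof -
    have eq: "y - y' = (y - z) - (y' - z)" by simp
    show "y - y' \<in> ?R" unfolding eq by (rule span_diff) (use y mem4 in blast)+
    show "?c (y - y') b = ?c (y - z) b - ?c (y' - z) b"
      unfolding eq using representation_diff[OF B(1) mem4[OF y(2)] mem4[OF y(1)]] by simp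
  qed
  have U_iff: "x \<in> ?U \<longleftrightarrow> ?c x e = 0 \<and> ?c x f = 0" if "x \<in> ?R" for x
    using mem_span_subset_iff[OF B(1) _ that, of "B - {e, f}"] ef by auto
  have "inj_on \<phi> K4"
  proof (rule inj_onI)
    fix y y' assume y: "y \<in> K4" "y' \<in> K4" "\<phi> y = \<phi> y'"
    then have "y - y' \<in> ?U" using U_iff diff4[OF y(1,2)] by (simp add: \<phi>_def)
    then have "coset ?U y = coset ?U y'" by (simp add: coset_eq_iff)
    then show "y = y'" using K3(2) K4(1) y by (auto dest: inj_onD)
  qed
  then have cL: "card L = card K4" by (simp add: L_def card_image)
  \<comment> \<open>The planar theorem takes natural numbers. Rounding up here accounts for the
    \<open>2\<close> in \<open>2 * T^4\<close>, and rounding \<open>Y\<close> down to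
    \<open>Xn\<close> for the \<open>+ 1\<close> in the second alternative.\<close>
  define \<tau> where "\<tau> = nat \<lceil>Y^2 / card L\<rceil>"
  define Xn where "Xn = nat \<lfloor>Y\<rfloor>"
  have cL0: "card L > 0" using K4 cL by (simp add: card_gt_0_iff)
  have "slopes e f = {} \<or> slopes e f \<noteq> {}" by blast
  have proj: "card ((\<lambda>(a, b). b - t * a) ` L) \<le> Xn" if t: "t \<in> slopes e f" for t
  proof -
    obtain W where W: "W \<in> E" "?c (v W) e \<noteq> 0" "t = ?c (v W) f / ?c (v W) e"
      using t unfolding slopes_def by blast
    let ?Z = "span (insert (v W) (B - {e, f}))"
    have nW: "\<not> W \<subseteq> ?U" using U_iff[OF v_mem(1)[OF W(1)]] W(2) v_in_member[OF W(1)] by blast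
    have "W \<subseteq> ?Z"
    proof -
      have "span (insert (v W) B0) \<subseteq> ?Z" using ef B(2) by (intro span_mono) auto
      then show ?thesis using span_v[OF W(1)] by blast
    qed
    moreover have "B - {e, f} \<subseteq> ?Z" using span_superset[of "insert (v W) (B - {e, f})"] by blast
    ultimately have 1: "card (coset ?Z ` K) \<le> Y" using W(1) nW by (intro coarse) auto
    have "(\<lambda>(a, b). b - t * a) ` L = (\<lambda>y. ?c (y - z) f - t * ?c (y - z) e) ` K4"
      by (simp add: L_def image_image \<phi>_def)
    also have "card \<dots> \<le> card (coset ?Z ` K4)"
    proof (rule card_image_le_coarser[OF K4(2)])
      fix y y' assume y: "y \<in> K4" "y' \<in> K4" "coset ?Z y = coset ?Z y'"
      \<comment> \<open>Modulo \<open>?U\<close> the difference is a multiple of \<open>v W\<close>,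
        whose coordinates at \<open>e\<close> and \<open>f\<close> have ratio \<open>t\<close>; the
        planar projection of slope \<open>t\<close> cannot tell the two points apart.\<close>
      then obtain k where k: "(y - y') - k *s v W \<in> ?U"
        by (auto simp: coset_eq_iff span_breakdown_eq)
      have kv: "k *s v W \<in> ?R" using v_mem(1)[OF W(1)] by (rule span_scale)
      have R: "(y - y') - k *s v W \<in> ?R" using diff4(1)[OF y(1,2)] kv by (rule span_diff)
      have "?c ((y - y') - k *s v W) b = ?c (y - y') b - k * ?c (v W) b" for b
        using representation_diff[OF B(1) kv diff4(1)[OF y(1,2)]]
          representation_scale[OF B(1) v_mem(1)[OF W(1)]] by simp
      then have "?c (y - y') e = k * ?c (v W) e" "?c (y - y') f = k * ?c (v W) f"
        using k U_iff[OF R] by simp_all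
      then have "?c (y - y') f - t * ?c (y - y') e = 0" using W(2,3) by simp
      then have "(?c (y - z) f - t * ?c (y - z) e) - (?c (y' - z) f - t * ?c (y' - z) e) = 0"
        unfolding diff4(2)[OF y(1,2)] by (simp add: algebra_simps)
      then show "?c (y - z) f - t * ?c (y - z) e = ?c (y' - z) f - t * ?c (y' - z) e"
        by (simp only: right_minus_eq)
    qed
    also have "\<dots> \<le> card (coset ?Z ` K)" using K K3(1) K4(1) by (intro card_mono) auto
    finally have "real (card ((\<lambda>(a, b). b - t * a) ` L)) \<le> Y" using 1 by linarith
    then show ?thesis by (simp add: Xn_def le_nat_floor)
  qed
  have XnY: "real Xn \<le> Y" "Y \<le> real Xn + 1" using Y0 unfolding Xn_def by linarith+
  have "real Xn^2 \<le> Y^2" using XnY(1) by (intro power_mono) auto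
  also have "\<dots> = (Y^2 / card L) * card L"
  proof -
    have "real (card L) \<noteq> 0" using cL0 by linarith
    from nonzero_eq_divide_eq[THEN iffD1, OF this refl] show ?thesis by (rule sym)
  qed
  also have "\<dots> \<le> real \<tau> * card L" by (intro mult_right_mono) (auto simp: \<tau>_def)
  finally have \<tau>: "Xn^2 \<le> \<tau> * card L" by (simp flip: of_nat_power of_nat_mult)
  have "Y^2 / card L \<le> T^4"
  proof -
    have "(r^2)^2 \<le> (real (card K3))^2" using cK3 r by (intro power_mono) auto
    also have "\<dots> \<le> card L * Y^2" using z(2) cL by (simp add: K4_def)
    finally have a: "(r^2)^2 \<le> card L * Y^2" .
    have "Y^2 * (r^2)^2 \<le> Y^2 * (card L * Y^2)" by (intro mult_left_mono a) simp
    also have "\<dots> = T^4 * card L * (r^2)^2" unfolding Y by (simp add: power2_eq_square power4_eq_xxxx mult_ac)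
    finally have "Y^2 \<le> T^4 * card L" using r by simp
    then show ?thesis using cL0 by (simp add: divide_le_eq)
  qed
  moreover have "real \<tau> \<le> Y^2 / card L + 1" by (simp add: \<tau>_def)
  moreover have "1 \<le> T^4" using T1 by simp
  ultimately have \<tau>T: "real \<tau> \<le> 2 * T^4" by linarith
  have G: "2^1032 * real \<tau>^576 \<le> G"
    unfolding G_def T_def[symmetric] using \<tau>T by (intro mult_left_mono power_mono) auto
  have "L \<noteq> {}" using cL0 by auto
  from planar_projections[OF prime_field this \<tau> proj]
  have "card (slopes e f) \<le> 2^1032 * \<tau>^576 \<or> Xn \<le> 2^1032 * \<tau>^576 \<or> q \<le> 2^1032 * \<tau>^576 * Xn"
    by (simp only: q_eq)
  then show ?thesis
  proof (elim disjE)
    assume "card (slopes e f) \<le> 2^1032 * \<tau>^576"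
    then have "real (card (slopes e f)) \<le> real (2^1032 * \<tau>^576)" by (rule of_nat_mono)
    then have "real (card (slopes e f)) \<le> 2^1032 * real \<tau>^576" by (simp only: of_nat_mult of_nat_power of_nat_numeral)
    then show ?thesis using G by linarith
  next
    assume "Xn \<le> 2^1032 * \<tau>^576"
    then have "real Xn \<le> real (2^1032 * \<tau>^576)" by (rule of_nat_mono)
    then have "real Xn \<le> 2^1032 * real \<tau>^576" by (simp only: of_nat_mult of_nat_power of_nat_numeral)
    then show ?thesis using G XnY Y by linarith
  next
    assume "q \<le> 2^1032 * \<tau>^576 * Xn"
    then have "real q \<le> real (2^1032 * \<tau>^576 * Xn)" by (rule of_nat_mono)
    then have "real q \<le> 2^1032 * real \<tau>^576 * real Xn" by (simp only: of_nat_mult of_nat_power of_nat_numeral)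
    also have "\<dots> \<le> G * Y" using G XnY by (intro mult_mono) (auto simp: G_def)
    finally show ?thesis using Y by simp
  qed
qed

text \<open>A member of the pencil is determined by the ratios of the coordinates of \<open>v W\<close> to the one at
  \<open>e\<close>.\<close>

lemma card_pencil_dichotomy:
  fixes T G :: real
  assumes e: "e \<in> B - B0"
  defines "T \<equiv> X / r^d" and "G \<equiv> 2^1032 * (2 * (X / r^d)^4)^576"
  shows "card {W \<in> E. \<not> W \<subseteq> span (B - {e})} \<le> G^d \<or> r * T \<le> G + 1 \<or> q \<le> G * (r * T)"
proof (rule ccontr)
  assume neg: "\<not> ?thesis"
  let ?c = "representation B"
  let ?E = "{W \<in> E. \<not> W \<subseteq> span (B - {e})}" and ?S = "B - B0 - {e}"
  have G: "card (slopes e f) \<le> G" if "f \<in> ?S" for f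
    using card_slopes_dichotomy[OF e, of f] that neg unfolding T_def G_def by blast
  define \<Phi> where "\<Phi> W = (\<lambda>f\<in>?S. ?c (v W) f / ?c (v W) e)" for W
  have ne: "?c (v W) e \<noteq> 0" if "W \<in> ?E" for W
  proof
    assume 0: "?c (v W) e = 0"
    have W: "W \<in> E" using that by blast
    have "v W \<in> span (B - {e})"
      using mem_span_subset_iff[OF B(1) _ v_mem(1)[OF W], of "B - {e}"] 0 by auto
    moreover have "B0 \<subseteq> span (B - {e})" using span_superset[of "B - {e}"] e B(2) by blast
    ultimately have "span (insert (v W) B0) \<subseteq> span (B - {e})" by (intro span_minimal) auto
    then show False using span_v[OF W] that by blast
  qed
  have "inj_on \<Phi> ?E"
  proof (rule inj_onI)
    fix W W' assume W: "W \<in> ?E" "W' \<in> ?E" "\<Phi> W = \<Phi> W'"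
    have E: "W \<in> E" "W' \<in> E" using W by auto
    define s where "s = ?c (v W') e / ?c (v W) e"
    have sv: "s *s v W \<in> span B" using v_mem(1)[OF E(1)] by (rule span_scale)
    have R: "v W' - s *s v W \<in> span B" using v_mem(1)[OF E(2)] sv by (rule span_diff)
    have rep: "?c (v W' - s *s v W) b = ?c (v W') b - s * ?c (v W) b" for b
      using representation_diff[OF B(1) sv v_mem(1)[OF E(2)]]
        representation_scale[OF B(1) v_mem(1)[OF E(1)]] by simp
    have "?c (v W' - s *s v W) b = 0" if b: "b \<in> B - B0" for b
    proof (cases "b = e")
      case True
      then show ?thesis using ne[OF W(1)] rep[of b] by (simp add: s_def)
    next
      case False
      then have "b \<in> ?S" using b by blast
      then have "?c (v W) b / ?c (v W) e = ?c (v W') b / ?c (v W') e"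
        using fun_cong[OF W(3), of b] by (simp add: \<Phi>_def)
      then show ?thesis using ne[OF W(1)] ne[OF W(2)] rep[of b] by (simp add: s_def field_simps)
    qed
    then have diff: "v W' - s *s v W \<in> span B0" using mem_span_subset_iff[OF B(1,2) R] by blast
    have "span B0 \<subseteq> span (insert (v W) B0)" by (rule span_mono) auto
    then have "v W' - s *s v W \<in> W" using diff span_v[OF E(1)] by blast
    moreover have "s *s v W \<in> W"
      using subspace_pencil_member[OF E(1)] v_in_member[OF E(1)] by (rule subspace_scale)
    ultimately have "(v W' - s *s v W) + s *s v W \<in> W"
      using subspace_pencil_member[OF E(1)] by (simp only: subspace_add)
    then have "v W' \<in> W" by simp
    then have "W = span (insert (v W') B0)" using pencil_eqI[OF E(1)] v_mem(2)[OF E(2)] by blast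
    then show "W = W'" using span_v[OF E(2)] by simp
  qed
  then have "card ?E = card (\<Phi> ` ?E)" by (simp add: card_image)
  also have "\<dots> \<le> card (PiE ?S (slopes e))"
  proof (rule card_mono)
    show "finite (PiE ?S (slopes e))" using B(3) by (intro finite_PiE) auto
    have "?c (v W) f / ?c (v W) e \<in> slopes e f" if "W \<in> ?E" for W f
      using ne[OF that] that unfolding slopes_def by blast
    then show "\<Phi> ` ?E \<subseteq> PiE ?S (slopes e)"
      unfolding \<Phi>_def by (intro image_subsetI restrict_PiE_iff[THEN iffD2] ballI)
  qed
  also have "\<dots> = (\<Prod>f\<in>?S. card (slopes e f))" using B(3) by (simp add: card_PiE)
  finally have "real (card ?E) \<le> (\<Prod>f\<in>?S. real (card (slopes e f)))" by (simp flip: of_nat_prod)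
  also have "\<dots> \<le> (\<Prod>f\<in>?S. G)" using G by (intro prod_mono) auto
  also have "\<dots> = G^d" using e d B(3) by simp
  finally show False using neg by blast
qed

end

section \<open>The geometric dichotomy for an arbitrary family of subspaces\<close>

context prime_field_space
begin

lemma exists_subspace_pencil:
  assumes V0: "subspace V0" "finite V0" and E: "finite E"
    and W: "\<And>W. W \<in> E \<Longrightarrow> subspace W \<and> V0 \<subseteq> W \<and> card W = q * card V0"
  obtains v B0 B where "subspace_pencil scale q E v B0 B" "span B0 = V0"
proof -
  have c: "card V0 > 0" using V0 subspace_0 by (auto simp: card_gt_0_iff)
  have q: "q \<ge> 2" by (rule two_le_q)
  define v where "v W = (SOME x. x \<in> W \<and> x \<notin> V0)" for W
  have v: "v W \<in> W" "v W \<notin> V0" if "W \<in> E" for W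
  proof -
    have "\<not> W \<subseteq> V0"
    proof
      assume "W \<subseteq> V0"
      then have "q * card V0 \<le> card V0" using card_mono[OF V0(2)] W[OF that] by metis
      then show False using c q by simp
    qed
    then have "\<exists>x. x \<in> W \<and> x \<notin> V0" by blast
    then have "v W \<in> W \<and> v W \<notin> V0" unfolding v_def by (rule someI_ex)
    then show "v W \<in> W" "v W \<notin> V0" by blast+
  qed
  have W_eq: "W = span (insert (v W) V0)" if "W \<in> E" for W
  proof -
    have "card W > 0" using W[OF that] c q by simp
    then have "finite W" by (simp add: card_gt_0_iff)
    moreover have "span (insert (v W) V0) \<subseteq> W"
      using W[OF that] v(1)[OF that] by (intro span_minimal) auto
    moreover have "card (span (insert (v W) V0)) = card W"
      using card_span_insert(1)[OF V0 v(2)[OF that]] W[OF that] by simp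
    ultimately show ?thesis using card_subset_eq by metis
  qed
  obtain B0 where B0: "B0 \<subseteq> V0" "independent B0" "V0 \<subseteq> span B0"
    by (rule maximal_independent_subset)
  have span0: "span B0 = V0" using B0 V0(1) span_minimal by blast
  have W_eq': "W = span (insert (v W) B0)" if "W \<in> E" for W
    using W_eq[OF that] span_insert_span[of "v W" B0] by (simp only: span0)
  obtain B where B: "B0 \<subseteq> B" "B \<subseteq> B0 \<union> v ` E" "independent B" "B0 \<union> v ` E \<subseteq> span B"
    using maximal_independent_subset_extend[of B0 "B0 \<union> v ` E"] B0(2) by blast
  have "subspace_pencil scale q E v B0 B"
  proof unfold_locales
    have "finite (B0 \<union> v ` E)" using B0(1) V0(2) E finite_subset by blast
    then show "finite B" using B(2) finite_subset by blast
    show "span (insert e B0) \<in> E" if e: "e \<in> B - B0" for e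
    proof -
      obtain W where "W \<in> E" "e = v W" using e B(2) by blast
      then show ?thesis using W_eq' by simp
    qed
    show "v W \<notin> span B0" if "W \<in> E" for W using v(2)[OF that] span0 by simp
    show "W = span (insert (v W) B0)" if "W \<in> E" for W by (rule W_eq'[OF that])
  qed (use B E in auto)
  then show thesis using span0 by (rule that)
qed

text \<open>The quantity \<open>M\<close> is essentially the number of members through a well-chosen
  \<open>(k - 1)\<close>-dimensional subspace. The bounds on \<open>d\<close> and \<open>M\<close>
  are part of the conclusion because the later choice of exponent must be uniform in
  \<open>d\<close>.\<close>

theorem projection_dichotomy:
  fixes E :: "'v set set" and M :: real
  assumes V: "finite V" "subspace V" "card V = q^n" and k: "1 \<le> k" "k < n" and d: "1 \<le> d"
    and q: "8 \<le> q" "4 * n \<le> q"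
    and E: "finite E" "\<And>W. W \<in> E \<Longrightarrow> subspace W \<and> W \<subseteq> V \<and> card W = q^k"
    and large: "2 * real q^((n - k) * (k - 1) + d - 1) \<le> card E"
    and K: "K \<subseteq> V" "K \<noteq> {}" and X: "\<And>W. W \<in> E \<Longrightarrow> card (coset W ` K) \<le> X"
  defines "M \<equiv> card E / real q^((n - k) * (k - 1))"
  shows "d \<le> n \<and> M < 2 * real q^(n - k) \<and>
    (\<exists>r::real. r > 0 \<and> card K \<le> 2 * (real n + 2) * r * real X^k \<and>
      (r^(d + 1) \<le> 2 * (real n + 2) * real X \<or>
        r^d \<le> real X \<and> r^(d + 1) \<le> card K \<and>
        (let T = real X / r^d; G = 2^1032 * (2 * T^4)^576
         in M \<le> 4 * G^d \<or> r * T \<le> G + 1 \<or> q \<le> G * (r * T))))"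
proof -
  let ?Q = "real q^((n - k) * (k - 1))"
  have q1: "real q \<ge> 8" "real q > 1" using q(1) by linarith+
  have Q0: "?Q > 0" using q1 by simp
  have cE: "card E = M * ?Q" using Q0 unfolding M_def by (metis nonzero_eq_divide_eq less_irrefl)
  have M_ge: "2 * real q^(d - 1) \<le> M"
  proof -
    have "(n - k) * (k - 1) + d - 1 = (d - 1) + (n - k) * (k - 1)" using d by simp
    then have "2 * real q^(d - 1) * ?Q \<le> M * ?Q" using large cE by (simp add: power_add)
    then show ?thesis using Q0 by (simp only: mult_le_cancel_right_pos)
  qed
  have pos: "real q^(d - 1) > 0" using q1 by simp
  have M0: "M > 0" using M_ge pos by linarith
  have zero: "subspace {0}" "{0} \<subseteq> V" "card {0::'v} = q^0" using subspace_0[OF V(2)] by auto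
  have WE: "subspace W \<and> {0} \<subseteq> W \<and> W \<subseteq> V \<and> card W = q^k" if "W \<in> E" for W
    using E(2)[OF that] subspace_0 by simp
  have M_lt: "M < 2 * real q^(n - k)"
  proof -
    have "card E < 2 * real q^((n - k) * (k - 0))"
      by (rule card_containing_subspace_le[OF E(1) V zero]) (use k q WE in auto)
    also have "(n - k) * (k - 0) = (n - k) + (n - k) * (k - 1)" using k by (cases k) auto
    finally have "M * ?Q < 2 * real q^(n - k) * ?Q" using cE by (simp add: power_add)
    then show ?thesis using Q0 by (simp only: mult_less_cancel_right_pos)
  qed
  have d_le: "d \<le> n - k"
  proof -
    have "real q^(d - 1) < real q^(n - k)" using M_ge M_lt by linarith
    then have "d - 1 < n - k" using q1(2) by (rule power_less_imp_less_exp[rotated])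
    then show ?thesis by simp
  qed
  have ne: "E \<noteq> {}" using cE M0 Q0 by auto
  have finK: "finite K" using K(1) V(1) by (rule finite_subset)
  have X1: "X \<ge> 1"
  proof -
    obtain W where W: "W \<in> E" using ne by blast
    have "card (coset W ` K) \<noteq> 0" using K finK by simp
    then show ?thesis using X[OF W] by simp
  qed
  \<comment> \<open>Too few subspaces contain a fixed nonzero vector: otherwise
    \<open>M < 2\<close>, against \<open>2 * q^(d - 1) \<le> M\<close>. The case
    \<open>k = 1\<close> is separate because the counting lemma needs \<open>1 < k\<close> when
    applied to a line.\<close>
  have sep: "\<exists>W\<in>E. u \<notin> W" if u: "u \<in> V" "u \<noteq> 0" for u
  proof (rule ccontr)
    assume "\<not> ?thesis"
    then have all: "u \<in> W" if "W \<in> E" for W using that by blast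
    have U: "subspace (span {u})" "span {u} \<subseteq> V" "card (span {u}) = q^1"
      using u V(2) card_span_insert(1)[of "{0}" u] zero by (auto simp: span_minimal span_insert_0 insert_commute)
    have EU: "subspace W \<and> span {u} \<subseteq> W \<and> W \<subseteq> V \<and> card W = q^k" if "W \<in> E" for W
      using E(2)[OF that] all[OF that] by (simp add: span_minimal)
    show False
    proof (cases "k = 1")
      case True
      have "W = span {u}" if "W \<in> E" for W
      proof -
        have "finite W" using EU[OF that] V(1) finite_subset by blast
        then show ?thesis using EU[OF that] U(3) True card_subset_eq[of W "span {u}"] by simp
      qed
      then have "E \<subseteq> {span {u}}" by blast
      then have "card E \<le> 1" using card_mono[of "{span {u}}" E] by simp
      moreover have "1 \<le> real q^(d - 1)" using q1 by simp
      ultimately show False using M_ge cE True by simp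
    next
      case False
      then have "card E < 2 * real q^((n - k) * (k - 1))"
        using k q by (intro card_containing_subspace_le[OF E(1) V U]) (use EU in auto)
      then have "M * ?Q < 2 * ?Q" using cE by simp
      then have "M < 2" using Q0 by (simp only: mult_less_cancel_right_pos)
      moreover have "1 \<le> real q^(d - 1)" using q1 by simp
      ultimately show False using M_ge by linarith
    qed
  qed
  obtain V0 where V0: "subspace V0" "{0} \<subseteq> V0" "V0 \<subseteq> V" "card V0 = q^(0 + (k - 1))"
    "real (card E) * (1 - 1 / real q^2)^(k - 1) \<le> card {W \<in> E. V0 \<subseteq> W} * ?Q"
    using exists_subspace_in_many[OF E(1) V zero, of "k - 1" k] k WE by auto
  define E0 where "E0 = {W \<in> E. V0 \<subseteq> W}"
  have fin0: "finite V0" using V0(3) V(1) by (rule finite_subset)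
  have E0: "15 / 16 * M \<le> card E0"
  proof -
    have "15 / 16 \<le> (1 - 1 / real q^2)^(k - 1)"
      by (rule large_q_power_bound[of n]) (use q k in linarith)+
    then have "card E * (15 / 16) \<le> card E * (1 - 1 / real q^2)^(k - 1)" by (intro mult_left_mono) auto
    also have "\<dots> \<le> card E0 * ?Q" using V0(5) by (simp add: E0_def)
    finally have "15 / 16 * M * ?Q \<le> card E0 * ?Q" using cE by simp
    then show ?thesis using Q0 by (simp only: mult_le_cancel_right_pos)
  qed
  have cK: "card K \<le> card (coset V0 ` K) * X^(k - 1)"
    by (rule card_le_projection_times[OF finK V(1) X X1 _ sep V0(1,3)]) (use E V0 in auto)
  obtain v B0 B where P: "subspace_pencil scale q E0 v B0 B" "span B0 = V0"
  proof (rule exists_subspace_pencil[OF V0(1) fin0, of E0])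
    show "finite E0" using E(1) by (simp add: E0_def)
    show "subspace W \<and> V0 \<subseteq> W \<and> card W = q * card V0" if "W \<in> E0" for W
      using that E(2)[of W] V0(4) k by (cases k) (auto simp: E0_def)
  qed (use that in blast)
  interpret P: subspace_pencil scale q E0 v B0 B by (rule P(1))
  let ?S = "B - B0"
  have finS: "finite ?S" using P.B by simp
  \<comment> \<open>All members of \<open>E0\<close> lie in the span of \<open>B\<close>, which has
    room for fewer than \<open>q^s / (q - 1)\<close> of them, \<open>s\<close> being the size of
    \<open>?S\<close>. Since \<open>15/8 * (q - 1) \<ge> q\<close> for \<open>q \<ge> 8\<close>,
    this forces \<open>q^s > q^d\<close>.\<close>
  have card_S: "d + 1 \<le> card ?S"
  proof -
    have "W \<subseteq> span (B0 \<union> ?S)" if "W \<in> E0" for W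
    proof -
      have "B0 \<union> ?S = B" using P.B by blast
      moreover have "span (insert (v W) B0) \<subseteq> span B"
        using P.v_mem(1)[OF that] P.B span_superset[of B] by (intro span_minimal) auto
      ultimately show ?thesis using P.span_v[OF that] by simp
    qed
    then have "{W \<in> E0. W \<subseteq> span (B0 \<union> ?S)} = E0" by blast
    then have "card E0 * (q - 1) < q^card ?S" using P.card_pencil_members_in_span[of ?S] by simp
    then have "real (card E0 * (q - 1)) < real (q^card ?S)" by (rule of_nat_less_iff[THEN iffD2])
    then have 1: "card E0 * (real q - 1) < real q^card ?S" using q(1) by (simp add: of_nat_diff)
    have "real q^d = real q * real q^(d - 1)" using d by (cases d) auto
    also have "\<dots> \<le> (15 / 8 * (real q - 1)) * real q^(d - 1)" using q1 by (intro mult_right_mono) auto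
    also have "\<dots> = 15 / 16 * (2 * real q^(d - 1)) * (real q - 1)" by simp
    also have "\<dots> \<le> 15 / 16 * M * (real q - 1)" using M_ge q1 by (intro mult_right_mono mult_left_mono) auto
    also have "\<dots> \<le> card E0 * (real q - 1)" using E0 q1 by (intro mult_right_mono) auto
    finally have "real q^d < real q^card ?S" using 1 by linarith
    then have "d < card ?S" using q1(2) by (rule power_less_imp_less_exp[rotated])
    then show ?thesis by simp
  qed
  obtain K1 where K1: "K1 \<subseteq> K" "inj_on (coset V0) K1" "coset V0 ` K1 = coset V0 ` K"
    using exists_representatives[of K "coset V0"] by blast
  have fin1: "finite K1" using K1(1) finK by (rule finite_subset)
  have ne1: "K1 \<noteq> {}" using K1(3) K(2) by blast
  have c1: "card K1 = card (coset V0 ` K)" using K1 card_image by metis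
  have prune: "\<exists>(r::real) K2. r > 0 \<and> K2 \<subseteq> K1 \<and> K2 \<noteq> {} \<and> card K1 = 2 * real i * X * r
      \<and> card K \<le> 2 * (real n + 2) * r * real X^k
      \<and> (\<forall>e\<in>I. \<forall>x\<in>K2. r \<le> card {y \<in> K2. y - x \<in> span (insert e B0)})"
    if I: "I \<subseteq> ?S" "card I = i" "0 < i" "i \<le> n + 2" for I i
  proof -
    \<comment> \<open>The factor \<open>2\<close> makes the inequality
      \<open>card I * X * r < card K1\<close> strict, so that thinning leaves a nonempty
      set.\<close>
    define r where "r = card K1 / (2 * real i * X)"
    have N0: "real (card K1) > 0" using fin1 ne1 by (simp add: card_gt_0_iff)
    have r0: "r > 0" using N0 I X1 by (simp add: r_def)
    have N1: "card K1 = 2 * real i * X * r" using I X1 by (simp add: r_def)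
    have fI: "finite I" using I(1) finS by (rule finite_subset)
    have XI: "card (coset (span (insert e B0)) ` K1) \<le> X" if "e \<in> I" for e
    proof -
      have W: "span (insert e B0) \<in> E" using P.basis_direction[of e] that I(1) by (auto simp: E0_def)
      have "card (coset (span (insert e B0)) ` K1) \<le> card (coset (span (insert e B0)) ` K)"
        using finK K1(1) by (intro card_mono) auto
      then show ?thesis using X[OF W] by linarith
    qed
    have lt: "card I * X * r < card K1" using N1 I(2) N0 by simp
    obtain K2 where K2: "K2 \<subseteq> K1" "K2 \<noteq> {}"
      "\<And>e x. e \<in> I \<Longrightarrow> x \<in> K2 \<Longrightarrow> r \<le> card {y \<in> K2. coset (span (insert e B0)) y = coset (span (insert e B0)) x}"
    proof (rule exists_subset_with_long_fibres[OF fin1 fI, where c = "\<lambda>e. coset (span (insert e B0))" and r = r])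
      show "card (coset (span (insert e B0)) ` K1) \<le> X" if "e \<in> I" for e by (rule XI[OF that])
    qed (use r0 lt that in blast)+
    have "real (card K) \<le> real (card K1 * X^(k - 1))" unfolding c1 by (rule of_nat_mono[OF cK])
    also have "\<dots> = 2 * real i * r * (real X * real X^(k - 1))" using N1 by simp
    also have "real X * real X^(k - 1) = real X^k" using k by (cases k) auto
    also have "2 * real i * r * real X^k \<le> 2 * (real n + 2) * r * real X^k"
      using I r0 by (intro mult_right_mono mult_left_mono) auto
    finally show ?thesis using K2 r0 N1 unfolding coset_eq_iff[OF subspace_span] by blast
  qed
  have result: "\<exists>r::real. r > 0 \<and> card K \<le> 2 * (real n + 2) * r * real X^k \<and>
      (r^(d + 1) \<le> 2 * (real n + 2) * real X \<or>
        r^d \<le> real X \<and> r^(d + 1) \<le> card K \<and>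
        (let T = real X / r^d; G = 2^1032 * (2 * T^4)^576
         in M \<le> 4 * G^d \<or> r * T \<le> G + 1 \<or> q \<le> G * (r * T)))"
  proof (cases "d + 2 \<le> card ?S")
    case True
    obtain I where I: "I \<subseteq> ?S" "card I = d + 2"
      by (rule obtain_subset_with_card_n[OF True]) (rule that)
    have i: "0 < d + 2" "d + 2 \<le> n + 2" using d_le by auto
    obtain r :: real and K2 where r: "r > 0" "K2 \<subseteq> K1" "K2 \<noteq> {}" "card K1 = 2 * real (d + 2) * X * r"
      "card K \<le> 2 * (real n + 2) * r * real X^k"
      "\<forall>e\<in>I. \<forall>x\<in>K2. r \<le> card {y \<in> K2. y - x \<in> span (insert e B0)}"
      using prune[OF I i] by (elim exE conjE) (rule that)
    obtain x where x: "x \<in> K2" using r(3) by blast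
    have fin2: "finite K2" using r(2) fin1 by (rule finite_subset)
    have "r^card I \<le> card {y \<in> K2. y - x \<in> span (B0 \<union> I)}"
    proof (rule fibre_growth[OF P.B(1,2) _ I(1) fin2 _ r(1) r(6)[rule_format] x])
      show "finite I" using I(1) finS by (rule finite_subset)
      show "inj_on (coset (span B0)) K2" using K1(2) r(2) P(2) inj_on_subset by metis
    qed
    also have "\<dots> \<le> card K1" using fin1 r(2) by (intro of_nat_mono card_mono) auto
    \<comment> \<open>Fibre growth in \<open>d + 2\<close> directions gives
      \<open>r^(d + 2) \<le> card K1\<close>, and \<open>card K1\<close> is itself a multiple of
      \<open>X * r\<close>, so one factor \<open>r\<close> cancels.\<close>
    finally have "r^(d + 1) * r \<le> (2 * real (d + 2) * X) * r" using I(2) r(4) by (simp add: mult_ac)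
    then have "r^(d + 1) \<le> 2 * real (d + 2) * X" using r(1) by (simp only: mult_le_cancel_right_pos)
    also have "\<dots> \<le> 2 * (real n + 2) * X" using d_le by (intro mult_right_mono) auto
    finally show ?thesis using r by blast
  next
    case False
    then have cS: "card ?S = d + 1" using card_S by simp
    have i: "0 < d + 1" "d + 1 \<le> n + 2" using d_le by auto
    obtain r :: real and K2 where r: "r > 0" "K2 \<subseteq> K1" "K2 \<noteq> {}"
      "card K \<le> 2 * (real n + 2) * r * real X^k"
      "\<forall>e\<in>?S. \<forall>x\<in>K2. r \<le> card {y \<in> K2. y - x \<in> span (insert e B0)}"
      using prune[OF subset_refl cS i] by (elim exE conjE) (rule that)
    have fin2: "finite K2" using r(2) fin1 by (rule finite_subset)
    have sub2: "K2 \<subseteq> K" using r(2) K1(1) by blast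
    interpret F: fibred_pencil scale q E0 v B0 B K2 r "real X" d
    proof unfold_locales
      show "inj_on (coset (span B0)) K2" using K1(2) r(2) P(2) inj_on_subset by metis
      show "real (card (coset W ` K2)) \<le> real X" if "W \<in> E0" for W
      proof -
        have "card (coset W ` K2) \<le> card (coset W ` K)" using finK sub2 by (intro card_mono) auto
        also have "\<dots> \<le> X" using that X by (simp add: E0_def)
        finally show ?thesis by simp
      qed
    qed (use r fin2 cS d in auto)
    obtain e where e: "e \<in> ?S" using cS by (metis card.empty ex_in_conv add_is_0 zero_neq_one)
    let ?E = "{W \<in> E0. \<not> W \<subseteq> span (B - {e})}" and ?E' = "{W \<in> E0. W \<subseteq> span (B - {e})}"
    \<comment> \<open>Members inside \<open>span (B - {e})\<close> have no slope relative to
      \<open>e\<close>. They number fewer than \<open>8/7 * q^(d - 1) \<le> 4/7 * M\<close>, and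
      \<open>15/16 - 4/7\<close> is more than a quarter.\<close>
    have "M / 4 \<le> card ?E"
    proof -
      let ?J = "?S - {e}"
      have J: "B0 \<union> ?J = B - {e}" "card ?J = d" using e P.B cS by auto
      have "card ?E' * (q - 1) < q^d" using P.card_pencil_members_in_span[of ?J] unfolding J by blast
      then have "real (card ?E' * (q - 1)) < real (q^d)" by (rule of_nat_less_iff[THEN iffD2])
      then have 1: "card ?E' * (real q - 1) < real q^d" using q(1) by (simp add: of_nat_diff)
      have "real q^d = real q * real q^(d - 1)" using d by (cases d) auto
      also have "\<dots> \<le> (8 / 7 * (real q - 1)) * real q^(d - 1)" using q1 by (intro mult_right_mono) auto
      also have "\<dots> = (8 / 7 * real q^(d - 1)) * (real q - 1)" by simp
      finally have "card ?E' * (real q - 1) < (8 / 7 * real q^(d - 1)) * (real q - 1)" using 1 by linarith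
      then have bad: "card ?E' < 8 / 7 * real q^(d - 1)" using q1 by simp
      have "finite E0" using E(1) by (simp add: E0_def)
      then have "card E0 \<le> card (?E \<union> ?E')" by (intro card_mono) auto
      also have "\<dots> \<le> card ?E + card ?E'" by (rule card_Un_le)
      finally have "real (card E0) \<le> card ?E + real (card ?E')" by linarith
      then show ?thesis using bad M_ge E0 by linarith
    qed
    then have "M \<le> 4 * (2^1032 * (2 * (X / r^d)^4)^576)^d" if "card ?E \<le> (2^1032 * (2 * (X / r^d)^4)^576)^d"
      using that by linarith
    then have "let T = real X / r^d; G = 2^1032 * (2 * T^4)^576
         in M \<le> 4 * G^d \<or> r * T \<le> G + 1 \<or> q \<le> G * (r * T)"
      using F.card_pencil_dichotomy[OF e] unfolding Let_def by blast
    moreover have "r^(d + 1) \<le> card K"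
    proof -
      have "card K2 \<le> card K" using finK sub2 by (rule card_mono)
      then show ?thesis using F.power_le_card by linarith
    qed
    ultimately show ?thesis using F.power_le_projection r(1,4) by blast
  qed
  have "d \<le> n" using d_le by simp
  then show ?thesis using result M_lt by blast
qed

end

section \<open>Transfer to coordinate spaces\<close>

lemma (in vectorspace) card_carrier_eq_power_dim:
  assumes fin: "finite (carrier V)"
  shows "card (carrier V) = card (carrier K)^dim"
proof -
  have "span (carrier V) = carrier V"
    using span_is_subset2[of "carrier V"] in_own_span[of "carrier V"] by auto
  then have fin_dim using fin by (auto simp: fin_dim_def)
  then obtain A where A: "finite A" "basis A" using finite_basis_exists by blast
  have AV: "A \<subseteq> carrier V" using A(2) by (simp add: basis_def)
  have crit: "\<exists>!a. a \<in> A \<rightarrow>\<^sub>E carrier K \<and> lincomb a A = u" if "u \<in> carrier V" for u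
    using basis_criterion[OF A(1) AV] A(2) that by blast
  have closed: "lincomb a A \<in> carrier V" if "a \<in> A \<rightarrow>\<^sub>E carrier K" for a
    using that AV by (intro lincomb_closed) auto
  have "bij_betw (\<lambda>a. lincomb a A) (A \<rightarrow>\<^sub>E carrier K) (carrier V)"
    unfolding bij_betw_def
  proof
    show "inj_on (\<lambda>a. lincomb a A) (A \<rightarrow>\<^sub>E carrier K)"
    proof (rule inj_onI)
      fix a b assume "a \<in> A \<rightarrow>\<^sub>E carrier K" "b \<in> A \<rightarrow>\<^sub>E carrier K" "lincomb a A = lincomb b A"
      then show "a = b" using crit[OF closed[of b]] by blast
    qed
    show "(\<lambda>a. lincomb a A) ` (A \<rightarrow>\<^sub>E carrier K) = carrier V"
      using crit closed by blast
  qed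
  then have "card (carrier V) = card (A \<rightarrow>\<^sub>E carrier K)" by (simp add: bij_betw_same_card)
  also have "\<dots> = card (carrier K)^card A" using A(1) by (simp add: card_PiE)
  finally show ?thesis using dim_basis[OF A] by simp
qed

lemma residues_prime_Fp: "prime p \<Longrightarrow> residues_prime p"
  by (simp add: residues_prime_def)

lemma vectorspace_Fpn:
  assumes "prime p"
  shows "vectorspace (Fp p) (Fpn p n)"
proof -
  interpret residues_prime p "Fp p" using assms by (rule residues_prime_Fp)
  show ?thesis
    unfolding vectorspace_def Fpn_def using is_field func_space_is_module by blast
qed

lemma Fpn_simps:
  assumes "prime p"
  shows "carrier (Fpn p n) = {..<n} \<rightarrow>\<^sub>E {0..<int p}"
    and "x \<oplus>\<^bsub>Fpn p n\<^esub> y = restrict (\<lambda>i. (x i + y i) mod int p) {..<n}"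
    and "c \<odot>\<^bsub>Fpn p n\<^esub> x = restrict (\<lambda>i. (c * x i) mod int p) {..<n}"
    and "\<zero>\<^bsub>Fpn p n\<^esub> = restrict (\<lambda>i. 0) {..<n}"
proof -
  interpret residues_prime p "Fp p" using assms by (rule residues_prime_Fp)
  have "{0..int p - 1} = {0..<int p}" by auto
  then show "carrier (Fpn p n) = {..<n} \<rightarrow>\<^sub>E {0..<int p}"
    by (simp add: Fpn_def ring.func_space_def[OF ring_axioms] res_carrier_eq)
  show "x \<oplus>\<^bsub>Fpn p n\<^esub> y = restrict (\<lambda>i. (x i + y i) mod int p) {..<n}"
    and "c \<odot>\<^bsub>Fpn p n\<^esub> x = restrict (\<lambda>i. (c * x i) mod int p) {..<n}"
    and "\<zero>\<^bsub>Fpn p n\<^esub> = restrict (\<lambda>i. 0) {..<n}"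
    by (simp_all add: Fpn_def ring.func_space_def[OF ring_axioms] res_add_eq res_mult_eq res_zero_eq)
qed

lemma Gr_submodule: "W \<in> Gr p n k \<Longrightarrow> submodule (Fp p) W (Fpn p n)"
  by (simp add: Gr_def subspace_def)

lemma card_Gr_member:
  assumes p: "prime p" and W: "W \<in> Gr p n k"
  shows "card W = p^k"
proof -
  interpret residues_prime p "Fp p" using p by (rule residues_prime_Fp)
  interpret V: vectorspace "Fp p" "Fpn p n" by (rule vectorspace_Fpn[OF p])
  have W': "subspace (Fp p) W (Fpn p n)" "vectorspace.dim (Fp p) ((Fpn p n)\<lparr>carrier := W\<rparr>) = k"
    using W by (simp_all add: Gr_def)
  interpret W: vectorspace "Fp p" "(Fpn p n)\<lparr>carrier := W\<rparr>" by (rule V.subspace_is_vs[OF W'(1)])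
  have "W \<subseteq> carrier (Fpn p n)" using Gr_submodule[OF W] by (rule submodule.subset)
  moreover have "finite (carrier (Fpn p n))" by (simp add: Fpn_simps[OF p] finite_PiE)
  ultimately have "finite W" by (rule finite_subset)
  then have "card W = card (carrier (Fp p))^k" using W.card_carrier_eq_power_dim W'(2) by simp
  also have "card (carrier (Fp p)) = p" by (simp add: res_carrier_eq)
  finally show ?thesis .
qed

interpretation function_space: prime_field_space
  "\<lambda>(c::'q::prime_card mod_ring) (x::nat \<Rightarrow> 'q mod_ring) i. c * x i" "CARD('q)"
proof unfold_locales
  fix x :: "'q mod_ring"
  show "\<exists>j. x = of_nat j" using surj_of_nat_mod_ring[of x] by blast
qed (auto simp: fun_eq_iff algebra_simps)

text \<open>Vectors of \<open>Fpn p n\<close> are \<open>undefined\<close> beyond \<open>n\<close>;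
  replacing that by \<open>0\<close> makes the map additive for pointwise addition of
  functions.\<close>

definition embed :: "nat \<Rightarrow> (nat \<Rightarrow> int) \<Rightarrow> nat \<Rightarrow> 'q::prime_card mod_ring"
  where "embed n x = (\<lambda>i. if i < n then of_int (x i) else 0)"

lemma of_int_mod_CARD: "of_int (a mod int CARD('q)) = (of_int a :: 'q::prime_card mod_ring)"
proof -
  have "(of_int a :: 'q mod_ring) = of_int (int CARD('q) * (a div int CARD('q)) + a mod int CARD('q))"
    by simp
  also have "\<dots> = of_nat CARD('q) * of_int (a div int CARD('q)) + of_int (a mod int CARD('q))"
    by (simp only: of_int_add of_int_mult of_int_of_nat_eq)
  finally show ?thesis by (simp only: of_nat_card_eq_0 mult_zero_left add_0)
qed

context
  fixes n p :: nat
  assumes p: "p = CARD('q::prime_card)"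
begin

lemma prime_p: "prime p"
  using prime_card[where 'a = 'q] p by simp

lemma embed_add: "(embed n (x \<oplus>\<^bsub>Fpn p n\<^esub> y) :: nat \<Rightarrow> 'q mod_ring) = embed n x + embed n y"
  unfolding embed_def Fpn_simps[OF prime_p] by (simp add: fun_eq_iff p of_int_mod_CARD)

lemma embed_smult: "(embed n (c \<odot>\<^bsub>Fpn p n\<^esub> x) :: nat \<Rightarrow> 'q mod_ring) = (\<lambda>i. of_int c * embed n x i)"
  unfolding embed_def Fpn_simps[OF prime_p] by (simp add: fun_eq_iff p of_int_mod_CARD)

lemma inj_on_embed: "inj_on (embed n :: _ \<Rightarrow> nat \<Rightarrow> 'q mod_ring) (carrier (Fpn p n))"
proof (rule inj_onI)
  fix x y assume x: "x \<in> carrier (Fpn p n)" and y: "y \<in> carrier (Fpn p n)"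
    and eq: "(embed n x :: nat \<Rightarrow> 'q mod_ring) = embed n y"
  have mem: "x \<in> {..<n} \<rightarrow>\<^sub>E {0..<int p}" "y \<in> {..<n} \<rightarrow>\<^sub>E {0..<int p}"
    using x y unfolding Fpn_simps(1)[OF prime_p] by blast+
  have inv: "to_int_mod_ring (of_int a :: 'q mod_ring) = a" if "a \<in> {0..<int p}" for a
    unfolding of_int_of_int_mod_ring
    by (rule to_int_mod_ring_of_int_mod_ring) (use that p in auto)
  show "x = y"
  proof (rule PiE_ext[OF mem])
    fix i assume i: "i \<in> {..<n}"
    have "(of_int (x i) :: 'q mod_ring) = of_int (y i)"
      using fun_cong[OF eq, of i] i unfolding embed_def by (simp only: lessThan_iff if_True)
    then show "x i = y i" using inv[OF PiE_mem[OF mem(1) i]] inv[OF PiE_mem[OF mem(2) i]] by metis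
  qed
qed

lemma subspace_embed_image:
  assumes W: "submodule (Fp p) W (Fpn p n)"
  shows "function_space.subspace ((embed n :: _ \<Rightarrow> nat \<Rightarrow> 'q mod_ring) ` W)"
proof (rule function_space.subspaceI)
  have "(embed n \<zero>\<^bsub>Fpn p n\<^esub> :: nat \<Rightarrow> 'q mod_ring) = 0"
    by (simp add: embed_def Fpn_simps[OF prime_p] fun_eq_iff)
  then show "0 \<in> (embed n :: _ \<Rightarrow> nat \<Rightarrow> 'q mod_ring) ` W"
    using submodule.zero_closed[OF W] by (metis imageI)
next
  fix x y assume "x \<in> (embed n :: _ \<Rightarrow> nat \<Rightarrow> 'q mod_ring) ` W" "y \<in> (embed n :: _ \<Rightarrow> nat \<Rightarrow> 'q mod_ring) ` W"
  then show "x + y \<in> (embed n :: _ \<Rightarrow> nat \<Rightarrow> 'q mod_ring) ` W"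
    using submodule.m_closed[OF W] by (auto simp flip: embed_add)
next
  fix c :: "'q mod_ring" and x assume x: "x \<in> (embed n :: _ \<Rightarrow> nat \<Rightarrow> 'q mod_ring) ` W"
  obtain j where j: "j < CARD('q)" "c = of_nat j" using surj_of_nat_mod_ring[of c] by blast
  interpret residues_prime p "Fp p" using prime_p by (rule residues_prime_Fp)
  have "int j \<in> {0..int p - 1}" using j(1) p by simp
  then have "int j \<in> carrier (Fp p)" by (simp only: res_carrier_eq)
  moreover have "(\<lambda>i. c * embed n w i) = embed n (int j \<odot>\<^bsub>Fpn p n\<^esub> w)" for w
    by (simp add: embed_smult j(2))
  ultimately show "(\<lambda>i. c * x i) \<in> (embed n :: _ \<Rightarrow> nat \<Rightarrow> 'q mod_ring) ` W"
    using x submodule.smult_closed[OF W] by auto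
qed

lemma card_quot_proj:
  assumes W: "submodule (Fp p) W (Fpn p n)" and K: "K \<subseteq> carrier (Fpn p n)"
  shows "card (quot_proj p n W ` K)
    = card (function_space.coset ((embed n :: _ \<Rightarrow> nat \<Rightarrow> 'q mod_ring) ` W) ` embed n ` K)"
proof -
  interpret M: module "Fp p" "Fpn p n" using vectorspace_Fpn[OF prime_p] by (simp add: vectorspace_def)
  let ?\<phi> = "embed n :: _ \<Rightarrow> nat \<Rightarrow> 'q mod_ring"
  have WC: "W \<subseteq> carrier (Fpn p n)" using W by (rule submodule.subset)
  have eq: "?\<phi> ` quot_proj p n W x = function_space.coset (?\<phi> ` W) (?\<phi> x)" for x
    by (auto simp: quot_proj_def a_r_coset_def' function_space.coset_def embed_add add.commute image_iff)
  have "\<Union> (quot_proj p n W ` K) \<subseteq> carrier (Fpn p n)"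
    using WC K M.a_closed by (fastforce simp: quot_proj_def a_r_coset_def')
  then have "inj_on ((`) ?\<phi>) (quot_proj p n W ` K)"
    by (intro inj_on_image inj_on_subset[OF inj_on_embed])
  then have "card (quot_proj p n W ` K) = card ((`) ?\<phi> ` quot_proj p n W ` K)"
    by (simp add: card_image)
  then show ?thesis by (simp add: image_image eq)
qed

end

section \<open>From types of prime cardinality to prime numbers\<close>

text \<open>All data other than the number \<open>p\<close> are quantified inside, so the statement
  mentions no type of field elements and its failure at a prime can be used to define such a
  type.\<close>

definition projection_bound :: "nat \<Rightarrow> bool"
  where "projection_bound p \<longleftrightarrow> (\<forall>n k d X (E::(nat \<Rightarrow> int) set set) K.
    1 \<le> k \<longrightarrow> k < n \<longrightarrow> 1 \<le> d \<longrightarrow> 8 \<le> p \<longrightarrow> 4 * n \<le> p \<longrightarrow> E \<subseteq> Gr p n k \<longrightarrow>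
    K \<subseteq> carrier (Fpn p n) \<longrightarrow> K \<noteq> {} \<longrightarrow>
    2 * real p^((n - k) * (k - 1) + d - 1) \<le> card E \<longrightarrow>
    (\<forall>W\<in>E. card (quot_proj p n W ` K) \<le> X) \<longrightarrow>
    (let M = card E / real p^((n - k) * (k - 1)) in
     d \<le> n \<and> M < 2 * real p^(n - k) \<and>
     (\<exists>r::real. r > 0 \<and> card K \<le> 2 * (real n + 2) * r * real X^k \<and>
       (r^(d + 1) \<le> 2 * (real n + 2) * real X \<or>
         r^d \<le> real X \<and> r^(d + 1) \<le> card K \<and>
         (let T = real X / r^d; G = 2^1032 * (2 * T^4)^576
          in M \<le> 4 * G^d \<or> r * T \<le> G + 1 \<or> p \<le> G * (r * T))))))"

lemma projection_bound_CARD: "projection_bound CARD('q::prime_card)"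
  unfolding projection_bound_def
proof (intro allI impI)
  fix n k d X :: nat and E :: "(nat \<Rightarrow> int) set set" and K :: "(nat \<Rightarrow> int) set"
  let ?p = "CARD('q)"
  let ?\<phi> = "embed n :: _ \<Rightarrow> nat \<Rightarrow> 'q mod_ring" and ?C = "carrier (Fpn ?p n)"
  assume hyp: "1 \<le> k" "k < n" "1 \<le> d" "8 \<le> ?p" "4 * n \<le> ?p" and E: "E \<subseteq> Gr ?p n k"
    and K: "K \<subseteq> ?C" "K \<noteq> {}"
    and large: "2 * real ?p^((n - k) * (k - 1) + d - 1) \<le> card E"
    and X: "\<forall>W\<in>E. card (quot_proj ?p n W ` K) \<le> X"
  note p = refl[of ?p]
  have prime: "prime ?p" by (rule prime_p[OF p])
  have finC: "finite ?C" by (simp add: Fpn_simps[OF prime] finite_PiE)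
  have subC: "submodule (Fp ?p) ?C (Fpn ?p n)"
  proof -
    interpret M: module "Fp ?p" "Fpn ?p n" using vectorspace_Fpn[OF prime] by (simp add: vectorspace_def)
    show ?thesis by unfold_locales auto
  qed
  have sub: "submodule (Fp ?p) W (Fpn ?p n)" "W \<subseteq> ?C" "card W = ?p^k" if "W \<in> E" for W
  proof -
    have W: "W \<in> Gr ?p n k" using that E by blast
    show "submodule (Fp ?p) W (Fpn ?p n)" using W by (rule Gr_submodule)
    then show "W \<subseteq> ?C" by (rule submodule.subset)
    show "card W = ?p^k" using prime W by (rule card_Gr_member)
  qed
  have inj: "inj_on ?\<phi> ?C" by (rule inj_on_embed[OF p])
  have inj2: "inj_on ((`) ?\<phi>) E" using sub(2) inj by (intro inj_on_image inj_on_subset[OF inj]) auto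
  have cE: "card ((`) ?\<phi> ` E) = card E" using inj2 by (rule card_image)
  have cK: "card (?\<phi> ` K) = card K" using inj_on_subset[OF inj K(1)] by (rule card_image)
  have finE: "finite E" using sub(2) finC by (intro finite_subset[of E "Pow ?C"]) auto
  have cV: "card (?\<phi> ` ?C) = ?p^n"
    using card_image[OF inj] by (simp add: Fpn_simps[OF prime] card_PiE)
  have members: "function_space.subspace W' \<and> W' \<subseteq> ?\<phi> ` ?C \<and> card W' = ?p^k"
    if W': "W' \<in> (`) ?\<phi> ` E" for W'
  proof -
    obtain W where W: "W \<in> E" "W' = ?\<phi> ` W" using W' by blast
    have "card W' = ?p^k"
      unfolding W(2) using card_image[OF inj_on_subset[OF inj sub(2)[OF W(1)]]] sub(3)[OF W(1)] by (rule trans)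
    moreover have "W' \<subseteq> ?\<phi> ` ?C" unfolding W(2) using sub(2)[OF W(1)] by (rule image_mono)
    moreover have "function_space.subspace W'" unfolding W(2) by (rule subspace_embed_image[OF p sub(1)[OF W(1)]])
    ultimately show ?thesis by blast
  qed
  have projections: "card (function_space.coset W' ` ?\<phi> ` K) \<le> X" if W': "W' \<in> (`) ?\<phi> ` E" for W'
  proof -
    obtain W where W: "W \<in> E" "W' = ?\<phi> ` W" using W' by blast
    show ?thesis
      unfolding W(2) card_quot_proj[OF p sub(1)[OF W(1)] K(1), symmetric] using X W(1) by blast
  qed
  have "finite (?\<phi> ` ?C)" "finite ((`) ?\<phi> ` E)" "?\<phi> ` K \<subseteq> ?\<phi> ` ?C" "?\<phi> ` K \<noteq> {}"
    using finC finE K by auto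
  note dich = function_space.projection_dichotomy[OF this(1) subspace_embed_image[OF p subC] cV hyp
      this(2) members large[folded cE] this(3,4) projections]
  show "let M = card E / real ?p^((n - k) * (k - 1)) in
     d \<le> n \<and> M < 2 * real ?p^(n - k) \<and>
     (\<exists>r::real. r > 0 \<and> card K \<le> 2 * (real n + 2) * r * real X^k \<and>
       (r^(d + 1) \<le> 2 * (real n + 2) * real X \<or>
         r^d \<le> real X \<and> r^(d + 1) \<le> card K \<and>
         (let T = real X / r^d; G = 2^1032 * (2 * T^4)^576
          in M \<le> 4 * G^d \<or> r * T \<le> G + 1 \<or> ?p \<le> G * (r * T))))"
    using dich unfolding cE cK Let_def .
qed

text \<open>The default value \<open>2\<close> keeps this number prime, and the type built from it
  nonempty, when no prime violates the bound.\<close>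

definition exceptional_prime :: nat
  where "exceptional_prime = (if \<exists>p. prime p \<and> \<not> projection_bound p
    then SOME p. prime p \<and> \<not> projection_bound p else 2)"

lemma prime_exceptional_prime: "prime exceptional_prime"
proof (cases "\<exists>p. prime p \<and> \<not> projection_bound p")
  case True
  then have "prime (SOME p. prime p \<and> \<not> projection_bound p) \<and>
      \<not> projection_bound (SOME p. prime p \<and> \<not> projection_bound p)" by (rule someI_ex)
  then show ?thesis unfolding exceptional_prime_def if_P[OF True] by blast
next
  case False
  then show ?thesis unfolding exceptional_prime_def if_not_P[OF False] by simp
qed

text \<open>The geometric argument is carried out over a type of prime cardinality, and no type can depend on
  the term \<open>p\<close>. So one fixes a type whose cardinality is a prime violating the bound, if any.\<close>

typedef exceptional = "{0..<exceptional_prime}"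
  using prime_gt_0_nat[OF prime_exceptional_prime] by (intro exI[of _ 0]) simp

lemma CARD_exceptional: "CARD(exceptional) = exceptional_prime"
  using type_definition.card[OF type_definition_exceptional] by simp

instance exceptional :: prime_card
  by intro_classes (simp add: CARD_exceptional prime_exceptional_prime)

theorem projection_bound_prime:
  assumes "prime p"
  shows "projection_bound p"
proof (rule ccontr)
  assume "\<not> projection_bound p"
  then have ex: "\<exists>p. prime p \<and> \<not> projection_bound p" using assms by blast
  then have "\<not> projection_bound (SOME p. prime p \<and> \<not> projection_bound p)" by (metis (mono_tags, lifting) someI_ex)
  then have "\<not> projection_bound exceptional_prime" unfolding exceptional_prime_def if_P[OF ex] .
  then show False using projection_bound_CARD[where 'q = exceptional] by (simp add: CARD_exceptional)
qed

section \<open>The lower bound\<close>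

lemma powr_inverse_le:
  fixes Y D T :: real
  assumes "0 \<le> Y" "1 \<le> D" "0 < T" "Y \<le> D * T^e" "0 < e"
  shows "Y powr (1 / real e) \<le> D * T"
proof -
  have "Y powr (1 / real e) \<le> (D * T^e) powr (1 / real e)" using assms by (intro powr_mono2) auto
  also have "\<dots> = D powr (1 / real e) * (T^e) powr (1 / real e)" using assms by (simp add: powr_mult)
  also have "(T^e) powr (1 / real e) = T"
    using assms by (simp add: powr_realpow[symmetric] powr_powr)
  also have "D powr (1 / real e) * T \<le> D * T"
  proof (rule mult_right_mono)
    have "D powr (1 / real e) \<le> D powr 1" using assms by (intro powr_mono) auto
    then show "D powr (1 / real e) \<le> D" using assms by simp
  qed (use assms in simp)
  finally show ?thesis .
qed

text \<open>Every alternative yields, beyond the required power of \<open>N\<close>, a positive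
  power of \<open>N\<close> or of \<open>T\<close>, into which \<open>M powr \<epsilon>\<close> is
  absorbed. The number \<open>L\<close> bounds both \<open>1 + d * k\<close> and
  \<open>1 + (d + 1) * k\<close> for all admissible \<open>d\<close> and \<open>k\<close>, so a
  single \<epsilon> works for all of them.\<close>

lemma dichotomy_lower_bound:
  fixes A C N M X r \<delta> \<epsilon> p T :: real and n k d b L :: nat
  assumes k: "k \<le> n" and d: "1 \<le> d" "d \<le> n"
    and A: "1 \<le> A" and C: "1 \<le> C" and b: "1 \<le> b" and L: "L = 1 + n + n^2" and p: "2 \<le> p" and \<delta>: "0 < \<delta>"
    and \<epsilon>: "0 < \<epsilon>" "\<epsilon> * (real (b + 1) * real (n + 1)^2 * real L^2) \<le> min 1 \<delta>"
    and N: "p powr \<delta> \<le> N" "N \<le> p powr (real d + 1 - \<delta>)" and M: "1 \<le> M" "M \<le> 2 * p^n"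
    and X: "1 \<le> X" and r: "0 < r" and NX: "N \<le> C * r * X^k"
    and T: "T = X / r^d"
    and dich: "r^(d + 1) \<le> C * X \<or> r^d \<le> X \<and> r^(d + 1) \<le> N \<and>
      (M \<le> 4 * (A * T^b)^d \<or> r * T \<le> A * T^b + 1 \<or> p \<le> A * T^b * (r * T))"
  shows "N powr (real d / (1 + real d * real k)) * M powr \<epsilon> \<le> C^(n + 2) * (4 * C * (2 * A)^L) * X"
proof -
  let ?Z = "real (b + 1) * real (n + 1)^2 * real L^2"
  let ?e0 = "1 + d * k" and ?e1 = "1 + (d + 1) * k"
  let ?\<alpha> = "real d / real ?e0"
  have \<epsilon>Z: "\<epsilon> * ?Z \<le> 1" "\<epsilon> * ?Z \<le> \<delta>" using \<epsilon>(2) by linarith+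
  have L0: "0 < L" by (simp add: L)
  have dk: "d * k \<le> n * n" using d k by (intro mult_le_mono) auto
  have e: "?e0 \<le> L" "?e1 \<le> L" using dk k by (simp_all add: L power2_eq_square)
  have N1: "1 \<le> N"
  proof -
    have "1 \<le> p powr \<delta>" using p \<delta> by (intro ge_one_powr_ge_zero) auto
    then show ?thesis using N by linarith
  qed
  have Mp: "M powr \<epsilon> \<le> p powr \<eta>" if "real (n + 1) * \<epsilon> \<le> \<eta>" for \<eta>
  proof -
    have "2 * p^n \<le> p * p^n" using p by (intro mult_right_mono) auto
    then have "M \<le> p * p^n" using M(2) by linarith
    then have "M \<le> p powr real (n + 1)" using p by (simp add: powr_realpow[symmetric] powr_add)
    then have "M powr \<epsilon> \<le> (p powr real (n + 1)) powr \<epsilon>" using M \<epsilon> by (intro powr_mono2) auto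
    also have "\<dots> \<le> p powr \<eta>" using that p by (simp add: powr_powr powr_mono del: of_nat_add)
    finally show ?thesis .
  qed
  have small: "real (n + 1) * \<epsilon> \<le> \<delta> / w" if w: "0 < w" "w \<le> real (b + 1) * real (n + 1) * real L^2" for w
  proof -
    have "real (n + 1) * \<epsilon> * w \<le> real (n + 1) * \<epsilon> * (real (b + 1) * real (n + 1) * real L^2)"
      using w \<epsilon> by (intro mult_left_mono) auto
    also have "\<dots> = \<epsilon> * ?Z" by (simp add: power2_eq_square)
    also have "\<dots> \<le> \<delta>" by (rule \<epsilon>Z(2))
    finally show ?thesis using w by (simp add: pos_le_divide_eq)
  qed
  have bn: "1 \<le> real (b + 1)" "1 \<le> real (n + 1)" "1 \<le> real L" using L0 by auto
  have L2: "1 \<le> real L^2" "real L \<le> real L^2" using bn(3) self_le_power[of "real L" 2] by auto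
  have Npow: "p powr (\<delta> * s) \<le> N powr s" if "0 \<le> s" for s
  proof -
    have "(p powr \<delta>) powr s \<le> N powr s" using N p that by (intro powr_mono2) auto
    then show ?thesis by (simp add: powr_powr)
  qed
  have AL: "1 \<le> (2 * A)^j" for j using A by (intro one_le_power) auto
  have CA: "1 \<le> C^j" for j using C by (intro one_le_power) auto
  have X0: "0 < X" using X by simp
  from dich show ?thesis
  proof
    assume rX: "r^(d + 1) \<le> C * X"
    have "N^(d + 1) \<le> (C * r * X^k)^(d + 1)" using NX N1 by (intro power_mono) auto
    also have "\<dots> = C^(d + 1) * X^(k * (d + 1)) * r^(d + 1)"
      by (simp add: power_mult_distrib power_mult[symmetric] power_add mult_ac)
    also have "\<dots> \<le> C^(d + 1) * X^(k * (d + 1)) * (C * X)" using rX C X by (intro mult_left_mono) auto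
    also have "\<dots> = C^(d + 2) * X^?e1" by (simp add: power_add mult_ac)
    finally have le: "N^(d + 1) \<le> C^(d + 2) * X^?e1" .
    have "(N^(d + 1)) powr (1 / real ?e1) \<le> C^(d + 2) * X"
      by (rule powr_inverse_le[OF _ CA X0 le]) (use N1 in auto)
    also have "(N^(d + 1)) powr (1 / real ?e1) = N powr (real (d + 1) * (1 / real ?e1))"
      using N1 by (simp add: powr_realpow[symmetric] powr_powr del: of_nat_add of_nat_Suc power_Suc)
    \<comment> \<open>The additional direction replaces \<open>d\<close> by \<open>d + 1\<close> in
      the exponent. The surplus \<open>1 / (?e0 * ?e1)\<close> is worth at least
      \<open>p powr (\<delta> / (?e0 * ?e1))\<close> because \<open>N\<close> is at least
      \<open>p powr \<delta>\<close>.\<close>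
    also have "real (d + 1) * (1 / real ?e1) = ?\<alpha> + 1 / (real ?e0 * real ?e1)"
    proof -
      have "real (d + 1) * real ?e0 = real d * real ?e1 + 1" by (simp add: algebra_simps)
      moreover have "real ?e0 \<noteq> 0" "real ?e1 \<noteq> 0" by linarith+
      ultimately show ?thesis by (simp add: divide_simps del: of_nat_add of_nat_mult)
    qed
    finally have 1: "N powr ?\<alpha> * N powr (1 / (real ?e0 * real ?e1)) \<le> C^(d + 2) * X"
      by (simp only: powr_add)
    have "M powr \<epsilon> \<le> p powr (\<delta> / (real ?e0 * real ?e1))"
    proof (rule Mp, rule small)
      show "0 < real ?e0 * real ?e1" by (intro mult_pos_pos) linarith+
      have "real ?e0 * real ?e1 \<le> real L * real L" using e by (intro mult_mono of_nat_mono) auto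
      also have "\<dots> \<le> (real (b + 1) * real (n + 1)) * real L^2"
        using mult_mono[OF bn(1,2)] by (simp add: power2_eq_square mult_le_cancel_right1)
      finally show "real ?e0 * real ?e1 \<le> real (b + 1) * real (n + 1) * real L^2" .
    qed
    also have "\<dots> \<le> N powr (1 / (real ?e0 * real ?e1))" using Npow[of "1 / (real ?e0 * real ?e1)"] by simp
    finally have "N powr ?\<alpha> * M powr \<epsilon> \<le> N powr ?\<alpha> * N powr (1 / (real ?e0 * real ?e1))"
      by (intro mult_left_mono) auto
    also note 1
    also have "C^(d + 2) * X \<le> (C^(n + 2) * (4 * C * (2 * A)^L)) * X"
    proof (intro mult_right_mono)
      have "C^(d + 2) * 1 \<le> C^(n + 2) * (4 * C * (2 * A)^L)"
        using C AL[of L] d by (intro mult_mono power_increasing) (auto intro: mult_ge1_I)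
      then show "C^(d + 2) \<le> C^(n + 2) * (4 * C * (2 * A)^L)" by simp
    qed (use X in simp)
    finally show ?thesis by simp
  next
    assume B: "r^d \<le> X \<and> r^(d + 1) \<le> N \<and>
      (M \<le> 4 * (A * T^b)^d \<or> r * T \<le> A * T^b + 1 \<or> p \<le> A * T^b * (r * T))"
    have T1: "1 \<le> T" using B r by (simp add: T)
    have XT: "X = r^d * T" using r by (simp add: T)
    have T0: "0 < T" using T1 by simp
    have AT: "1 \<le> A * T^b" using A T1 by (intro mult_ge1_I one_le_power) auto
    have "N^d * T \<le> (C * r * X^k)^d * T" using NX N1 T0 by (intro mult_right_mono power_mono) auto
    also have "\<dots> = C^d * X^(d * k) * (r^d * T)"
      by (simp add: power_mult_distrib power_mult[symmetric] mult_ac)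
    also have "\<dots> = C^d * X^?e0" by (simp add: XT[symmetric])
    finally have le: "N^d * T \<le> C^d * X^?e0" .
    have "(N^d * T) powr (1 / real ?e0) \<le> C^d * X"
      by (rule powr_inverse_le[OF _ CA X0 le]) (use N1 T0 in auto)
    also have "(N^d * T) powr (1 / real ?e0) = (N^d) powr (1 / real ?e0) * T powr (1 / real ?e0)"
      using N1 T0 by (simp add: powr_mult)
    also have "(N^d) powr (1 / real ?e0) = N powr ?\<alpha>"
      using N1 by (simp add: powr_realpow[symmetric] powr_powr)
    finally have 1: "N powr ?\<alpha> * T powr (1 / real ?e0) \<le> C^d * X" .
    \<comment> \<open>All three remaining alternatives take this form: some quantity
      \<open>Y\<close>, a root of which dominates \<open>M powr \<epsilon>\<close>, is bounded by a
      power of \<open>T\<close>. They differ in \<open>Y\<close>, which is \<open>M\<close>,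
      \<open>N\<close> and \<open>p powr \<sigma>\<close> in turn.\<close>
    have gain: "M powr \<epsilon> \<le> D * T powr (1 / real L)"
      if Y: "Y \<le> D * T^j" "0 < j" "1 \<le> D" "M powr \<epsilon> \<le> Y powr (1 / (real j * real L))" "0 \<le> Y" for Y D :: real and j
    proof -
      have "Y powr (1 / real j) \<le> D * T" using Y T0 by (intro powr_inverse_le) auto
      then have "(Y powr (1 / real j)) powr (1 / real L) \<le> D powr (1 / real L) * T powr (1 / real L)"
        using Y T0 by (simp add: powr_mult[symmetric] powr_mono2)
      also have "\<dots> \<le> D powr 1 * T powr (1 / real L)"
        using Y L0 by (intro mult_right_mono powr_mono) auto
      finally show ?thesis using Y by (simp add: powr_powr)
    qed
    have "M powr \<epsilon> \<le> (4 * C * (2 * A)^L) * T powr (1 / real L)"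
      using B[THEN conjunct2, THEN conjunct2]
    proof (elim disjE)
      assume "M \<le> 4 * (A * T^b)^d"
      also have "\<dots> \<le> 4 * (A * T^b)^n" using AT d by (intro mult_left_mono power_increasing) auto
      also have "\<dots> = 4 * A^n * T^(b * n)" by (simp add: power_mult_distrib power_mult)
      also have "\<dots> \<le> 4 * C * (2 * A)^L * T^(b * n)"
      proof (intro mult_right_mono mult_mono)
        have "A^n \<le> (2 * A)^n" using A by (intro power_mono) auto
        also have "\<dots> \<le> (2 * A)^L" using A by (intro power_increasing) (auto simp: L)
        finally show "A^n \<le> (2 * A)^L" .
      qed (use A C T0 in auto)
      finally have Y: "M \<le> 4 * C * (2 * A)^L * T^(b * n)" .
      show ?thesis
      proof (rule gain[OF Y])
        have w: "real (b * n) * real L \<le> ?Z"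
        proof -
          have "real n \<le> real (n + 1)^2" by (simp add: power2_eq_square algebra_simps)
          then have "real b * real n * real L \<le> real (b + 1) * real (n + 1)^2 * real L^2"
            using L2 by (intro mult_mono) auto
          then show ?thesis by simp
        qed
        have w0: "0 < real (b * n) * real L" using b d L0 by simp
        have "\<epsilon> * (real (b * n) * real L) \<le> \<epsilon> * ?Z" using w \<epsilon> by (intro mult_left_mono) auto
        then have "\<epsilon> * (real (b * n) * real L) \<le> 1" using \<epsilon>Z(1) by (rule order_trans)
        then have "\<epsilon> \<le> 1 / (real (b * n) * real L)" using w0 by (simp add: pos_le_divide_eq)
        then show "M powr \<epsilon> \<le> M powr (1 / (real (b * n) * real L))" using M by (intro powr_mono) auto
        show "0 < b * n" using b d by simp
        show "1 \<le> 4 * C * (2 * A)^L" using C AL[of L] by (intro mult_ge1_I) auto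
      qed (use M in simp)
    next
      assume "r * T \<le> A * T^b + 1"
      then have "r * T \<le> 2 * A * T^b" using AT by linarith
      moreover have "r * 1 \<le> r * T" using T1 r by (intro mult_left_mono) auto
      \<comment> \<open>Once \<open>r\<close> is bounded by a power of \<open>T\<close>, so is
        \<open>N\<close>, which is at most \<open>C * r^(1 + d * k) * T^k\<close>.\<close>
      ultimately have r2: "r \<le> 2 * A * T^b" by simp
      have "N \<le> C * r * (r^d * T)^k" using NX XT by simp
      also have "\<dots> = C * (r^?e0 * T^k)" by (simp add: power_mult_distrib power_mult[symmetric])
      also have "\<dots> \<le> C * ((2 * A * T^b)^L * T^k)"
      proof (intro mult_left_mono mult_right_mono)
        have "r^?e0 \<le> (2 * A * T^b)^?e0" using r2 r by (intro power_mono) auto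
        also have "\<dots> \<le> (2 * A * T^b)^L" using AT e by (intro power_increasing) auto
        finally show "r^?e0 \<le> (2 * A * T^b)^L" .
      qed (use C T0 in auto)
      also have "\<dots> = C * (2 * A)^L * T^(b * L + k)"
        by (simp add: power_mult_distrib power_mult power_add)
      also have "\<dots> \<le> 4 * C * (2 * A)^L * T^((b + 1) * L)"
        using C A T1 k by (intro mult_mono power_increasing) (auto simp: L)
      finally have Y: "N \<le> 4 * C * (2 * A)^L * T^((b + 1) * L)" .
      show ?thesis
      proof (rule gain[OF Y])
        let ?w = "real ((b + 1) * L) * real L"
        have w0: "0 < ?w" using L0 by (intro mult_pos_pos of_nat_0_less_iff[THEN iffD2]) auto
        have "?w = real (b + 1) * 1 * real L^2" unfolding of_nat_mult power2_eq_square by simp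
        also have "\<dots> \<le> real (b + 1) * real (n + 1) * real L^2" by (intro mult_right_mono mult_left_mono) auto
        finally have "M powr \<epsilon> \<le> p powr (\<delta> / ?w)" using w0 by (intro Mp small)
        also have "\<dots> \<le> N powr (1 / ?w)" using Npow[of "1 / ?w"] w0 by simp
        finally show "M powr \<epsilon> \<le> N powr (1 / ?w)" .
        show "0 < (b + 1) * L" using L0 by simp
        show "1 \<le> 4 * C * (2 * A)^L" using C AL[of L] by (intro mult_ge1_I) auto
      qed (use N1 in simp)
    next
      assume pT: "p \<le> A * T^b * (r * T)"
      define \<sigma> where "\<sigma> = \<delta> / real (d + 1)"
      \<comment> \<open>The upper bound on \<open>N\<close> acts here:
        \<open>r^(d + 1) \<le> N\<close> keeps \<open>r\<close> a factor
        \<open>p powr \<sigma>\<close> below \<open>p\<close>, and this gap must be made up by a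
        power of \<open>T\<close>.\<close>
      have r1: "r \<le> p powr (1 - \<sigma>)"
      proof -
        have "r^(d + 1) \<le> 1 * (p powr (1 - \<sigma>))^(d + 1)"
        proof -
          have "(p powr (1 - \<sigma>))^(d + 1) = p powr ((1 - \<sigma>) * real (d + 1))"
            using p by (simp add: powr_realpow[symmetric] powr_powr del: power_Suc of_nat_Suc)
          also have "(1 - \<sigma>) * real (d + 1) = real d + 1 - \<delta>" by (simp add: \<sigma>_def field_simps)
          finally show ?thesis using B N by linarith
        qed
        then show ?thesis using r p by (simp add: power_mono_iff del: power_Suc)
      qed
      have "p = p powr \<sigma> * p powr (1 - \<sigma>)" using p by (simp add: powr_add[symmetric])
      then have "p powr \<sigma> * p powr (1 - \<sigma>) \<le> A * T^(b + 1) * r" using pT by (simp add: mult_ac)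
      also have "\<dots> \<le> A * T^(b + 1) * p powr (1 - \<sigma>)" using r1 A T0 by (intro mult_left_mono) auto
      finally have "p powr \<sigma> \<le> A * T^(b + 1)" using p by (simp only: mult_le_cancel_right_pos powr_gt_zero)
      also have "\<dots> \<le> 4 * C * (2 * A)^L * T^(b + 1)"
      proof (intro mult_right_mono)
        have "A \<le> (2 * A)^1" using A by simp
        also have "\<dots> \<le> (2 * A)^L" using A L0 by (intro power_increasing) auto
        also have "(2 * A)^L = 1 * (2 * A)^L" by simp
        also have "\<dots> \<le> (4 * C) * (2 * A)^L" using C A by (intro mult_right_mono) auto
        finally show "A \<le> 4 * C * (2 * A)^L" .
      qed (use T0 in simp)
      finally have Y: "p powr \<sigma> \<le> 4 * C * (2 * A)^L * T^(b + 1)" .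
      show ?thesis
      proof (rule gain[OF Y])
        let ?w = "real (d + 1) * (real (b + 1) * real L)"
        have w0: "0 < ?w" using L0 by simp
        have "?w = real (b + 1) * real (d + 1) * real L" by simp
        also have "\<dots> \<le> real (b + 1) * real (n + 1) * real L^2"
          using L2 d by (intro mult_mono) auto
        finally have "M powr \<epsilon> \<le> p powr (\<delta> / ?w)" using w0 by (intro Mp small)
        also have "\<delta> / ?w = \<sigma> * (1 / (real (b + 1) * real L))" by (simp add: \<sigma>_def)
        finally show "M powr \<epsilon> \<le> (p powr \<sigma>) powr (1 / (real (b + 1) * real L))" by (simp only: powr_powr)
        show "1 \<le> 4 * C * (2 * A)^L" using C AL[of L] by (intro mult_ge1_I) auto
      qed auto
    qed
    also have "\<dots> \<le> (4 * C * (2 * A)^L) * T powr (1 / real ?e0)"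
    proof (intro mult_left_mono powr_mono)
      have "0 < real ?e0" unfolding of_nat_0_less_iff by simp
      then show "1 / real L \<le> 1 / real ?e0" by (intro frac_le of_nat_mono e(1)) auto
    qed (use T1 C A in auto)
    finally have "N powr ?\<alpha> * M powr \<epsilon> \<le> N powr ?\<alpha> * ((4 * C * (2 * A)^L) * T powr (1 / real ?e0))"
      by (intro mult_left_mono) auto
    also have "\<dots> = (4 * C * (2 * A)^L) * (N powr ?\<alpha> * T powr (1 / real ?e0))" by (simp only: mult_ac)
    also have "\<dots> \<le> (4 * C * (2 * A)^L) * (C^d * X)" using 1 A C by (intro mult_left_mono) auto
    also have "\<dots> \<le> (4 * C * (2 * A)^L) * (C^(n + 2) * X)"
      using A C X d by (intro mult_left_mono mult_right_mono power_increasing) auto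
    finally show ?thesis by (simp add: mult_ac)
  qed
qed

theorem theorem1p11:
  fixes n :: nat
  assumes "n \<ge> 2"
  shows "\<exists>c::real. c > 0 \<and> (\<forall>\<delta>::real. \<delta> > 0 \<longrightarrow> (\<exists>\<epsilon>::real. \<epsilon> > 0 \<and>
    (\<forall>(d::nat) (m::nat) (p::nat) (E :: (nat \<Rightarrow> int) set set) (K :: (nat \<Rightarrow> int) set).
      d \<ge> 1 \<longrightarrow> 1 \<le> m \<longrightarrow> m \<le> n - 1 \<longrightarrow> prime p \<longrightarrow>
      E \<subseteq> Gr p n (n - m) \<longrightarrow> K \<subseteq> carrier (Fpn p n) \<longrightarrow>
      real (card E) \<ge> 2 * real p powr (real m * real (n - m) - real m + real d - 1) \<longrightarrow>
      real p powr \<delta> \<le> real (card K) \<longrightarrow>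
      real (card K) \<le> real p powr (real d + 1 - \<delta>) \<longrightarrow>
      (\<exists>W\<in>E. real (card (quot_proj p n W ` K)) \<ge>
         c * real (card K) powr (real d / (1 + real d * real (n - m)))
           * (real (card E) / real p powr (real m * real (n - m) - real m)) powr \<epsilon>))))"
proof -
  define C :: real where "C = 2 * (real n + 2)"
  define A :: real where "A = 2^1032 * 2^576"
  \<comment> \<open>Here \<open>b\<close> is the exponent of \<open>T\<close> in the quantity
    \<open>G\<close> of the dichotomy, and \<open>p0\<close> is large enough to guarantee both
    \<open>8 \<le> p\<close> and \<open>4 * n \<le> p\<close>.\<close>
  define b L p0 :: nat where "b = 4 * 576" and "L = 1 + n + n^2" and "p0 = 4 * n + 8"
  define Z where "Z = real (b + 1) * real (n + 1)^2 * real L^2"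
  define D where "D = C^(n + 2) * (4 * C * (2 * A)^L)"
  \<comment> \<open>For \<open>p < p0\<close> this covers the trivial bounds
    \<open>card K \<le> p^n\<close> and \<open>card E \<le> 2^(p^n)\<close>. Like \<open>D\<close>
    it depends on \<open>n\<close> alone, so \<open>1 / (D * S)\<close> can be fixed before
    \<delta>.\<close>
  define S :: real where "S = real p0^n * 2^(p0^n)"
  have C1: "1 \<le> C" by (simp add: C_def)
  have A1: "1 \<le> A" unfolding A_def by (intro mult_ge1_I one_le_power) auto
  have D1: "1 \<le> D"
    unfolding D_def using C1 A1 by (intro mult_ge1_I one_le_power) auto
  have S1: "1 \<le> S" unfolding S_def by (intro mult_ge1_I one_le_power) (auto simp: p0_def)
  have Z1: "1 \<le> Z"
  proof -
    have "1 \<le> real (b + 1)" "1 \<le> real (n + 1)" "1 \<le> real L" by (auto simp: L_def)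
    then show ?thesis unfolding Z_def by (intro mult_ge1_I one_le_power)
  qed
  have main: "\<exists>W\<in>E. 1 / (D * S) * real (card K) powr (real d / (1 + real d * real (n - m)))
      * (real (card E) / real p powr (real m * real (n - m) - real m)) powr (min 1 \<delta> / Z)
      \<le> real (card (quot_proj p n W ` K))"
    if \<delta>: "\<delta> > 0" and d: "d \<ge> 1" and m: "1 \<le> m" "m \<le> n - 1" and p: "prime p"
      and E: "E \<subseteq> Gr p n (n - m)" and K: "K \<subseteq> carrier (Fpn p n)"
      and large: "real (card E) \<ge> 2 * real p powr (real m * real (n - m) - real m + real d - 1)"
      and N: "real p powr \<delta> \<le> real (card K)" "real (card K) \<le> real p powr (real d + 1 - \<delta>)"
    for \<delta> :: real and d m p :: nat and E :: "(nat \<Rightarrow> int) set set" and K :: "(nat \<Rightarrow> int) set"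
  proof -
    define k where "k = n - m"
    have k: "1 \<le> k" "k < n" "n - k = m" "k \<le> n" using m assms by (auto simp: k_def)
    have p2: "2 \<le> real p" using prime_ge_2_nat[OF p] by simp
    have finC: "finite (carrier (Fpn p n))" by (simp add: Fpn_simps[OF p] finite_PiE)
    have cC: "card (carrier (Fpn p n)) = p^n" by (simp add: Fpn_simps[OF p] card_PiE)
    define Q where "Q = real p^(m * (k - 1))"
    define M where "M = real (card E) / Q"
    define \<epsilon> where "\<epsilon> = min 1 \<delta> / Z"
    let ?\<alpha> = "real d / (1 + real d * real k)" and ?N = "real (card K)"
    have \<epsilon>: "0 < \<epsilon>" "\<epsilon> * Z \<le> min 1 \<delta>" "\<epsilon> \<le> 1"
      using \<delta> Z1 by (auto simp: \<epsilon>_def divide_le_eq)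
    have e1: "real m * real k - real m = real (m * (k - 1))"
      using k by (simp add: of_nat_diff algebra_simps)
    have Q: "real p powr (real m * real k - real m) = Q"
      unfolding e1 Q_def using p2 by (intro powr_realpow) simp
    have Q1: "1 \<le> Q" unfolding Q_def using p2 by (intro one_le_power) simp
    have large': "2 * real p^(m * (k - 1) + d - 1) \<le> real (card E)"
    proof -
      have "real m * real k - real m + real d - 1 = real (m * (k - 1) + d - 1)"
        unfolding e1 using d by (simp add: of_nat_diff)
      then have "2 * real p powr real (m * (k - 1) + d - 1) \<le> real (card E)"
        using large[folded k_def] by (simp only:)
      moreover have "real p powr real (m * (k - 1) + d - 1) = real p^(m * (k - 1) + d - 1)"
        using p2 by (intro powr_realpow) simp
      ultimately show ?thesis by (simp only:)
    qed
    have M1: "1 \<le> M"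
    proof -
      have "Q \<le> real p^(m * (k - 1) + d - 1)" unfolding Q_def using p2 d by (intro power_increasing) auto
      then show ?thesis using large' Q1 by (simp add: M_def)
    qed
    have cE: "0 < card E" using M1 by (cases "card E") (auto simp: M_def)
    then have finE: "finite E" "E \<noteq> {}" by (auto simp: card_gt_0_iff)
    have N1: "1 \<le> ?N"
    proof -
      have "1 \<le> real p powr \<delta>" using p2 \<delta> by (intro ge_one_powr_ge_zero) auto
      then show ?thesis using N by linarith
    qed
    then have K': "K \<noteq> {}" "finite K" using finC K finite_subset by auto
    \<comment> \<open>For the member with the largest projection, the uniform upper bound
      \<open>X\<close> over \<open>E\<close> is attained, so a lower bound on \<open>X\<close> is
      the claim for this \<open>W\<close>.\<close>
    obtain W where W: "W \<in> E"
      "\<And>W'. W' \<in> E \<Longrightarrow> card (quot_proj p n W' ` K) \<le> card (quot_proj p n W ` K)"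
      using exists_maximum[OF finE, of "\<lambda>W. real (card (quot_proj p n W ` K))"] by auto
    define X where "X = card (quot_proj p n W ` K)"
    have "X \<noteq> 0" using K' by (simp add: X_def)
    then have X1: "1 \<le> real X" by linarith
    have le: "?N powr ?\<alpha> * M powr \<epsilon> \<le> D * S * real X"
    proof (cases "p < p0")
      case True
      have "?N powr ?\<alpha> \<le> ?N powr 1"
      proof (intro powr_mono)
        have "real d * 1 \<le> real d * real k" using k by (intro mult_left_mono) auto
        then show "?\<alpha> \<le> 1" by (simp add: divide_le_eq)
      qed (rule N1)
      also have "\<dots> = ?N" using N1 by simp
      also have "\<dots> \<le> real p^n" using card_mono[OF finC K] cC by (simp flip: of_nat_power)
      also have "\<dots> \<le> real p0^n" using True by (intro power_mono) auto
      finally have 1: "?N powr ?\<alpha> \<le> real p0^n" .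
      have "M powr \<epsilon> \<le> M powr 1" using \<epsilon>(3) M1 by (intro powr_mono) auto
      also have "\<dots> = M" using M1 by simp
      also have "\<dots> \<le> real (card E)" using Q1 by (simp add: M_def divide_le_eq mult_le_cancel_left1)
      also have "\<dots> \<le> real (2^(p^n))"
      proof -
        have "E \<subseteq> Pow (carrier (Fpn p n))" using E Gr_submodule submodule.subset by blast
        then have "card E \<le> card (Pow (carrier (Fpn p n)))" using finC by (intro card_mono) auto
        then show ?thesis by (simp add: card_Pow finC cC)
      qed
      also have "\<dots> \<le> 2^(p0^n)"
        using True by (simp add: power_increasing power_mono)
      finally have 2: "M powr \<epsilon> \<le> 2^(p0^n)" .
      have "?N powr ?\<alpha> * M powr \<epsilon> \<le> S" unfolding S_def using 1 2 by (intro mult_mono) auto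
      also have "\<dots> \<le> D * S * real X" using D1 S1 X1 mult_ge1_I[OF D1 X1]
        by (simp add: mult_le_cancel_right1 mult.commute mult.left_commute)
      finally show ?thesis .
    next
      case False
      then have p8: "8 \<le> p" "4 * n \<le> p" by (auto simp: p0_def)
      have EG: "E \<subseteq> Gr p n k" using E by (simp add: k_def)
      have lrg: "2 * real p^((n - k) * (k - 1) + d - 1) \<le> real (card E)" using large' k by simp
      have XX: "\<forall>W'\<in>E. card (quot_proj p n W' ` K) \<le> X" using W by (simp add: X_def)
      have MM: "real (card E) / real p^((n - k) * (k - 1)) = M" using k by (simp add: M_def Q_def)
      note dich = projection_bound_prime[OF p, unfolded projection_bound_def, rule_format,
          OF k(1,2) d p8 EG K K'(1) lrg XX[rule_format], unfolded Let_def MM, folded C_def]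
      from dich have dn: "d \<le> n" and Mlt: "M < 2 * real p^(n - k)" by blast+
      from dich obtain r :: real where r: "r > 0" "?N \<le> C * r * real X^k"
        "r^(d + 1) \<le> C * real X \<or> r^d \<le> real X \<and> r^(d + 1) \<le> ?N \<and>
         (M \<le> 4 * (2^1032 * (2 * (real X / r^d)^4)^576)^d
          \<or> r * (real X / r^d) \<le> 2^1032 * (2 * (real X / r^d)^4)^576 + 1
          \<or> real p \<le> 2^1032 * (2 * (real X / r^d)^4)^576 * (r * (real X / r^d)))"
        by blast
      have G: "2^1032 * (2 * t^4)^576 = A * t^b" for t :: real
        by (simp only: A_def b_def power_mult_distrib power_mult mult.assoc)
      have Mn: "M \<le> 2 * real p^n"
      proof -
        have "real p^(n - k) \<le> real p^n" using p2 by (intro power_increasing) auto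
        then show ?thesis using Mlt by linarith
      qed
      have b1: "1 \<le> b" by (simp add: b_def)
      have "?N powr ?\<alpha> * M powr \<epsilon> \<le> D * real X"
        unfolding D_def
        by (rule dichotomy_lower_bound[OF k(4) d dn A1 C1 b1 L_def p2 \<delta> \<epsilon>(1) \<epsilon>(2)[unfolded Z_def]
              N M1 Mn X1 r(1,2) refl r(3)[unfolded G]])
      also have "\<dots> \<le> D * S * real X"
        using D1 S1 X1 by (intro mult_right_mono) (auto simp: mult_le_cancel_left1)
      finally show ?thesis .
    qed
    have DS: "0 < D * S" using D1 S1 by (intro mult_pos_pos) auto
    have "1 / (D * S) * (?N powr ?\<alpha> * M powr \<epsilon>) \<le> 1 / (D * S) * (D * S * real X)"
      using DS by (intro mult_left_mono le) auto
    also have "\<dots> = real X"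
    proof -
      have "D \<noteq> 0" "S \<noteq> 0" using D1 S1 by auto
      then show ?thesis by simp
    qed
    finally show ?thesis
      using W(1) unfolding X_def k_def[symmetric] Q M_def[symmetric] \<epsilon>_def[symmetric] mult.assoc by blast
  qed
  have "0 < 1 / (D * S)" using D1 S1 by simp
  moreover have "0 < min 1 \<delta> / Z" if "\<delta> > 0" for \<delta> :: real using that Z1 by simp
  ultimately show ?thesis using main by blast
qed

end
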